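(* Consider the stationary vacuum field equations for data $(g_S,u,\phi)$ on $S$, $$\begin{cases}\mathrm{Ric}_{g_S}-D^2u-du\otimes du-2e^{-4u}(d\phi\otimes d\phi-|d\phi|^2g_S)=0,\\ \Delta_{g_S}u-|du|^2-2e^{-4u}|d\phi|^2=0,\\ \Delta_{g_S}\phi+3\langle du,d\phi\rangle=0,\end{cases}$$ together with the boundary conditions on $\partial S$ $$g_S^T=\gamma,\qquad H_{g_S}=\lambda,\qquad \mathbf n_{g_S}(\phi)=f,$$ with prescribed $\gamma\in Met^{m,\alpha}(\partial S)$ and $\lambda,f\in C^{m-1,\alpha}(\partial S)$. These equations and boundary conditions form an elliptic boundary value problem modulo gauge transformations, i.e.: if $(g_S,u,\phi)\in [Met^{m,\alpha}_\delta\times C^{m,\alpha}_\delta\times C^{m,\alpha}_\delta](S)$ is a zero of the gauged operator $\mathcal P_S=(\mathcal L_S,\mathcal B_S)$ defined in the context, with reference metric $\tilde g_S=g_S$, then the linearization of $\mathcal P_S$ at $(g_S,u,\phi)$ is an elliptic boundary value operator in the sense of Agmon–Douglis–Nirenberg.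
   Context: Manifold and function spaces. $S$ is a smooth 3-manifold with boundary diffeomorphic to $\mathbb R^3\setminus B^3$, $B^3$ the (open) unit 3-ball; coordinates $x^i$ and the radius function $r$ on $S$ are pulled back from $\mathbb R^3\setminus B^3$ by a fixed diffeomorphism. Fix an integer $m\ge2$, $0<\alpha<1$, and a decay rate $\tfrac12<\delta<1$. $C^{m,\alpha}_\delta(S)$ is the Banach space of functions $v$ on $S$ with finite norm $\sum_{k=0}^m\sup r^{k+\delta}|\nabla^kv|+\sup_{x\ne y}\min(r(x),r(y))^{m+\alpha+\delta}\frac{|\nabla^mv(x)-\nabla^mv(y)|}{|x-y|^\alpha}$. $Met^{m,\alpha}_\delta(S)$ is the set of Riemannian metrics $g$ with $g_{ij}-\delta_{ij}\in C^{m,\alpha}_\delta(S)$. $Met^{m,\alpha}(\partial S)$ is the space of $C^{m,\alpha}$ metrics on $\partial S$. Conventions. For a metric $g$: $D^2u$ is the Hessian, $\Delta_g u=-\mathrm{tr}_gD^2u$, $\delta_g=-\mathrm{tr}_g\nabla$ is the divergence, $\delta_g^*X=\frac12L_Xg$ its formal adjoint. $\mathbf n_g$ is the outward unit normal of $\partial S$ in $(S,g)$, $H_g=\mathrm{tr}A_g$ the mean curvature with $A_g=\frac12L_{\mathbf n}g$, and $g^T$ the metric induced on $\partial S$. Norms and inner products in the equations are with respect to $g_S$; $s_{g_S}$ is the scalar curvature. Gauged operator. Fix a reference metric $\tilde g_S$ near $g_S$. Put $$T_S=-\tfrac12\big(s_{g_S}+4\Delta_{g_S}u-4|du|^2-2e^{-4u}|d\phi|^2\big)g_S,\qquad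 G_S=\delta_{e^{2u}\tilde g_S}(e^{2u}g_S).$$ $\mathcal L_S(g_S,u,\phi)$ has the three components (i) $2\big[\mathrm{Ric}_{g_S}-D^2u-du\otimes du-2e^{-4u}(d\phi\otimes d\phi-|d\phi|^2g_S)+(\Delta_{g_S}u-|du|^2-2e^{-4u}|d\phi|^2)g_S+T_S+\delta^*_{e^{2u}g_S}G_S\big]$, (ii) $8e^{-2u}(\Delta_{g_S}u-|du|^2-2e^{-4u}|d\phi|^2)$, (iii) $8e^{-6u}(\Delta_{g_S}\phi+3\langle du,d\phi\rangle)$, and $\mathcal B_S(g_S,u,\phi)=\{G_S|_{\partial S},\ g_S^T-\gamma,\ H_{g_S}-\lambda,\ \mathbf n_{g_S}(\phi)-f\}$ on $\partial S$. Ellipticity (Agmon–Douglis–Nirenberg). For a linear operator $P=(L,B)$ with interior operator $L$ and boundary operator $B$, let $L(\xi)$, $B(\xi)$ be the matrices of principal symbols (the principal part of each component being that of its own leading order; here the components of the linearization of $\mathcal L_S$ have order 2, and those of $\mathcal B_S$ have orders $1,0,1,1$ respectively). $P$ is elliptic if (A) $l(\xi)=\det L(\xi)$ has no nontrivial real root $\xi$; and (B) for every nonzero tangential 1-form $\eta$ to $\partial S$ and unit conormal $\mu$, with $L^*(\xi)$ the adjoint (adjugate) matrix of $L(\xi)$, the rows of $B(\eta+z\mu)L^*(\eta+z\mu)$ are linearly independent modulo $l^+(z)=\prod(z-z_k)$, where $z_k$ are the roots of $l(\eta+z\mu)=0$ with positive imaginary part. *)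

theory Defs
  imports "HOL-Analysis.Analysis" "HOL-Computational_Algebra.Polynomial"
begin

text \<open>
  The manifold \<open>S\<close> is identified with \<open>\<real>\<^sup>3\<close> minus the open unit ball by the fixed
  diffeomorphism, so that tensor fields on \<open>S\<close> are given by their components in the coordinates
  \<open>x\<^sup>i\<close>, and the radius function is \<^const>\<open>norm\<close>.  Values outside \<open>S\<close> are irrelevant:
  every derivative below is taken within the set in question.
\<close>

definition ext :: "(real^3) set"
  where "ext = {x. 1 \<le> norm x}"

definition bdry :: "(real^3) set"
  where "bdry = sphere 0 1"

definition tangent :: "real^3 \<Rightarrow> (real^3) set"
  where "tangent x = {v. v \<bullet> x = 0}"


section \<open>Function spaces\<close>

definition pd :: "(real^'n) set \<Rightarrow> 'n \<Rightarrow> (real^'n \<Rightarrow> real) \<Rightarrow> real^'n \<Rightarrow> real"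
  where "pd M i f x = frechet_derivative f (at x within M) (axis i 1)"

fun pds :: "(real^'n) set \<Rightarrow> 'n list \<Rightarrow> (real^'n \<Rightarrow> real) \<Rightarrow> real^'n \<Rightarrow> real" where
  "pds M [] f = f"
| "pds M (i # is) f = pd M i (pds M is f)"

text \<open>\<open>k\<close> times continuously differentiable up to the boundary of \<open>M\<close>.\<close>

definition Ck :: "nat \<Rightarrow> (real^'n) set \<Rightarrow> (real^'n \<Rightarrow> real) \<Rightarrow> bool"
  where "Ck k M f \<longleftrightarrow>
    (\<forall>is. length is < k \<longrightarrow> pds M is f differentiable_on M) \<and>
    (\<forall>is. length is \<le> k \<longrightarrow> continuous_on M (pds M is f))"

definition jet_norm :: "nat \<Rightarrow> (real^'n::finite) set \<Rightarrow> (real^'n \<Rightarrow> real) \<Rightarrow> real^'n \<Rightarrow> real"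
  where "jet_norm k M f x = sqrt (\<Sum>is | length is = k. (pds M is f x)\<^sup>2)"

definition jet_dist ::
    "nat \<Rightarrow> (real^'n::finite) set \<Rightarrow> (real^'n \<Rightarrow> real) \<Rightarrow> real^'n \<Rightarrow> real^'n \<Rightarrow> real"
  where "jet_dist k M f x y = sqrt (\<Sum>is | length is = k. (pds M is f x - pds M is f y)\<^sup>2)"

definition holder :: "nat \<Rightarrow> real \<Rightarrow> (real^'n::finite) set \<Rightarrow> (real^'n \<Rightarrow> real) set"
  where "holder k \<alpha> M = {f. Ck k M f \<and>
    (\<forall>j\<le>k. bdd_above (jet_norm j M f ` M)) \<and>
    bdd_above {jet_dist k M f x y / dist x y powr \<alpha> | x y. x \<in> M \<and> y \<in> M \<and> x \<noteq> y}}"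

definition whol :: "nat \<Rightarrow> real \<Rightarrow> real \<Rightarrow> (real^3 \<Rightarrow> real) set"
  where "whol m \<alpha> \<delta> = {f. Ck m ext f \<and>
    (\<forall>k\<le>m. bdd_above ((\<lambda>x. norm x powr (real k + \<delta>) * jet_norm k ext f x) ` ext)) \<and>
    bdd_above {min (norm x) (norm y) powr (real m + \<alpha> + \<delta>) *
        (jet_dist m ext f x y / dist x y powr \<alpha>) | x y. x \<in> ext \<and> y \<in> ext \<and> x \<noteq> y}}"

type_synonym tensor2 = "real^3 \<Rightarrow> real^3^3"
type_synonym vfield = "real^3 \<Rightarrow> real^3"

definition Met :: "nat \<Rightarrow> real \<Rightarrow> real \<Rightarrow> tensor2 set"
  where "Met m \<alpha> \<delta> = {g.
    (\<forall>x\<in>ext. transpose (g x) = g x \<and> (\<forall>v. v \<noteq> 0 \<longrightarrow> v \<bullet> (g x *v v) > 0)) \<and>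
    (\<forall>i j. (\<lambda>x. g x $ i $ j - mat 1 $ i $ j) \<in> whol m \<alpha> \<delta>)}"

text \<open>
  Inverse stereographic projections from the two poles; for \<open>s = 1\<close> and \<open>s = - 1\<close> they map the
  closed unit disc onto the two closed hemispheres, so Hoelder regularity on the sphere is Hoelder
  regularity on the disc in these two charts.
\<close>

definition stereo :: "real \<Rightarrow> real^2 \<Rightarrow> real^3"
  where "stereo s y = (1 / (1 + (norm y)\<^sup>2)) *\<^sub>R
    vector [2 * y $ 1, 2 * y $ 2, s * (1 - (norm y)\<^sup>2)]"

definition stereo_frame :: "real \<Rightarrow> 2 \<Rightarrow> real^2 \<Rightarrow> real^3"
  where "stereo_frame s a y = (\<chi> k. pd (cball 0 1) a (\<lambda>z. stereo s z $ k) y)"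

definition bdry_holder :: "nat \<Rightarrow> real \<Rightarrow> (real^3 \<Rightarrow> real) set"
  where "bdry_holder k \<alpha> = {f. \<forall>s\<in>{1, -1}. (\<lambda>y. f (stereo s y)) \<in> holder k \<alpha> (cball 0 1)}"

text \<open>
  A bilinear form on the tangent plane of the sphere at \<open>x\<close> is given by any \<open>3 \<times> 3\<close> matrix
  extending it; only the values on tangent vectors are ever used.
\<close>

definition bdry_Met :: "nat \<Rightarrow> real \<Rightarrow> tensor2 set"
  where "bdry_Met m \<alpha> = {\<gamma>.
    (\<forall>x\<in>bdry. \<forall>v\<in>tangent x. \<forall>w\<in>tangent x. v \<bullet> (\<gamma> x *v w) = w \<bullet> (\<gamma> x *v v)) \<and>
    (\<forall>x\<in>bdry. \<forall>v\<in>tangent x. v \<noteq> 0 \<longrightarrow> v \<bullet> (\<gamma> x *v v) > 0) \<and>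
    (\<forall>s\<in>{1, -1}. \<forall>a b.
       (\<lambda>y. stereo_frame s a y \<bullet> (\<gamma> (stereo s y) *v stereo_frame s b y))
         \<in> holder m \<alpha> (cball 0 1))}"


section \<open>Riemannian geometry of \<open>S\<close> in coordinates\<close>

abbreviation pdS :: "3 \<Rightarrow> (real^3 \<Rightarrow> real) \<Rightarrow> real^3 \<Rightarrow> real"
  where "pdS \<equiv> pd ext"

definition ginv :: "tensor2 \<Rightarrow> tensor2"
  where "ginv g x = matrix_inv (g x)"

definition d :: "(real^3 \<Rightarrow> real) \<Rightarrow> vfield"
  where "d u x = (\<chi> i. pdS i u x)"

definition ip :: "tensor2 \<Rightarrow> real^3 \<Rightarrow> real^3 \<Rightarrow> real^3 \<Rightarrow> real"
  where "ip g x \<xi> \<omega> = (\<Sum>i\<in>UNIV. \<Sum>j\<in>UNIV. ginv g x $ i $ j * \<xi> $ i * \<omega> $ j)"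

definition tr :: "tensor2 \<Rightarrow> tensor2 \<Rightarrow> real^3 \<Rightarrow> real"
  where "tr g k x = (\<Sum>i\<in>UNIV. \<Sum>j\<in>UNIV. ginv g x $ i $ j * k x $ i $ j)"

definition tensor :: "real^3 \<Rightarrow> real^3 \<Rightarrow> real^3^3"
  where "tensor \<xi> \<omega> = (\<chi> i j. \<xi> $ i * \<omega> $ j)"

definition christoffel :: "tensor2 \<Rightarrow> 3 \<Rightarrow> 3 \<Rightarrow> 3 \<Rightarrow> real^3 \<Rightarrow> real"
  where "christoffel g k i j x = (\<Sum>l\<in>UNIV. ginv g x $ k $ l *
    (pdS i (\<lambda>y. g y $ j $ l) x + pdS j (\<lambda>y. g y $ i $ l) x - pdS l (\<lambda>y. g y $ i $ j) x)) / 2"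

definition Ric :: "tensor2 \<Rightarrow> tensor2"
  where "Ric g x = (\<chi> i j. \<Sum>k\<in>UNIV.
      pdS k (christoffel g k i j) x - pdS i (christoffel g k k j) x
    + (\<Sum>l\<in>UNIV. christoffel g k k l x * christoffel g l i j x
                 - christoffel g k i l x * christoffel g l k j x))"

definition scal :: "tensor2 \<Rightarrow> real^3 \<Rightarrow> real"
  where "scal g x = tr g (Ric g) x"

definition Hess :: "tensor2 \<Rightarrow> (real^3 \<Rightarrow> real) \<Rightarrow> tensor2"
  where "Hess g u x = (\<chi> i j. pdS i (pdS j u) x - (\<Sum>k\<in>UNIV. christoffel g k i j x * pdS k u x))"

definition Lap :: "tensor2 \<Rightarrow> (real^3 \<Rightarrow> real) \<Rightarrow> real^3 \<Rightarrow> real"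
  where "Lap g u x = - tr g (Hess g u) x"

text \<open>\<open>cov g k i x $ a $ b\<close> is \<open>(\<nabla>\<^sub>i k)\<^sub>a\<^sub>b\<close>.\<close>

definition cov :: "tensor2 \<Rightarrow> tensor2 \<Rightarrow> 3 \<Rightarrow> tensor2"
  where "cov g k i x = (\<chi> a b. pdS i (\<lambda>y. k y $ a $ b) x
    - (\<Sum>p\<in>UNIV. christoffel g p i a x * k x $ p $ b + christoffel g p i b x * k x $ a $ p))"

definition diverg :: "tensor2 \<Rightarrow> tensor2 \<Rightarrow> vfield"
  where "diverg g k x =
    (\<chi> b. - (\<Sum>i\<in>UNIV. \<Sum>a\<in>UNIV. ginv g x $ i $ a * cov g k i x $ a $ b))"

definition Lie :: "vfield \<Rightarrow> tensor2 \<Rightarrow> tensor2"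
  where "Lie X k x = (\<chi> i j. \<Sum>l\<in>UNIV. X x $ l * pdS l (\<lambda>y. k y $ i $ j) x
    + k x $ l $ j * pdS i (\<lambda>y. X y $ l) x + k x $ i $ l * pdS j (\<lambda>y. X y $ l) x)"

definition sharp :: "tensor2 \<Rightarrow> vfield \<Rightarrow> vfield"
  where "sharp g \<omega> x = ginv g x *v \<omega> x"

text \<open>\<open>\<delta>\<^sup>*\<close> on 1-forms, which are identified with vector fields by the metric.\<close>

definition dstar :: "tensor2 \<Rightarrow> vfield \<Rightarrow> tensor2"
  where "dstar g \<omega> x = (1/2) *\<^sub>R Lie (sharp g \<omega>) g x"

text \<open>
  Unit normal of the coordinate spheres pointing towards the origin; on the unit sphere it is the
  outward unit normal of \<open>\<partial>S\<close> in \<open>S\<close>.  Only the tangential part of \<open>A\<close> enters the mean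
  curvature, and it does not depend on the extension of the normal off \<open>\<partial>S\<close>.
\<close>

definition normal :: "tensor2 \<Rightarrow> vfield"
  where "normal g x = (- 1 / sqrt (ip g x x x)) *\<^sub>R (ginv g x *v x)"

definition mean_curv :: "tensor2 \<Rightarrow> real^3 \<Rightarrow> real"
  where "mean_curv g x = (\<Sum>i\<in>UNIV. \<Sum>j\<in>UNIV.
    (ginv g x $ i $ j - normal g x $ i * normal g x $ j) * ((1/2) *\<^sub>R Lie (normal g) g x) $ i $ j)"


section \<open>The gauged operator\<close>

type_synonym fields = "tensor2 \<times> (real^3 \<Rightarrow> real) \<times> (real^3 \<Rightarrow> real)"

text \<open>Boundary data: the gauge 1-form, a form on the tangent planes of \<open>\<partial>S\<close>, two functions.\<close>

type_synonym bdata = "vfield \<times> tensor2 \<times> (real^3 \<Rightarrow> real) \<times> (real^3 \<Rightarrow> real)"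

definition conf :: "(real^3 \<Rightarrow> real) \<Rightarrow> tensor2 \<Rightarrow> tensor2"
  where "conf u g x = exp (2 * u x) *\<^sub>R g x"

definition gauge :: "tensor2 \<Rightarrow> tensor2 \<Rightarrow> (real^3 \<Rightarrow> real) \<Rightarrow> vfield"
  where "gauge g0 g u = diverg (conf u g0) (conf u g)"

definition T_S :: "tensor2 \<Rightarrow> (real^3 \<Rightarrow> real) \<Rightarrow> (real^3 \<Rightarrow> real) \<Rightarrow> tensor2"
  where "T_S g u \<phi> x = (- (1/2) * (scal g x + 4 * Lap g u x - 4 * ip g x (d u x) (d u x)
    - 2 * exp (- 4 * u x) * ip g x (d \<phi> x) (d \<phi> x))) *\<^sub>R g x"

definition L_metric :: "tensor2 \<Rightarrow> tensor2 \<Rightarrow> (real^3 \<Rightarrow> real) \<Rightarrow> (real^3 \<Rightarrow> real) \<Rightarrow> tensor2"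
  where "L_metric g0 g u \<phi> x = 2 *\<^sub>R
    (Ric g x - Hess g u x - tensor (d u x) (d u x)
     - (2 * exp (- 4 * u x)) *\<^sub>R (tensor (d \<phi> x) (d \<phi> x) - ip g x (d \<phi> x) (d \<phi> x) *\<^sub>R g x)
     + (Lap g u x - ip g x (d u x) (d u x)
        - 2 * exp (- 4 * u x) * ip g x (d \<phi> x) (d \<phi> x)) *\<^sub>R g x
     + T_S g u \<phi> x + dstar (conf u g) (gauge g0 g u) x)"

definition L_u :: "tensor2 \<Rightarrow> (real^3 \<Rightarrow> real) \<Rightarrow> (real^3 \<Rightarrow> real) \<Rightarrow> real^3 \<Rightarrow> real"
  where "L_u g u \<phi> x = 8 * exp (- 2 * u x) * (Lap g u x - ip g x (d u x) (d u x)
    - 2 * exp (- 4 * u x) * ip g x (d \<phi> x) (d \<phi> x))"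

definition L_phi :: "tensor2 \<Rightarrow> (real^3 \<Rightarrow> real) \<Rightarrow> (real^3 \<Rightarrow> real) \<Rightarrow> real^3 \<Rightarrow> real"
  where "L_phi g u \<phi> x = 8 * exp (- 6 * u x) * (Lap g \<phi> x + 3 * ip g x (d u x) (d \<phi> x))"

fun L_S :: "tensor2 \<Rightarrow> fields \<Rightarrow> fields"
  where "L_S g0 (g, u, \<phi>) = (L_metric g0 g u \<phi>, L_u g u \<phi>, L_phi g u \<phi>)"

fun B_S :: "tensor2 \<Rightarrow> tensor2 \<Rightarrow> (real^3 \<Rightarrow> real) \<Rightarrow> (real^3 \<Rightarrow> real) \<Rightarrow> fields \<Rightarrow> bdata"
  where "B_S g0 \<gamma> lam f (g, u, \<phi>) =
    (gauge g0 g u,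
     \<lambda>x. g x - \<gamma> x,
     \<lambda>x. mean_curv g x - lam x,
     \<lambda>x. normal g x \<bullet> d \<phi> x - f x)"

text \<open>Vanishing on \<open>S\<close>, and vanishing on \<open>\<partial>S\<close> of the sections represented by the data.\<close>

fun int_zero :: "fields \<Rightarrow> bool"
  where "int_zero (k, v, \<psi>) \<longleftrightarrow> (\<forall>x\<in>ext. k x = 0 \<and> v x = 0 \<and> \<psi> x = 0)"

fun bdry_zero :: "bdata \<Rightarrow> bool"
  where "bdry_zero (\<omega>, k, a, b) \<longleftrightarrow> (\<forall>x\<in>bdry. \<omega> x = 0 \<and>
    (\<forall>v\<in>tangent x. \<forall>w\<in>tangent x. v \<bullet> (k x *v w) = 0) \<and> a x = 0 \<and> b x = 0)"


section \<open>Components and linearization\<close>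

datatype icomp = M11 | M12 | M13 | M22 | M23 | M33 | U | Phi

datatype bcomp = G1 | G2 | G3 | T11 | T12 | T22 | MeanC | NPhi

lemma UNIV_icomp: "UNIV = {M11, M12, M13, M22, M23, M33, U, Phi}"
  by (auto intro: icomp.exhaust)

lemma UNIV_bcomp: "UNIV = {G1, G2, G3, T11, T12, T22, MeanC, NPhi}"
  by (auto intro: bcomp.exhaust)

instance icomp :: finite
  by standard (simp add: UNIV_icomp)

instance bcomp :: finite
  by standard (simp add: UNIV_bcomp)

fun icoord :: "icomp \<Rightarrow> fields \<Rightarrow> real^3 \<Rightarrow> real" where
  "icoord M11 (k, v, \<psi>) x = k x $ 1 $ 1"
| "icoord M12 (k, v, \<psi>) x = k x $ 1 $ 2"
| "icoord M13 (k, v, \<psi>) x = k x $ 1 $ 3"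
| "icoord M22 (k, v, \<psi>) x = k x $ 2 $ 2"
| "icoord M23 (k, v, \<psi>) x = k x $ 2 $ 3"
| "icoord M33 (k, v, \<psi>) x = k x $ 3 $ 3"
| "icoord U (k, v, \<psi>) x = v x"
| "icoord Phi (k, v, \<psi>) x = \<psi> x"

text \<open>Components of boundary data at \<open>x\<close> relative to a basis \<open>e1, e2\<close> of the tangent plane.\<close>

fun bcoord :: "real^3 \<Rightarrow> real^3 \<Rightarrow> bcomp \<Rightarrow> bdata \<Rightarrow> real^3 \<Rightarrow> real" where
  "bcoord e1 e2 G1 (\<omega>, k, a, b) x = \<omega> x $ 1"
| "bcoord e1 e2 G2 (\<omega>, k, a, b) x = \<omega> x $ 2"
| "bcoord e1 e2 G3 (\<omega>, k, a, b) x = \<omega> x $ 3"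
| "bcoord e1 e2 T11 (\<omega>, k, a, b) x = e1 \<bullet> (k x *v e1)"
| "bcoord e1 e2 T12 (\<omega>, k, a, b) x = e1 \<bullet> (k x *v e2)"
| "bcoord e1 e2 T22 (\<omega>, k, a, b) x = e2 \<bullet> (k x *v e2)"
| "bcoord e1 e2 MeanC (\<omega>, k, a, b) x = a x"
| "bcoord e1 e2 NPhi (\<omega>, k, a, b) x = b x"

definition tangent_basis :: "real^3 \<Rightarrow> real^3 \<Rightarrow> real^3 \<Rightarrow> bool"
  where "tangent_basis x e1 e2 \<longleftrightarrow>
    e1 \<in> tangent x \<and> e2 \<in> tangent x \<and> e1 \<noteq> e2 \<and> independent {e1, e2}"

fun perturb :: "fields \<Rightarrow> real \<Rightarrow> fields \<Rightarrow> fields"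
  where "perturb (g, u, \<phi>) t (h, v, \<psi>) =
    (\<lambda>x. g x + t *\<^sub>R h x, \<lambda>x. u x + t * v x, \<lambda>x. \<phi> x + t * \<psi> x)"

text \<open>The tangent space of \<open>Met \<times> C \<times> C\<close>.\<close>

definition variations :: "nat \<Rightarrow> real \<Rightarrow> real \<Rightarrow> fields set"
  where "variations m \<alpha> \<delta> = {(h, v, \<psi>). (\<forall>x\<in>ext. transpose (h x) = h x) \<and>
    (\<forall>i j. (\<lambda>x. h x $ i $ j) \<in> whol m \<alpha> \<delta>) \<and> v \<in> whol m \<alpha> \<delta> \<and> \<psi> \<in> whol m \<alpha> \<delta>}"

text \<open>
  \<open>(DL, DB)\<close> is the linearization of \<open>(L, B)\<close> at \<open>W\<close>: its components are the directional
  derivatives, at each point, along the variations in \<open>V\<close>.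
\<close>

definition is_linearization ::
    "(fields \<Rightarrow> fields) \<Rightarrow> (fields \<Rightarrow> bdata) \<Rightarrow> fields \<Rightarrow> fields set \<Rightarrow>
     (fields \<Rightarrow> fields) \<Rightarrow> (fields \<Rightarrow> bdata) \<Rightarrow> bool"
  where "is_linearization L B W V DL DB \<longleftrightarrow>
    (\<forall>X\<in>V. \<forall>x\<in>ext. \<forall>c.
      ((\<lambda>t. icoord c (L (perturb W t X)) x) has_real_derivative icoord c (DL X) x) (at 0)) \<and>
    (\<forall>X\<in>V. \<forall>x\<in>bdry. \<forall>e1 e2 b. tangent_basis x e1 e2 \<longrightarrow>
      ((\<lambda>t. bcoord e1 e2 b (B (perturb W t X)) x) has_real_derivative
        bcoord e1 e2 b (DB X) x) (at 0))"


section \<open>Ellipticity in the sense of Agmon, Douglis and Nirenberg\<close>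

text \<open>
  \<open>a c is\<close> is the coefficient of \<open>\<partial>\<^sub>i\<^sub>s\<close> applied to the component \<open>c\<close> of the unknown.
\<close>

definition diff_expr :: "nat \<Rightarrow> (icomp \<Rightarrow> 3 list \<Rightarrow> real) \<Rightarrow> fields \<Rightarrow> real^3 \<Rightarrow> real"
  where "diff_expr k a X x =
    (\<Sum>c\<in>UNIV. \<Sum>is | length is \<le> k. a c is * pds ext is (icoord c X) x)"

text \<open>
  Principal symbol, obtained by substituting \<open>\<xi>\<close> for \<open>\<partial>\<close> (without a factor of the imaginary
  unit, which would only rescale rows) in the terms of top order.  The embedding \<open>\<iota>\<close> of the
  coefficients allows \<open>\<xi>\<close> to be a real covector or a covector of polynomials in \<open>z\<close>.
\<close>

definition symbol ::
    "(real \<Rightarrow> 'a::comm_ring_1) \<Rightarrow> ('r \<Rightarrow> nat) \<Rightarrow> ('r \<Rightarrow> icomp \<Rightarrow> 3 list \<Rightarrow> real) \<Rightarrow> 'a^3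
       \<Rightarrow> 'a^icomp^'r"
  where "symbol \<iota> ord A \<xi> =
    (\<chi> r c. \<Sum>is | length is = ord r. \<iota> (A r c is) * prod_list (map (\<lambda>i. \<xi> $ i) is))"

definition adjugate :: "'a::comm_ring_1^'n^'n \<Rightarrow> 'a^'n^'n"
  where "adjugate A =
    (\<chi> i j. det (\<chi> k l. if l = i then (if k = j then 1 else 0) else A $ k $ l))"

definition iord :: "icomp \<Rightarrow> nat"
  where "iord c = 2"

fun bord :: "bcomp \<Rightarrow> nat" where
  "bord G1 = 1" | "bord G2 = 1" | "bord G3 = 1"
| "bord T11 = 0" | "bord T12 = 0" | "bord T22 = 0"
| "bord MeanC = 1" | "bord NPhi = 1"

definition cpoly :: "real \<Rightarrow> complex poly"
  where "cpoly a = [:of_real a:]"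

text \<open>\<open>\<eta> + z \<mu>\<close> as a covector of polynomials in \<open>z\<close>.\<close>

definition line :: "real^3 \<Rightarrow> real^3 \<Rightarrow> complex poly^3"
  where "line \<eta> \<mu> = (\<chi> i. [:of_real (\<eta> $ i), of_real (\<mu> $ i):])"

definition lplus :: "complex poly \<Rightarrow> complex poly"
  where "lplus p = (\<Prod>z\<in>{z. poly p z = 0 \<and> Im z > 0}. [:- z, 1:] ^ order z p)"

definition rows_indep_mod :: "complex poly \<Rightarrow> complex poly^'n^'m \<Rightarrow> bool"
  where "rows_indep_mod q M \<longleftrightarrow>
    (\<forall>c :: 'm \<Rightarrow> complex. (\<forall>j. q dvd (\<Sum>i\<in>UNIV. smult (c i) (M $ i $ j))) \<longrightarrow> (\<forall>i. c i = 0))"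

definition unit_conormal :: "tensor2 \<Rightarrow> real^3 \<Rightarrow> real^3 \<Rightarrow> bool"
  where "unit_conormal g x \<mu> \<longleftrightarrow> (\<forall>v\<in>tangent x. \<mu> \<bullet> v = 0) \<and> ip g x \<mu> \<mu> = 1"

text \<open>
  Conditions (A) and (B) at a point, for matrices of coefficients at that point.  A 1-form is
  tangential to \<open>\<partial>S\<close> if it annihilates the unit normal.
\<close>

definition ADN_interior :: "(icomp \<Rightarrow> icomp \<Rightarrow> 3 list \<Rightarrow> real) \<Rightarrow> bool"
  where "ADN_interior A \<longleftrightarrow> (\<forall>\<xi>. \<xi> \<noteq> 0 \<longrightarrow> det (symbol (\<lambda>a. a) iord A \<xi>) \<noteq> 0)"

definition ADN_boundary ::
    "tensor2 \<Rightarrow> real^3 \<Rightarrow> (icomp \<Rightarrow> icomp \<Rightarrow> 3 list \<Rightarrow> real) \<Rightarrow>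
     (bcomp \<Rightarrow> icomp \<Rightarrow> 3 list \<Rightarrow> real) \<Rightarrow> bool"
  where "ADN_boundary g x A C \<longleftrightarrow>
    (\<forall>\<eta> \<mu>. \<eta> \<noteq> 0 \<and> \<eta> \<bullet> normal g x = 0 \<and> unit_conormal g x \<mu> \<longrightarrow>
      (let L = symbol cpoly iord A (line \<eta> \<mu>); B = symbol cpoly bord C (line \<eta> \<mu>)
       in rows_indep_mod (lplus (det L)) (B ** adjugate L)))"

text \<open>
  \<open>(DL, DB)\<close> is a linear differential operator on \<open>V\<close> of order 2 in the interior and of orders
  1, 0, 1, 1 on the boundary, and it is elliptic with respect to the metric \<open>g\<close>.
\<close>

definition ADN_elliptic ::
    "tensor2 \<Rightarrow> fields set \<Rightarrow> (fields \<Rightarrow> fields) \<Rightarrow> (fields \<Rightarrow> bdata) \<Rightarrow> bool"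
  where "ADN_elliptic g V DL DB \<longleftrightarrow>
    (\<exists>A :: real^3 \<Rightarrow> icomp \<Rightarrow> icomp \<Rightarrow> 3 list \<Rightarrow> real.
      (\<forall>x\<in>ext. (\<forall>X\<in>V. \<forall>r. icoord r (DL X) x = diff_expr (iord r) (A x r) X x) \<and>
                ADN_interior (A x)) \<and>
      (\<forall>x\<in>bdry. \<forall>e1 e2. tangent_basis x e1 e2 \<longrightarrow>
        (\<exists>C :: bcomp \<Rightarrow> icomp \<Rightarrow> 3 list \<Rightarrow> real.
          (\<forall>X\<in>V. \<forall>b. bcoord e1 e2 b (DB X) x = diff_expr (bord b) (C b) X x) \<and>
          ADN_boundary g x (A x) C)))"

end

theory Submission
  imports Defs
begin

text \<open>
  Every component of the gauged operator at a point is a differentiable function of the 2-jet (on the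
  boundary: the 1-jet) of the fields there, so the coefficients of its linearization are the values of
  a derivative on basis jets, and only the terms of top order matter.  With \<open>p = |\<xi>|\<^sup>2\<close> the symbol
  of the metric component is
  \<open>- p h - \<xi> \<xi> tr h - (h(\<xi>, \<xi>) - p tr h) g + 2 (p g - \<xi> \<xi>) v\<close>; the gauge term contributes no
  second derivatives of \<open>u\<close> because it vanishes identically when the reference metric is \<open>g\<close>.
  Taking the trace and evaluating on \<open>\<xi>\<close> shows that the symbol is injective for real \<open>\<xi> \<noteq> 0\<close>.

  For the boundary condition let \<open>c\<close> be a row vector with \<open>l\<^sup>+ | c B L\<^sup>*\<close>.  Multiplying by \<open>L\<close>,
  if \<open>(z - z\<^sub>0)\<^sup>j\<close> divides \<open>L h\<close> for a polynomial field \<open>h(z)\<close>, where \<open>z\<^sub>0 = i |\<eta>|\<close>, then it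
  also divides \<open>c B h\<close>.  Eight such fields, one of them of order 2 and one of order 3, force
  \<open>c = 0\<close>.
\<close>

section \<open>Derivatives of the inverse matrix\<close>

text \<open>Neither \<open>det L\<close> nor \<open>lplus (det L)\<close> is ever computed. It
  suffices that \<open>lplus (det L)\<close> contains the full power of \<open>z - z0\<close>
  dividing \<open>det L\<close>, which cancels against \<open>det L\<close> itself; that
  \<open>det L\<close> is a nonzero polynomial follows from condition (A) at z = 0. The number of
  test fields is forced: \<open>l\<close> is a constant times the eighth power of p, so
  \<open>z0\<close> is a root of multiplicity eight. There the symbol has a kernel of dimension six,
  cut out by \<open>h(\<xi>, \<xi>) = 0\<close> and \<open>tr h + 2 v = 0\<close>; the two missing
  conditions come from prolonging the kernel element \<xi> \<xi>, a gauge direction, to orders 2 and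
  3. Two obstacles shape the bookkeeping. The reference metric stays fixed while u varies in both
  conformal metrics, so the gauge depends on two jets, a frozen B and a variable J. And the same
  symbols are needed for real covectors and for covectors of polynomials in z, so they are computed
  once over a commutative ring into which the reals embed.\<close>

lemma det_replace_column_mult:
  fixes A :: "'a::comm_ring_1^'n^'n"
  shows "(\<Sum>j\<in>UNIV. adjugate A $ i $ j * v $ j)
    = det (\<chi> k l. if l = i then v $ k else A $ k $ l)"
proof -
  have tr: "det (\<chi> k l. if l = i then w $ k else A $ k $ l)
      = det (\<chi> l. if l = i then w else column l A)" for w :: "'a^'n"
    by (subst det_transpose[symmetric])
       (auto simp: transpose_def column_def intro!: arg_cong[where f = det] simp: vec_eq_iff)
  have "det (\<chi> k l. if l = i then v $ k else A $ k $ l)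
      = det (\<chi> l. if l = i then (\<Sum>j\<in>UNIV. v $ j *s axis j 1) else column l A)"
    unfolding tr basis_expansion ..
  also have "\<dots> = (\<Sum>j\<in>UNIV. det (\<chi> l. if l = i then v $ j *s axis j 1 else column l A))"
    by (rule det_linear_row_sum) simp
  also have "\<dots> = (\<Sum>j\<in>UNIV. v $ j * det (\<chi> l. if l = i then axis j 1 else column l A))"
    by (simp add: det_row_mul)
  also have "\<dots> = (\<Sum>j\<in>UNIV. adjugate A $ i $ j * v $ j)"
    by (rule sum.cong)
       (auto simp: adjugate_def axis_def mult.commute tr[symmetric] eq_commute
          intro!: arg_cong2[where f = "(*)"] arg_cong[where f = det] simp: vec_eq_iff)
  finally show ?thesis ..
qed

text \<open>The entries of the product are determinants with column i replaced by column m, which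
  repeats a column off the diagonal. A general commutative ring is used because the symbol matrices
  have polynomial entries; applied to a vector, it is the form in which \<open>L\<close> gets
  multiplied into the adjugate.\<close>

lemma adjugate_mult_left:
  fixes A :: "'a::comm_ring_1^'n^'n"
  shows "adjugate A *v (A *v w) = det A *s w"
proof -
  have "(\<Sum>j\<in>UNIV. adjugate A $ i $ j * A $ j $ m) = (if i = m then det A else 0)" for i m
  proof -
    have "(\<Sum>j\<in>UNIV. adjugate A $ i $ j * A $ j $ m)
        = det (\<chi> k l. if l = i then A $ k $ m else A $ k $ l)"
      using det_replace_column_mult[of A i "column m A"]
      by (simp only: column_def vec_lambda_beta)
    also have "\<dots> = (if i = m then det A else 0)"
    proof (cases "i = m")
      case True
      then show ?thesis
        by (auto intro!: arg_cong[where f = det] simp: vec_eq_iff)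
    next
      case False
      then show ?thesis
        by (auto intro!: det_identical_columns[of i m] simp: column_def vec_eq_iff)
    qed
    finally show ?thesis .
  qed
  then have "adjugate A ** A = mat (det A)"
    by (simp add: matrix_matrix_mult_def mat_def vec_eq_iff)
  moreover have "mat (det A) *v w = det A *s w"
    by (simp add: matrix_vector_mult_def mat_def vec_eq_iff if_distrib [where f = "\<lambda>x. x * _"] cong: if_cong)
  ultimately show ?thesis
    by (simp add: matrix_vector_mul_assoc)
qed

lemma matrix_inv_mult:
  fixes A :: "real^'n^'n"
  assumes "det A \<noteq> 0"
  shows "A ** matrix_inv A = mat 1" "matrix_inv A ** A = mat 1"
proof -
  have "\<exists>B. A ** B = mat 1 \<and> B ** A = mat 1"
    using assms by (simp add: invertible_det_nz flip: invertible_def)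
  then show "A ** matrix_inv A = mat 1" "matrix_inv A ** A = mat 1"
    unfolding matrix_inv_def by (metis (mono_tags, lifting) someI_ex)+
qed

lemma matrix_inv_cofactor:
  fixes A :: "real^'n^'n"
  assumes "det A \<noteq> 0"
  shows "matrix_inv A $ k $ l = adjugate A $ k $ l / det A"
proof -
  have inv: "A ** matrix_inv A = mat 1"
    using assms by (rule matrix_inv_mult)
  have "det A * matrix_inv A $ k $ l = (adjugate A *v (A *v column l (matrix_inv A))) $ k"
    by (simp add: adjugate_mult_left column_def)
  also have "A *v column l (matrix_inv A) = axis l 1"
    using arg_cong[OF inv, of "column l"]
    by (auto simp: column_def vec_eq_iff mat_def axis_def matrix_matrix_mult_def
        matrix_vector_mult_def)
  finally show ?thesis
    using assms by (simp add: matrix_vector_mult_basis column_def field_simps)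
qed

lemma differentiable_prod:
  fixes f :: "'i \<Rightarrow> 'a::real_normed_vector \<Rightarrow> real"
  assumes "finite I" "\<And>i. i \<in> I \<Longrightarrow> f i differentiable (at z within S)"
  shows "(\<lambda>x. \<Prod>i\<in>I. f i x) differentiable (at z within S)"
  using assms by (induction rule: finite_induct) (auto intro!: differentiable_mult differentiable_add)

lemma differentiable_sum_real:
  fixes f :: "'i \<Rightarrow> 'a::real_normed_vector \<Rightarrow> real"
  assumes "finite I" "\<And>i. i \<in> I \<Longrightarrow> f i differentiable (at z within S)"
  shows "(\<lambda>x. \<Sum>i\<in>I. f i x) differentiable (at z within S)"
  using assms by (induction rule: finite_induct) (auto intro!: differentiable_mult differentiable_add)

lemma differentiable_det:
  fixes f :: "'a::real_normed_vector \<Rightarrow> real^'n^'n"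
  assumes "\<And>i j. (\<lambda>x. f x $ i $ j) differentiable (at z within S)"
  shows "(\<lambda>x. det (f x)) differentiable (at z within S)"
  unfolding det_def
  by (intro differentiable_sum_real differentiable_mult differentiable_const differentiable_prod assms)
     (simp_all add: finite_permutations)

lemma bounded_linear_entry: "bounded_linear (\<lambda>A::real^'n^'m. A $ i $ j)"
  by (rule bounded_linear_compose[OF bounded_linear_vec_nth bounded_linear_vec_nth])

text \<open>Cofactors give differentiability near A, where the determinant stays nonzero; the value
  of the derivative then follows from the constant product of inverse and matrix.\<close>

lemma matrix_inv_has_derivative:
  fixes A :: "real^'n^'n"
  assumes A: "det A \<noteq> 0"
  shows "((\<lambda>B. matrix_inv B $ k $ l) has_derivative
    (\<lambda>H. - (\<Sum>p\<in>UNIV. \<Sum>q\<in>UNIV. matrix_inv A $ k $ p * H $ p $ q * matrix_inv A $ q $ l))) (at A)"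
proof -
  have entry: "(\<lambda>B::real^'n^'n. B $ i $ j) differentiable (at A)" for i j
    by (rule bounded_linear_imp_differentiable[OF bounded_linear_entry])
  have det_diff: "(\<lambda>B::real^'n^'n. det B) differentiable (at A)"
    by (rule differentiable_det[OF entry])
  have "isCont (\<lambda>B::real^'n^'n. det B) A"
    using det_diff differentiable_imp_continuous_within by blast
  then have ev: "\<forall>\<^sub>F B in nhds A. det B \<noteq> 0"
    using A tendsto_imp_eventually_ne[of "\<lambda>B. det B" "det A" "nhds A" 0]
    by (simp add: isCont_def tendsto_at_iff_tendsto_nhds)
  then obtain S where S: "open S" "A \<in> S" "\<And>B. B \<in> S \<Longrightarrow> det B \<noteq> 0"
    by (auto simp: eventually_nhds)
  have "(\<lambda>B::real^'n^'n. matrix_inv B $ k $ l) differentiable (at A)" for k l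
  proof -
    have "(\<lambda>B::real^'n^'n. adjugate B $ k $ l) differentiable (at A)"
      unfolding adjugate_def vec_lambda_beta
    proof (rule differentiable_det)
      fix i j
      show "(\<lambda>B. (\<chi> i' j'. if j' = k then if i' = l then 1 else 0 else B $ i' $ j') $ i $ j)
          differentiable at A"
        by (cases "j = k"; cases "i = l") (simp_all add: entry)
    qed
    then have "(\<lambda>B::real^'n^'n. adjugate B $ k $ l / det B) differentiable (at A)"
      using det_diff A by (intro differentiable_divide) auto
    then show ?thesis
      using S unfolding differentiable_def
      by (metis (no_types, lifting) has_derivative_transform_within_open matrix_inv_cofactor)
  qed
  then obtain D where D: "((\<lambda>B. matrix_inv B $ k $ l) has_derivative D k l) (at A)" for k l
    unfolding differentiable_def by metis
  let ?M = "matrix_inv A"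
  \<comment> \<open>Differentiating \<open>matrix_inv B ** B = mat 1\<close>, which holds on all of
    S, gives one equation per entry; it is solved below by multiplying with the inverse of A from
    the right.\<close>
  have eqn: "(\<Sum>q\<in>UNIV. D k q H * A $ q $ j) = - (\<Sum>q\<in>UNIV. ?M $ k $ q * H $ q $ j)" for k j H
  proof -
    have "((\<lambda>B. \<Sum>q\<in>UNIV. matrix_inv B $ k $ q * B $ q $ j) has_derivative
        (\<lambda>H. \<Sum>q\<in>UNIV. ?M $ k $ q * H $ q $ j + D k q H * A $ q $ j)) (at A)"
      by (intro has_derivative_sum has_derivative_mult D
          bounded_linear_imp_has_derivative bounded_linear_entry)
    moreover have "(\<Sum>q\<in>UNIV. matrix_inv B $ k $ q * B $ q $ j) = mat 1 $ k $ j" if "B \<in> S" for B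
      using S(3)[OF that]
      by (simp flip: matrix_inv_mult(2)) (simp add: matrix_matrix_mult_def)
    ultimately have "((\<lambda>B. mat 1 $ k $ j) has_derivative
        (\<lambda>H. \<Sum>q\<in>UNIV. ?M $ k $ q * H $ q $ j + D k q H * A $ q $ j)) (at A)"
      by (rule has_derivative_transform_within_open[OF _ S(1,2)])
    then have "(\<lambda>H. \<Sum>q\<in>UNIV. ?M $ k $ q * H $ q $ j + D k q H * A $ q $ j) = (\<lambda>H. 0)"
      using has_derivative_const has_derivative_unique by blast
    from fun_cong[OF this, of H] show ?thesis
      by (simp add: sum.distrib)
  qed
  have "D k l H = - (\<Sum>p\<in>UNIV. \<Sum>q\<in>UNIV. ?M $ k $ p * H $ p $ q * ?M $ q $ l)" for H
  proof -
    have inv: "(\<Sum>j\<in>UNIV. A $ q $ j * ?M $ j $ l) = (if q = l then 1 else 0)" for q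
      using arg_cong[OF matrix_inv_mult(1)[OF A], of "\<lambda>X. X $ q $ l"]
      by (simp add: matrix_matrix_mult_def mat_def)
    have "D k l H = (\<Sum>q\<in>UNIV. D k q H * (\<Sum>j\<in>UNIV. A $ q $ j * ?M $ j $ l))"
      by (simp add: inv if_distrib[where f = "\<lambda>x. _ * x"] cong: if_cong)
    also have "\<dots> = (\<Sum>q\<in>UNIV. \<Sum>j\<in>UNIV. D k q H * A $ q $ j * ?M $ j $ l)"
      by (simp add: sum_distrib_left mult.assoc)
    also have "\<dots> = (\<Sum>j\<in>UNIV. (\<Sum>q\<in>UNIV. D k q H * A $ q $ j) * ?M $ j $ l)"
      by (subst sum.swap) (simp add: sum_distrib_right)
    also have "\<dots> = - (\<Sum>j\<in>UNIV. \<Sum>p\<in>UNIV. ?M $ k $ p * H $ p $ j * ?M $ j $ l)"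
      by (simp add: eqn sum_distrib_right sum_negf)
    finally show ?thesis
      by (subst sum.swap)
  qed
  then show ?thesis
    using D[of k l] by (metis (no_types, lifting) ext)
qed

section \<open>Partial derivatives up to the boundary\<close>

text \<open>\<open>pd\<close> is a choice of derivative within \<open>ext\<close>, so the calculus
  carries the derivative explicitly through its three partials; \<open>has_partials_pd\<close>
  transfers it to \<open>pd\<close> by uniqueness.\<close>

definition has_partials :: "(real^3 \<Rightarrow> real) \<Rightarrow> (3 \<Rightarrow> real) \<Rightarrow> real^3 \<Rightarrow> bool"
  where "has_partials f f' x \<longleftrightarrow> (f has_derivative (\<lambda>w. \<Sum>i\<in>UNIV. w $ i * f' i)) (at x within ext)"

text \<open>This is the condition under which a derivative within \<open>ext\<close> is unique, also
  at points of the unit sphere, where only one side is available.\<close>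

lemma ext_coordinate_approachable:
  fixes x :: "real^3"
  assumes "x \<in> ext" "i \<in> Basis" "0 < e"
  shows "\<exists>d. 0 < \<bar>d\<bar> \<and> \<bar>d\<bar> < e \<and> x + d *\<^sub>R i \<in> ext"
proof -
  \<comment> \<open>The sign makes the step along i point away from the origin, so the norm does not
    decrease.\<close>
  define d where "d = (if x \<bullet> i \<ge> 0 then e / 2 else - e / 2)"
  have "d * (x \<bullet> i) \<ge> 0"
    using assms by (auto simp: d_def mult_nonpos_nonpos mult_le_0_iff)
  then have "(norm x)\<^sup>2 \<le> (norm (x + d *\<^sub>R i))\<^sup>2"
    using assms(2) by (simp add: power2_norm_eq_inner inner_add_left inner_add_right inner_commute)
  then have "norm x \<le> norm (x + d *\<^sub>R i)"
    by (simp add: power2_le_iff_abs_le)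
  then have "x + d *\<^sub>R i \<in> ext"
    using assms(1) by (simp add: ext_def)
  moreover have "0 < \<bar>d\<bar>" "\<bar>d\<bar> < e"
    using assms(3) by (auto simp: d_def)
  ultimately show ?thesis by blast
qed

lemma has_partials_pd:
  assumes "has_partials f f' x" "x \<in> ext"
  shows "pdS i f x = f' i"
proof -
  have "(f has_derivative frechet_derivative f (at x within ext)) (at x within ext)"
    using assms(1) by (meson differentiableI frechet_derivative_works has_partials_def)
  then have "frechet_derivative f (at x within ext) = (\<lambda>w. \<Sum>i\<in>UNIV. w $ i * f' i)"
    using assms ext_coordinate_approachable
    by (intro frechet_derivative_unique_within[of f _ x ext]) (auto simp: has_partials_def)
  then show ?thesis
    by (simp add: pd_def axis_def if_distrib[where f = "\<lambda>x. x * _"] cong: if_cong)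
qed

lemma has_partials_of_differentiable:
  assumes "f differentiable (at x within ext)"
  shows "has_partials f (\<lambda>i. pdS i f x) x"
proof -
  let ?D = "frechet_derivative f (at x within ext)"
  have D: "(f has_derivative ?D) (at x within ext)"
    using assms frechet_derivative_works by blast
  then interpret linear ?D
    by (rule has_derivative_linear)
  have "?D w = (\<Sum>i\<in>UNIV. w $ i * pdS i f x)" for w
    using arg_cong[OF basis_expansion[of w], of ?D]
    by (simp add: sum scale pd_def scalar_mult_eq_scaleR)
  then show ?thesis
    using D unfolding has_partials_def by (metis (no_types, lifting) ext)
qed

lemma has_partials_differentiable:
  "has_partials f f' x \<Longrightarrow> f differentiable (at x within ext)"
  by (auto simp: has_partials_def differentiable_def)

lemma has_partials_eq:
  assumes "has_partials f f' x" "\<And>i. f' i = g' i"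
  shows "has_partials f g' x"
  using assms by (simp add: has_partials_def)

lemma has_partials_cong:
  assumes "has_partials f f' x" "x \<in> ext" "\<And>y. y \<in> ext \<Longrightarrow> g y = f y"
  shows "has_partials g f' x"
  using assms unfolding has_partials_def by (blast intro: has_derivative_transform)

lemma has_partials_const: "has_partials (\<lambda>_. c) (\<lambda>_. 0) x"
  by (simp add: has_partials_def)

lemma has_partials_coordinate: "has_partials (\<lambda>y. y $ a) (\<lambda>i. if i = a then 1 else 0) x"
  by (simp add: has_partials_def bounded_linear_imp_has_derivative bounded_linear_vec_nth
      if_distrib[where f = "\<lambda>x. _ * x"] cong: if_cong)

lemma has_partials_add:
  assumes "has_partials f f' x" "has_partials g g' x"
  shows "has_partials (\<lambda>y. f y + g y) (\<lambda>i. f' i + g' i) x"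
  using has_derivative_add[OF assms[unfolded has_partials_def]]
  by (simp add: has_partials_def distrib_left sum.distrib)

lemma has_partials_minus:
  assumes "has_partials f f' x"
  shows "has_partials (\<lambda>y. - f y) (\<lambda>i. - f' i) x"
  using has_derivative_minus[OF assms[unfolded has_partials_def]]
  by (simp add: has_partials_def sum_negf)

lemma has_partials_diff:
  assumes "has_partials f f' x" "has_partials g g' x"
  shows "has_partials (\<lambda>y. f y - g y) (\<lambda>i. f' i - g' i) x"
  using has_derivative_diff[OF assms[unfolded has_partials_def]]
  by (simp add: has_partials_def right_diff_distrib sum_subtractf)

lemma has_partials_mult:
  assumes "has_partials f f' x" "has_partials g g' x"
  shows "has_partials (\<lambda>y. f y * g y) (\<lambda>i. f' i * g x + f x * g' i) x"
  using has_derivative_mult[OF assms[unfolded has_partials_def]]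
  by (simp add: has_partials_def distrib_left sum.distrib sum_distrib_left sum_distrib_right
      algebra_simps)

lemma has_partials_sum:
  assumes "\<And>a. a \<in> I \<Longrightarrow> has_partials (f a) (f' a) x"
  shows "has_partials (\<lambda>y. \<Sum>a\<in>I. f a y) (\<lambda>i. \<Sum>a\<in>I. f' a i) x"
proof -
  have "((\<lambda>y. \<Sum>a\<in>I. f a y) has_derivative (\<lambda>w. \<Sum>a\<in>I. \<Sum>i\<in>UNIV. w $ i * f' a i)) (at x within ext)"
    using assms by (intro has_derivative_sum) (auto simp: has_partials_def)
  then show ?thesis
    by (subst (asm) sum.swap) (simp add: has_partials_def sum_distrib_left)
qed

lemma has_partials_chain:
  assumes "has_partials f f' x" "(h has_real_derivative h') (at (f x))"
  shows "has_partials (\<lambda>y. h (f y)) (\<lambda>i. h' * f' i) x"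
proof -
  have "((\<lambda>y. h (f y)) has_derivative (\<lambda>w. h' * (\<Sum>i\<in>UNIV. w $ i * f' i))) (at x within ext)"
    by (rule has_derivative_compose[OF assms(1)[unfolded has_partials_def]
          assms(2)[unfolded has_field_derivative_def]])
  then show ?thesis
    by (simp add: has_partials_def sum_distrib_left algebra_simps)
qed

definition inv_partials :: "(3 \<Rightarrow> 3 \<Rightarrow> real) \<Rightarrow> (3 \<Rightarrow> 3 \<Rightarrow> 3 \<Rightarrow> real) \<Rightarrow> 3 \<Rightarrow> 3 \<Rightarrow> 3 \<Rightarrow> real"
  where "inv_partials M D m k l = - (\<Sum>p\<in>UNIV. \<Sum>q\<in>UNIV. M k p * D m p q * M q l)"

lemma has_partials_ginv:
  assumes g: "\<And>a b. has_partials (\<lambda>y. g y $ a $ b) (\<lambda>i. D i a b) x" and det: "det (g x) \<noteq> 0"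
  shows "has_partials (\<lambda>y. ginv g y $ k $ l) (\<lambda>m. inv_partials (\<lambda>k l. ginv g x $ k $ l) D m k l) x"
proof -
  let ?D = "\<lambda>w. \<chi> a b. \<Sum>i\<in>UNIV. w $ i * D i a b"
  have "(g has_derivative ?D) (at x within ext)"
    using g unfolding has_partials_def
    by (subst has_derivative_componentwise_within) (auto simp: Basis_vec_def inner_axis)
  from has_derivative_compose[OF this matrix_inv_has_derivative[OF det, of k l]]
  have "((\<lambda>y. matrix_inv (g y) $ k $ l) has_derivative
     (\<lambda>w. - (\<Sum>p\<in>UNIV. \<Sum>q\<in>UNIV. matrix_inv (g x) $ k $ p * ?D w $ p $ q * matrix_inv (g x) $ q $ l)))
     (at x within ext)" .
  moreover have "- (\<Sum>p\<in>UNIV. \<Sum>q\<in>UNIV. M k p * ?D w $ p $ q * M q l)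
      = (\<Sum>m\<in>UNIV. w $ m * inv_partials M D m k l)" for w M
    by (simp add: inv_partials_def sum_distrib_left sum_distrib_right sum_negf)
       (subst sum.swap, rule sum.cong, simp, subst sum.swap, simp add: algebra_simps)
  ultimately show ?thesis
    unfolding has_partials_def ginv_def by (elim has_derivative_eq_rhs) (rule ext)
qed

section \<open>Curvature and divergence in terms of partial derivatives\<close>

text \<open>Geometric quantities become functions of arrays of numbers: M for the inverse metric, D
  and D2 for first and second partials of the metric. The same formulas then serve for g, for its
  conformal change and for their linearizations.\<close>

definition chr :: "(3 \<Rightarrow> 3 \<Rightarrow> real) \<Rightarrow> (3 \<Rightarrow> 3 \<Rightarrow> 3 \<Rightarrow> real) \<Rightarrow> 3 \<Rightarrow> 3 \<Rightarrow> 3 \<Rightarrow> real"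
  where "chr M D k i j = (\<Sum>l\<in>UNIV. M k l * (D i j l + D j i l - D l i j)) / 2"

definition chr_partials :: "(3 \<Rightarrow> 3 \<Rightarrow> real) \<Rightarrow> (3 \<Rightarrow> 3 \<Rightarrow> 3 \<Rightarrow> real) \<Rightarrow> (3 \<Rightarrow> 3 \<Rightarrow> 3 \<Rightarrow> 3 \<Rightarrow> real)
    \<Rightarrow> 3 \<Rightarrow> 3 \<Rightarrow> 3 \<Rightarrow> 3 \<Rightarrow> real"
  where "chr_partials M D D2 m k i j = (\<Sum>l\<in>UNIV.
      inv_partials M D m k l * (D i j l + D j i l - D l i j)
      + M k l * (D2 m i j l + D2 m j i l - D2 m l i j)) / 2"

definition ric :: "(3 \<Rightarrow> 3 \<Rightarrow> real) \<Rightarrow> (3 \<Rightarrow> 3 \<Rightarrow> 3 \<Rightarrow> real) \<Rightarrow> (3 \<Rightarrow> 3 \<Rightarrow> 3 \<Rightarrow> 3 \<Rightarrow> real)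
    \<Rightarrow> 3 \<Rightarrow> 3 \<Rightarrow> real"
  where "ric M D D2 i j = (\<Sum>k\<in>UNIV.
      chr_partials M D D2 k k i j - chr_partials M D D2 i k k j
      + (\<Sum>l\<in>UNIV. chr M D k k l * chr M D l i j - chr M D k i l * chr M D l k j))"

text \<open>(M, D) belong to the metric whose connection is used and (K, DK) to the tensor being
  differentiated; in the gauge these are two different metrics.\<close>

definition dvg :: "(3 \<Rightarrow> 3 \<Rightarrow> real) \<Rightarrow> (3 \<Rightarrow> 3 \<Rightarrow> 3 \<Rightarrow> real) \<Rightarrow> (3 \<Rightarrow> 3 \<Rightarrow> real) \<Rightarrow> (3 \<Rightarrow> 3 \<Rightarrow> 3 \<Rightarrow> real)
    \<Rightarrow> 3 \<Rightarrow> real"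
  where "dvg M D K DK b = - (\<Sum>i\<in>UNIV. \<Sum>a\<in>UNIV. M i a *
    (DK i a b - (\<Sum>p\<in>UNIV. chr M D p i a * K p b + chr M D p i b * K a p)))"

definition dvg_partials :: "(3 \<Rightarrow> 3 \<Rightarrow> real) \<Rightarrow> (3 \<Rightarrow> 3 \<Rightarrow> 3 \<Rightarrow> real) \<Rightarrow> (3 \<Rightarrow> 3 \<Rightarrow> 3 \<Rightarrow> 3 \<Rightarrow> real)
    \<Rightarrow> (3 \<Rightarrow> 3 \<Rightarrow> real) \<Rightarrow> (3 \<Rightarrow> 3 \<Rightarrow> 3 \<Rightarrow> real) \<Rightarrow> (3 \<Rightarrow> 3 \<Rightarrow> 3 \<Rightarrow> 3 \<Rightarrow> real) \<Rightarrow> 3 \<Rightarrow> 3 \<Rightarrow> real"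
  where "dvg_partials M D D2 K DK DDK m b = - (\<Sum>i\<in>UNIV. \<Sum>a\<in>UNIV.
    inv_partials M D m i a *
      (DK i a b - (\<Sum>p\<in>UNIV. chr M D p i a * K p b + chr M D p i b * K a p))
    + M i a * (DDK m i a b - (\<Sum>p\<in>UNIV.
        chr_partials M D D2 m p i a * K p b + chr M D p i a * DK m p b
        + (chr_partials M D D2 m p i b * K a p + chr M D p i b * DK m a p))))"

section \<open>Functions twice differentiable up to the boundary\<close>

text \<open>Required on all of \<open>ext\<close>, since second partials at a point depend on the
  first partials near it.\<close>

definition twice_diff :: "(real^3 \<Rightarrow> real) \<Rightarrow> bool"
  where "twice_diff f \<longleftrightarrow> (\<forall>y\<in>ext. f differentiable (at y within ext) \<and>
    (\<forall>i. pdS i f differentiable (at y within ext)))"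

lemma twice_diff_partials:
  assumes "twice_diff f" "y \<in> ext"
  shows "has_partials f (\<lambda>i. pdS i f y) y" "has_partials (pdS i f) (\<lambda>m. pdS m (pdS i f) y) y"
  using assms by (auto simp: twice_diff_def intro: has_partials_of_differentiable)

lemma twice_diffI:
  assumes "\<And>y. y \<in> ext \<Longrightarrow> has_partials f (\<lambda>i. f' i y) y"
    and "\<And>y i. y \<in> ext \<Longrightarrow> has_partials (f' i) (\<lambda>m. f'' m i y) y"
  shows "twice_diff f" "y \<in> ext \<Longrightarrow> pdS i f y = f' i y"
    "y \<in> ext \<Longrightarrow> pdS m (pdS i f) y = f'' m i y"
proof -
  have 1: "pdS i f y = f' i y" if "y \<in> ext" for i y
    using has_partials_pd[OF assms(1)] that by blast
  have 2: "has_partials (pdS i f) (\<lambda>m. f'' m i y) y" if "y \<in> ext" for i y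
    using has_partials_cong[OF assms(2)] that 1 by blast
  show "twice_diff f"
    unfolding twice_diff_def using assms(1) 2 has_partials_differentiable by blast
  show "y \<in> ext \<Longrightarrow> pdS i f y = f' i y"
    by (rule 1)
  show "y \<in> ext \<Longrightarrow> pdS m (pdS i f) y = f'' m i y"
    by (rule has_partials_pd[OF 2])
qed

text \<open>Used to replace an entry of g by the component stored for it in the upper triangle: the
  two agree only on \<open>ext\<close>, where g is symmetric.\<close>

lemma twice_diff_cong:
  assumes "twice_diff f" "\<And>y. y \<in> ext \<Longrightarrow> g y = f y"
  shows "twice_diff g" "y \<in> ext \<Longrightarrow> pdS i g y = pdS i f y"
    "y \<in> ext \<Longrightarrow> pdS m (pdS i g) y = pdS m (pdS i f) y"
proof -
  have "has_partials g (\<lambda>i. pdS i f y) y" if "y \<in> ext" for y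
    using has_partials_cong[OF twice_diff_partials(1)[OF assms(1) that] that assms(2)] by blast
  from twice_diffI[of g "\<lambda>i y. pdS i f y" "\<lambda>m i y. pdS m (pdS i f) y", OF this
      twice_diff_partials(2)[OF assms(1)]]
  show "twice_diff g" "y \<in> ext \<Longrightarrow> pdS i g y = pdS i f y"
    "y \<in> ext \<Longrightarrow> pdS m (pdS i g) y = pdS m (pdS i f) y"
    by blast+
qed

text \<open>\<open>Met\<close> prescribes the regularity of the difference to the Euclidean metric,
  not of g itself.\<close>

lemma twice_diff_add_const:
  assumes "twice_diff (\<lambda>y. f y - c)"
  shows "twice_diff f"
proof -
  have 1: "has_partials f (\<lambda>i. pdS i (\<lambda>y. f y - c) y) y" if "y \<in> ext" for y
    using has_partials_add[OF twice_diff_partials(1)[OF assms that] has_partials_const[of c]]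
    by simp
  show ?thesis
    by (rule twice_diffI(1)[OF 1 twice_diff_partials(2)[OF assms]])
qed

lemma twice_diff_linear:
  assumes f: "twice_diff f" and g: "twice_diff g"
  shows "twice_diff (\<lambda>y. f y + t * g y)"
    "y \<in> ext \<Longrightarrow> pdS i (\<lambda>y. f y + t * g y) y = pdS i f y + t * pdS i g y"
    "y \<in> ext \<Longrightarrow> pdS m (pdS i (\<lambda>y. f y + t * g y)) y = pdS m (pdS i f) y + t * pdS m (pdS i g) y"
proof -
  have 1: "has_partials (\<lambda>y. f y + t * g y) (\<lambda>i. pdS i f y + t * pdS i g y) y" if "y \<in> ext" for y
    using has_partials_add[OF twice_diff_partials(1)[OF f that]
        has_partials_mult[OF has_partials_const[of t] twice_diff_partials(1)[OF g that]]]
    by simp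
  have 2: "has_partials (\<lambda>y. pdS i f y + t * pdS i g y)
      (\<lambda>m. pdS m (pdS i f) y + t * pdS m (pdS i g) y) y" if "y \<in> ext" for i y
    using has_partials_add[OF twice_diff_partials(2)[OF f that]
        has_partials_mult[OF has_partials_const[of t] twice_diff_partials(2)[OF g that]]]
    by simp
  note * = twice_diffI[OF 1 2]
  show "twice_diff (\<lambda>y. f y + t * g y)"
    "y \<in> ext \<Longrightarrow> pdS i (\<lambda>y. f y + t * g y) y = pdS i f y + t * pdS i g y"
    "y \<in> ext \<Longrightarrow> pdS m (pdS i (\<lambda>y. f y + t * g y)) y = pdS m (pdS i f) y + t * pdS m (pdS i g) y"
    using * by blast+
qed

lemma twice_diff_exp_mult:
  assumes f: "twice_diff f" and u: "twice_diff u"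
  shows "twice_diff (\<lambda>y. exp (2 * u y) * f y)"
    and "y \<in> ext \<Longrightarrow> pdS i (\<lambda>y. exp (2 * u y) * f y) y
      = exp (2 * u y) * (2 * pdS i u y * f y + pdS i f y)"
    and "y \<in> ext \<Longrightarrow> pdS m (pdS i (\<lambda>y. exp (2 * u y) * f y)) y
      = exp (2 * u y) * (2 * pdS m u y * (2 * pdS i u y * f y + pdS i f y)
          + (2 * pdS m (pdS i u) y * f y + 2 * pdS i u y * pdS m f y + pdS m (pdS i f) y))"
proof -
  have e: "has_partials (\<lambda>y. exp (2 * u y)) (\<lambda>i. exp (2 * u y) * (2 * pdS i u y)) y"
    if "y \<in> ext" for y
  proof -
    have "((\<lambda>s. exp (2 * s)) has_real_derivative exp (2 * u y) * 2) (at (u y))"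
      by (auto intro!: derivative_eq_intros)
    from has_partials_chain[OF twice_diff_partials(1)[OF u that] this] show ?thesis
      by (simp add: mult.assoc)
  qed
  have 1: "has_partials (\<lambda>y. exp (2 * u y) * f y)
      (\<lambda>i. exp (2 * u y) * (2 * pdS i u y * f y + pdS i f y)) y" if "y \<in> ext" for y
    by (rule has_partials_eq[OF has_partials_mult[OF e twice_diff_partials(1)[OF f]]])
       (use that in \<open>auto simp: algebra_simps\<close>)
  have 2: "has_partials (\<lambda>y. exp (2 * u y) * (2 * pdS i u y * f y + pdS i f y))
      (\<lambda>m. exp (2 * u y) * (2 * pdS m u y * (2 * pdS i u y * f y + pdS i f y)
          + (2 * pdS m (pdS i u) y * f y + 2 * pdS i u y * pdS m f y + pdS m (pdS i f) y))) y"
    if "y \<in> ext" for i y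
    by (rule has_partials_eq, rule has_partials_mult[OF e has_partials_add[OF has_partials_mult[OF
          has_partials_mult[OF has_partials_const twice_diff_partials(2)[OF u]]
          twice_diff_partials(1)[OF f]] twice_diff_partials(2)[OF f]]])
       (use that in \<open>auto simp: algebra_simps\<close>)
  note * = twice_diffI[OF 1 2]
  show "twice_diff (\<lambda>y. exp (2 * u y) * f y)"
    "y \<in> ext \<Longrightarrow> pdS i (\<lambda>y. exp (2 * u y) * f y) y
      = exp (2 * u y) * (2 * pdS i u y * f y + pdS i f y)"
    "y \<in> ext \<Longrightarrow> pdS m (pdS i (\<lambda>y. exp (2 * u y) * f y)) y
      = exp (2 * u y) * (2 * pdS m u y * (2 * pdS i u y * f y + pdS i f y)
          + (2 * pdS m (pdS i u) y * f y + 2 * pdS i u y * pdS m f y + pdS m (pdS i f) y))"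
    using * by blast+
qed

abbreviation ginv_at :: "tensor2 \<Rightarrow> real^3 \<Rightarrow> 3 \<Rightarrow> 3 \<Rightarrow> real"
  where "ginv_at g x \<equiv> \<lambda>k l. ginv g x $ k $ l"
abbreviation comp_at :: "tensor2 \<Rightarrow> real^3 \<Rightarrow> 3 \<Rightarrow> 3 \<Rightarrow> real"
  where "comp_at g x \<equiv> \<lambda>a b. g x $ a $ b"
abbreviation pd_at :: "tensor2 \<Rightarrow> real^3 \<Rightarrow> 3 \<Rightarrow> 3 \<Rightarrow> 3 \<Rightarrow> real"
  where "pd_at g x \<equiv> \<lambda>i a b. pdS i (\<lambda>y. g y $ a $ b) x"
abbreviation pd2_at :: "tensor2 \<Rightarrow> real^3 \<Rightarrow> 3 \<Rightarrow> 3 \<Rightarrow> 3 \<Rightarrow> 3 \<Rightarrow> real"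
  where "pd2_at g x \<equiv> \<lambda>m i a b. pdS m (pdS i (\<lambda>y. g y $ a $ b)) x"

lemma christoffel_chr: "christoffel g k i j x = chr (ginv_at g x) (pd_at g x) k i j"
  by (simp add: christoffel_def chr_def)

definition regular_metric :: "tensor2 \<Rightarrow> real^3 \<Rightarrow> bool"
  where "regular_metric g x \<longleftrightarrow> (\<forall>a b. twice_diff (\<lambda>y. g y $ a $ b)) \<and> x \<in> ext \<and> det (g x) \<noteq> 0"

lemma regular_metric_ginv:
  assumes "regular_metric g x"
  shows "has_partials (\<lambda>y. ginv g y $ k $ l) (\<lambda>m. inv_partials (ginv_at g x) (pd_at g x) m k l) x"
  using assms by (intro has_partials_ginv twice_diff_partials) (auto simp: regular_metric_def)

lemma regular_metric_pd:
  assumes "regular_metric g x"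
  shows "has_partials (\<lambda>y. g y $ a $ b) (\<lambda>m. pd_at g x m a b) x"
    "has_partials (pdS i (\<lambda>y. g y $ a $ b)) (\<lambda>m. pd2_at g x m i a b) x"
  using assms by (auto intro!: twice_diff_partials simp: regular_metric_def)

lemma has_partials_christoffel:
  assumes g: "regular_metric g x"
  shows "has_partials (christoffel g k i j)
    (\<lambda>m. chr_partials (ginv_at g x) (pd_at g x) (pd2_at g x) m k i j) x"
proof -
  have "has_partials (\<lambda>y. (\<Sum>l\<in>UNIV. ginv g y $ k $ l *
      (pd_at g y i j l + pd_at g y j i l - pd_at g y l i j)) * (1/2))
    (\<lambda>m. chr_partials (ginv_at g x) (pd_at g x) (pd2_at g x) m k i j) x"
    by (rule has_partials_eq, rule has_partials_mult[OF has_partials_sum[OF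
            has_partials_mult[OF regular_metric_ginv[OF g] has_partials_diff[OF has_partials_add[OF
            regular_metric_pd(2)[OF g] regular_metric_pd(2)[OF g]] regular_metric_pd(2)[OF g]]]]
          has_partials_const])
       (simp add: chr_partials_def)
  then show ?thesis
    by (rule back_subst[where P = "\<lambda>f. has_partials f _ _"]) (simp add: christoffel_def fun_eq_iff)
qed

lemma Ric_ric:
  assumes g: "regular_metric g x"
  shows "Ric g x $ i $ j = ric (ginv_at g x) (pd_at g x) (pd2_at g x) i j"
proof -
  have "x \<in> ext"
    using g by (simp add: regular_metric_def)
  then show ?thesis
    by (simp add: Ric_def ric_def christoffel_chr has_partials_pd[OF has_partials_christoffel[OF g]])
qed

lemma diverg_dvg:
  "diverg g k x $ b = dvg (ginv_at g x) (pd_at g x) (comp_at k x) (pd_at k x) b"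
  by (simp add: diverg_def dvg_def cov_def christoffel_chr)

lemma has_partials_diverg:
  assumes g: "regular_metric g x" and k: "regular_metric k x"
  shows "has_partials (\<lambda>y. diverg g k y $ b)
    (\<lambda>m. dvg_partials (ginv_at g x) (pd_at g x) (pd2_at g x)
      (comp_at k x) (pd_at k x) (pd2_at k x) m b) x"
proof -
  have "has_partials (\<lambda>y. - (\<Sum>i\<in>UNIV. \<Sum>a\<in>UNIV. ginv g y $ i $ a *
        (pdS i (\<lambda>y. k y $ a $ b) y - (\<Sum>p\<in>UNIV. christoffel g p i a y * k y $ p $ b
           + christoffel g p i b y * k y $ a $ p))))
    (\<lambda>m. dvg_partials (ginv_at g x) (pd_at g x) (pd2_at g x)
      (comp_at k x) (pd_at k x) (pd2_at k x) m b) x"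
    by (rule has_partials_eq, rule has_partials_minus[OF has_partials_sum[OF has_partials_sum[OF
            has_partials_mult[OF regular_metric_ginv[OF g] has_partials_diff[OF
              regular_metric_pd(2)[OF k] has_partials_sum[OF has_partials_add[OF
              has_partials_mult[OF has_partials_christoffel[OF g] regular_metric_pd(1)[OF k]]
              has_partials_mult[OF has_partials_christoffel[OF g] regular_metric_pd(1)[OF k]]]]]]]]])
       (simp add: dvg_partials_def christoffel_chr)
  then show ?thesis
    by (simp add: diverg_def cov_def)
qed

section \<open>Conformal change of the metric\<close>

lemma det_scaleR_eq_0:
  fixes A :: "real^'n^'n"
  assumes "c \<noteq> 0"
  shows "det (c *\<^sub>R A) = 0 \<longleftrightarrow> det A = 0"
proof -
  have "c *\<^sub>R A = (\<chi> i. c *s (A $ i))"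
    by (simp add: vec_eq_iff)
  then show ?thesis
    using assms det_rows_mul[of "\<lambda>_. c" "\<lambda>i. A $ i"] by simp
qed

lemma matrix_inv_scaleR:
  fixes A :: "real^'n^'n"
  assumes "det A \<noteq> 0" "c \<noteq> 0"
  shows "matrix_inv (c *\<^sub>R A) = (1 / c) *\<^sub>R matrix_inv A"
proof -
  have d: "det (c *\<^sub>R A) \<noteq> 0"
    using assms by (simp add: det_scaleR_eq_0)
  have "c *\<^sub>R A ** ((1 / c) *\<^sub>R matrix_inv A) = A ** matrix_inv A"
    using assms(2) by (simp add: matrix_matrix_mult_def vec_eq_iff)
  then have "matrix_inv (c *\<^sub>R A) = matrix_inv (c *\<^sub>R A) ** (c *\<^sub>R A ** ((1 / c) *\<^sub>R matrix_inv A))"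
    using assms(1) by (simp add: matrix_inv_mult)
  also have "\<dots> = (1 / c) *\<^sub>R matrix_inv A"
    using matrix_inv_mult(2)[OF d] by (simp add: matrix_mul_assoc)
  finally show ?thesis .
qed

lemma ginv_conf:
  assumes "det (g x) \<noteq> 0"
  shows "ginv (conf u g) x $ k $ l = exp (- 2 * u x) * ginv g x $ k $ l"
  using assms by (simp add: ginv_def conf_def matrix_inv_scaleR exp_minus divide_inverse)

lemma regular_metric_conf:
  assumes g: "regular_metric g x" and u: "twice_diff u"
  shows "regular_metric (conf u g) x"
    and "pd_at (conf u g) x = (\<lambda>i a b. exp (2 * u x) * (2 * pdS i u x * g x $ a $ b + pd_at g x i a b))"
    and "pd2_at (conf u g) x = (\<lambda>m i a b.
      exp (2 * u x) * (2 * pdS m u x * (2 * pdS i u x * g x $ a $ b + pd_at g x i a b)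
        + (2 * pdS m (pdS i u) x * g x $ a $ b + 2 * pdS i u x * pd_at g x m a b + pd2_at g x m i a b)))"
proof -
  have c: "(\<lambda>y. conf u g y $ a $ b) = (\<lambda>y. exp (2 * u y) * g y $ a $ b)" for a b
    by (simp add: conf_def)
  have t: "twice_diff (\<lambda>y. g y $ a $ b)" and x: "x \<in> ext" and d: "det (g x) \<noteq> 0" for a b
    using g by (auto simp: regular_metric_def)
  show "regular_metric (conf u g) x"
    using twice_diff_exp_mult(1)[OF t u] x d
    by (simp add: regular_metric_def c) (simp add: conf_def det_scaleR_eq_0)
  show "pd_at (conf u g) x = (\<lambda>i a b. exp (2 * u x) * (2 * pdS i u x * g x $ a $ b + pd_at g x i a b))"
    unfolding c by (intro ext) (rule twice_diff_exp_mult(2)[OF t u x])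
  show "pd2_at (conf u g) x = (\<lambda>m i a b.
      exp (2 * u x) * (2 * pdS m u x * (2 * pdS i u x * g x $ a $ b + pd_at g x i a b)
        + (2 * pdS m (pdS i u) x * g x $ a $ b + 2 * pdS i u x * pd_at g x m a b + pd2_at g x m i a b)))"
    unfolding c by (intro ext) (rule twice_diff_exp_mult(3)[OF t u x])
qed

section \<open>The operator as a function of jets\<close>

text \<open>One Euclidean space, so that the operator at a point becomes an ordinary function with a
  Frechet derivative. The two orders of differentiation in a mixed derivative are independent
  coordinates, matching the ordered index lists of \<open>pds\<close>.\<close>

type_synonym jet = "(real^icomp) \<times> (real^icomp^3) \<times> (real^icomp^3^3)"

definition j0 :: "jet \<Rightarrow> icomp \<Rightarrow> real"
  where "j0 J c = fst J $ c"
definition j1 :: "jet \<Rightarrow> 3 \<Rightarrow> icomp \<Rightarrow> real"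
  where "j1 J i c = fst (snd J) $ i $ c"
definition j2 :: "jet \<Rightarrow> 3 \<Rightarrow> 3 \<Rightarrow> icomp \<Rightarrow> real"
  where "j2 J i j c = snd (snd J) $ i $ j $ c"

definition jet_of :: "fields \<Rightarrow> real^3 \<Rightarrow> jet"
  where "jet_of Z x = ((\<chi> c. icoord c Z x), (\<chi> i c. pdS i (icoord c Z) x),
    (\<chi> i j c. pdS i (pdS j (icoord c Z)) x))"

text \<open>Reading the metric through its upper triangle makes the array \<open>g0\<close> of every
  jet symmetric.\<close>

definition sym_index :: "3 \<Rightarrow> 3 \<Rightarrow> icomp"
  where "sym_index a b =
    (if a = 1 then (if b = 1 then M11 else if b = 2 then M12 else M13)
     else if a = 2 then (if b = 1 then M12 else if b = 2 then M22 else M23)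
     else (if b = 1 then M13 else if b = 2 then M23 else M33))"

lemma sym_index_commute: "sym_index a b = sym_index b a"
  using exhaust_3[of a] exhaust_3[of b] by (auto simp: sym_index_def)

definition g0 :: "jet \<Rightarrow> 3 \<Rightarrow> 3 \<Rightarrow> real"
  where "g0 J a b = j0 J (sym_index a b)"
definition g1 :: "jet \<Rightarrow> 3 \<Rightarrow> 3 \<Rightarrow> 3 \<Rightarrow> real"
  where "g1 J i a b = j1 J i (sym_index a b)"
definition g2 :: "jet \<Rightarrow> 3 \<Rightarrow> 3 \<Rightarrow> 3 \<Rightarrow> 3 \<Rightarrow> real"
  where "g2 J m i a b = j2 J m i (sym_index a b)"
definition gi :: "jet \<Rightarrow> 3 \<Rightarrow> 3 \<Rightarrow> real"
  where "gi J k l = matrix_inv (\<chi> a b. g0 J a b) $ k $ l"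

definition regular_fields :: "fields \<Rightarrow> bool"
  where "regular_fields Z \<longleftrightarrow>
    (\<forall>c. twice_diff (icoord c Z)) \<and> (\<forall>y\<in>ext. transpose (fst Z y) = fst Z y)"

lemma metric_icoord:
  assumes "regular_fields (g, u, \<phi>)" "y \<in> ext"
  shows "g y $ a $ b = icoord (sym_index a b) (g, u, \<phi>) y"
proof -
  have "g y $ b $ a = g y $ a $ b" for a b
    using assms by (simp add: regular_fields_def transpose_def vec_eq_iff)
  then show ?thesis
    using exhaust_3[of a] exhaust_3[of b] by (auto simp: sym_index_def)
qed

lemma jet_of_metric:
  assumes Z: "regular_fields (g, u, \<phi>)" and x: "x \<in> ext"
  shows "comp_at g x = g0 (jet_of (g, u, \<phi>) x)"
    and "pd_at g x = g1 (jet_of (g, u, \<phi>) x)"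
    and "pd2_at g x = g2 (jet_of (g, u, \<phi>) x)"
    and "ginv_at g x = gi (jet_of (g, u, \<phi>) x)"
    and "twice_diff (\<lambda>y. g y $ a $ b)"
proof -
  have t: "twice_diff (icoord c (g, u, \<phi>))" for c
    using Z by (simp add: regular_fields_def)
  note cong = twice_diff_cong[OF t metric_icoord[OF Z]]
  show 0: "comp_at g x = g0 (jet_of (g, u, \<phi>) x)"
    using metric_icoord[OF Z x] by (simp add: fun_eq_iff g0_def j0_def jet_of_def)
  show "pd_at g x = g1 (jet_of (g, u, \<phi>) x)"
    using cong(2)[OF _ x] by (simp add: fun_eq_iff g1_def j1_def jet_of_def)
  show "pd2_at g x = g2 (jet_of (g, u, \<phi>) x)"
    using cong(3)[OF _ x] by (simp add: fun_eq_iff g2_def j2_def jet_of_def)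
  have "(\<chi> a b. g0 (jet_of (g, u, \<phi>) x) a b) = g x"
    by (simp add: vec_eq_iff flip: 0)
  then show "ginv_at g x = gi (jet_of (g, u, \<phi>) x)"
    by (simp add: fun_eq_iff ginv_def gi_def)
  show "twice_diff (\<lambda>y. g y $ a $ b)"
    by (rule cong(1))
qed

lemma icoord_eta: "icoord U (g, u, \<phi>) = u" "icoord Phi (g, u, \<phi>) = \<phi>"
  by auto

lemma jet_of_scalar:
  "j0 (jet_of (g, u, \<phi>) x) U = u x" "j0 (jet_of (g, u, \<phi>) x) Phi = \<phi> x"
  "j1 (jet_of (g, u, \<phi>) x) i U = pdS i u x" "j1 (jet_of (g, u, \<phi>) x) i Phi = pdS i \<phi> x"
  "j2 (jet_of (g, u, \<phi>) x) m i U = pdS m (pdS i u) x"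
  "j2 (jet_of (g, u, \<phi>) x) m i Phi = pdS m (pdS i \<phi>) x"
  by (simp_all add: j0_def j1_def j2_def jet_of_def icoord_eta)

definition hess_jet :: "icomp \<Rightarrow> jet \<Rightarrow> 3 \<Rightarrow> 3 \<Rightarrow> real"
  where "hess_jet c J i j = j2 J i j c - (\<Sum>k\<in>UNIV. chr (gi J) (g1 J) k i j * j1 J k c)"

definition lap_jet :: "icomp \<Rightarrow> jet \<Rightarrow> real"
  where "lap_jet c J = - (\<Sum>i\<in>UNIV. \<Sum>j\<in>UNIV. gi J i j * hess_jet c J i j)"

definition ip_jet :: "icomp \<Rightarrow> icomp \<Rightarrow> jet \<Rightarrow> real"
  where "ip_jet c c' J = (\<Sum>i\<in>UNIV. \<Sum>j\<in>UNIV. gi J i j * j1 J i c * j1 J j c')"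

definition scal_jet :: "jet \<Rightarrow> real"
  where "scal_jet J = (\<Sum>i\<in>UNIV. \<Sum>j\<in>UNIV. gi J i j * ric (gi J) (g1 J) (g2 J) i j)"

text \<open>
  Jets of the conformal metric: the metric is taken from the jet \<open>B\<close>, the conformal factor
  from \<open>J\<close>.
\<close>

definition conf0 :: "jet \<Rightarrow> jet \<Rightarrow> 3 \<Rightarrow> 3 \<Rightarrow> real"
  where "conf0 B J a b = exp (2 * j0 J U) * g0 B a b"
definition conf1 :: "jet \<Rightarrow> jet \<Rightarrow> 3 \<Rightarrow> 3 \<Rightarrow> 3 \<Rightarrow> real"
  where "conf1 B J i a b = exp (2 * j0 J U) * (2 * j1 J i U * g0 B a b + g1 B i a b)"
definition conf2 :: "jet \<Rightarrow> jet \<Rightarrow> 3 \<Rightarrow> 3 \<Rightarrow> 3 \<Rightarrow> 3 \<Rightarrow> real"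
  where "conf2 B J m i a b = exp (2 * j0 J U) *
    (2 * j1 J m U * (2 * j1 J i U * g0 B a b + g1 B i a b)
      + (2 * j2 J m i U * g0 B a b + 2 * j1 J i U * g1 B m a b + g2 B m i a b))"
definition confi :: "jet \<Rightarrow> jet \<Rightarrow> 3 \<Rightarrow> 3 \<Rightarrow> real"
  where "confi B J k l = exp (- 2 * j0 J U) * gi B k l"

definition gauge_jet :: "jet \<Rightarrow> jet \<Rightarrow> 3 \<Rightarrow> real"
  where "gauge_jet B J b = dvg (confi B J) (conf1 B J) (conf0 J J) (conf1 J J) b"

definition gauge_jet_partials :: "jet \<Rightarrow> jet \<Rightarrow> 3 \<Rightarrow> 3 \<Rightarrow> real"
  where "gauge_jet_partials B J m b =
    dvg_partials (confi B J) (conf1 B J) (conf2 B J) (conf0 J J) (conf1 J J) (conf2 J J) m b"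

definition gauge_sharp :: "jet \<Rightarrow> jet \<Rightarrow> 3 \<Rightarrow> real"
  where "gauge_sharp B J l = (\<Sum>b\<in>UNIV. confi J J l b * gauge_jet B J b)"

definition gauge_sharp_partials :: "jet \<Rightarrow> jet \<Rightarrow> 3 \<Rightarrow> 3 \<Rightarrow> real"
  where "gauge_sharp_partials B J m l = (\<Sum>b\<in>UNIV.
    inv_partials (confi J J) (conf1 J J) m l b * gauge_jet B J b
    + confi J J l b * gauge_jet_partials B J m b)"

definition dstar_jet :: "jet \<Rightarrow> jet \<Rightarrow> 3 \<Rightarrow> 3 \<Rightarrow> real"
  where "dstar_jet B J i j = (1/2) * (\<Sum>l\<in>UNIV. gauge_sharp B J l * conf1 J J l i j
    + conf0 J J l j * gauge_sharp_partials B J i l + conf0 J J i l * gauge_sharp_partials B J j l)"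

definition metric_jet :: "jet \<Rightarrow> jet \<Rightarrow> 3 \<Rightarrow> 3 \<Rightarrow> real"
  where "metric_jet B J i j = 2 *
    (ric (gi J) (g1 J) (g2 J) i j - hess_jet U J i j - j1 J i U * j1 J j U
     - (2 * exp (- 4 * j0 J U)) * (j1 J i Phi * j1 J j Phi - ip_jet Phi Phi J * g0 J i j)
     + (lap_jet U J - ip_jet U U J - 2 * exp (- 4 * j0 J U) * ip_jet Phi Phi J) * g0 J i j
     + (- (1/2) * (scal_jet J + 4 * lap_jet U J - 4 * ip_jet U U J
        - 2 * exp (- 4 * j0 J U) * ip_jet Phi Phi J)) * g0 J i j
     + dstar_jet B J i j)"

definition u_jet :: "jet \<Rightarrow> real"
  where "u_jet J = 8 * exp (- 2 * j0 J U) * (lap_jet U J - ip_jet U U J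
    - 2 * exp (- 4 * j0 J U) * ip_jet Phi Phi J)"

definition phi_jet :: "jet \<Rightarrow> real"
  where "phi_jet J = 8 * exp (- 6 * j0 J U) * (lap_jet Phi J + 3 * ip_jet U Phi J)"

section \<open>Unit normal and mean curvature on jets\<close>

lemma neg_inverse_sqrt_has_derivative:
  fixes s :: real
  assumes "s > 0"
  shows "((\<lambda>s. - 1 / sqrt s) has_real_derivative 1 / (2 * s * sqrt s)) (at s)"
  using assms by (auto intro!: derivative_eq_intros simp: field_simps)

definition sqn :: "real^3 \<Rightarrow> (3 \<Rightarrow> 3 \<Rightarrow> real) \<Rightarrow> real"
  where "sqn x M = (\<Sum>i\<in>UNIV. \<Sum>j\<in>UNIV. M i j * x $ i * x $ j)"

definition nrm :: "real^3 \<Rightarrow> (3 \<Rightarrow> 3 \<Rightarrow> real) \<Rightarrow> 3 \<Rightarrow> real"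
  where "nrm x M l = (- 1 / sqrt (sqn x M)) * (\<Sum>b\<in>UNIV. M l b * x $ b)"

text \<open>The terms with \<open>if m = i\<close>, \<open>if m = j\<close> and
  \<open>if m = b\<close> differentiate the position covector in \<open>normal\<close>, which varies
  with the point.\<close>

definition nrm_partials :: "real^3 \<Rightarrow> (3 \<Rightarrow> 3 \<Rightarrow> real) \<Rightarrow> (3 \<Rightarrow> 3 \<Rightarrow> 3 \<Rightarrow> real) \<Rightarrow> 3 \<Rightarrow> 3 \<Rightarrow> real"
  where "nrm_partials x M D m l =
    (1 / (2 * sqn x M * sqrt (sqn x M))) * (\<Sum>i\<in>UNIV. \<Sum>j\<in>UNIV.
        (inv_partials M D m i j * x $ i + M i j * (if m = i then 1 else 0)) * x $ j
        + M i j * x $ i * (if m = j then 1 else 0)) * (\<Sum>b\<in>UNIV. M l b * x $ b)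
    + (- 1 / sqrt (sqn x M)) *
        (\<Sum>b\<in>UNIV. inv_partials M D m l b * x $ b + M l b * (if m = b then 1 else 0))"

definition mean_curv_jet :: "real^3 \<Rightarrow> jet \<Rightarrow> real"
  where "mean_curv_jet x J = (\<Sum>i\<in>UNIV. \<Sum>j\<in>UNIV.
    (gi J i j - nrm x (gi J) i * nrm x (gi J) j) * ((1/2) * (\<Sum>l\<in>UNIV.
      nrm x (gi J) l * g1 J l i j + g0 J l j * nrm_partials x (gi J) (g1 J) i l
      + g0 J i l * nrm_partials x (gi J) (g1 J) j l)))"

definition normal_deriv_jet :: "real^3 \<Rightarrow> jet \<Rightarrow> real"
  where "normal_deriv_jet x J = (\<Sum>i\<in>UNIV. nrm x (gi J) i * j1 J i Phi)"

section \<open>Evaluating the operator through jets\<close>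

text \<open>The jet is a parameter tied to the fields by an equation, so that perturbed fields can
  be interpreted with a jet already in the form \<open>J + t *\<^sub>R V\<close>.\<close>

locale field_point =
  fixes g :: tensor2 and u \<phi> :: "real^3 \<Rightarrow> real" and x :: "real^3" and J :: jet
  assumes reg: "regular_fields (g, u, \<phi>)" and x: "x \<in> ext" and det: "det (g x) \<noteq> 0"
    and J: "J = jet_of (g, u, \<phi>) x"
begin

lemma regular_metric: "regular_metric g x"
  using jet_of_metric[OF reg] x det by (simp add: regular_metric_def)

lemma twice_diff_u: "twice_diff u"
  using reg icoord_eta(1)[of g u \<phi>] unfolding regular_fields_def by metis

lemma at_metric: "comp_at g x = g0 J" "pd_at g x = g1 J" "pd2_at g x = g2 J" "ginv_at g x = gi J"
  using jet_of_metric[OF reg x] by (simp_all add: J)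

lemma at_metric': "g x $ a $ b = g0 J a b" "pdS i (\<lambda>y. g y $ a $ b) x = g1 J i a b"
    "ginv g x $ a $ b = gi J a b" "pdS m (pdS i (\<lambda>y. g y $ a $ b)) x = g2 J m i a b"
  using at_metric by (simp_all add: fun_eq_iff)

lemma at_scalar: "u x = j0 J U" "pdS i u x = j1 J i U" "pdS i \<phi> x = j1 J i Phi"
    "pdS m (pdS i u) x = j2 J m i U" "pdS m (pdS i \<phi>) x = j2 J m i Phi"
  by (simp_all add: J jet_of_scalar)

lemma christoffel_jet: "christoffel g k i j x = chr (gi J) (g1 J) k i j"
  by (simp add: christoffel_chr at_metric)

lemma Hess_jet: "Hess g u x $ i $ j = hess_jet U J i j" "Hess g \<phi> x $ i $ j = hess_jet Phi J i j"
  by (simp_all add: Hess_def hess_jet_def christoffel_jet at_scalar)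

lemma Lap_jet: "Lap g u x = lap_jet U J" "Lap g \<phi> x = lap_jet Phi J"
  by (simp_all add: Lap_def tr_def lap_jet_def Hess_jet at_metric')

lemma ip_jet: "ip g x (d u x) (d u x) = ip_jet U U J" "ip g x (d \<phi> x) (d \<phi> x) = ip_jet Phi Phi J"
    "ip g x (d u x) (d \<phi> x) = ip_jet U Phi J"
  by (simp_all add: ip_def ip_jet_def d_def at_metric' at_scalar)

lemma d_component: "d u x $ i = j1 J i U" "d \<phi> x $ i = j1 J i Phi"
  by (simp_all add: d_def at_scalar)

lemma Ric_jet: "Ric g x $ i $ j = ric (gi J) (g1 J) (g2 J) i j"
  by (simp add: Ric_ric[OF regular_metric] at_metric)

lemma scal_jet: "scal g x = scal_jet J"
  by (simp add: scal_def tr_def scal_jet_def Ric_jet at_metric')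

lemma conf_self:
  "regular_metric (conf u g) x" "comp_at (conf u g) x = conf0 J J" "pd_at (conf u g) x = conf1 J J"
  "pd2_at (conf u g) x = conf2 J J" "ginv_at (conf u g) x = confi J J"
  using regular_metric_conf[OF regular_metric twice_diff_u] ginv_conf[where g = g, OF det]
  by (simp_all add: fun_eq_iff conf0_def conf1_def conf2_def confi_def at_scalar
      at_metric')
     (simp add: conf_def at_metric' at_scalar)

lemma conf_self':
  "conf u g x $ a $ b = conf0 J J a b" "pdS i (\<lambda>y. conf u g y $ a $ b) x = conf1 J J i a b"
  "ginv (conf u g) x $ a $ b = confi J J a b"
  using conf_self by (simp_all add: fun_eq_iff)

lemma ip_sqn: "ip g x x x = sqn x (gi J)"
  by (simp add: ip_def sqn_def at_metric')

lemma L_u_jet: "L_u g u \<phi> x = u_jet J"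
  by (simp add: L_u_def u_jet_def Lap_jet ip_jet at_scalar(1))

lemma L_phi_jet: "L_phi g u \<phi> x = phi_jet J"
  by (simp add: L_phi_def phi_jet_def Lap_jet ip_jet at_scalar(1))

end

text \<open>Here \<open>h\<close> is the reference metric of the gauge, with jet \<open>B\<close>.\<close>

locale gauge_point = field_point +
  fixes h :: tensor2 and v \<psi> :: "real^3 \<Rightarrow> real" and B :: jet
  assumes ref: "field_point h v \<psi> x B"
begin

interpretation ref: field_point h v \<psi> x B
  by (rule ref)

lemma conf_ref:
  "regular_metric (conf u h) x" "pd_at (conf u h) x = conf1 B J"
  "pd2_at (conf u h) x = conf2 B J" "ginv_at (conf u h) x = confi B J"
  using regular_metric_conf[OF ref.regular_metric twice_diff_u] ginv_conf[where g = h, OF ref.det]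
  by (simp_all add: fun_eq_iff conf1_def conf2_def confi_def at_scalar
      ref.at_metric')

lemma gauge_gauge_jet: "gauge h g u x $ b = gauge_jet B J b"
  by (simp add: gauge_def gauge_jet_def diverg_dvg conf_self conf_ref)

lemma has_partials_gauge:
  "has_partials (\<lambda>y. gauge h g u y $ b) (\<lambda>m. gauge_jet_partials B J m b) x"
  using has_partials_diverg[OF conf_ref(1) conf_self(1), of b]
  by (simp add: gauge_def gauge_jet_partials_def conf_self conf_ref)

lemma dstar_dstar_jet: "dstar (conf u g) (gauge h g u) x $ i $ j = dstar_jet B J i j"
proof -
  have X: "(\<lambda>y. sharp (conf u g) (gauge h g u) y $ l)
      = (\<lambda>y. \<Sum>b\<in>UNIV. ginv (conf u g) y $ l $ b * gauge h g u y $ b)" for l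
    by (simp add: sharp_def matrix_vector_mult_def)
  have "has_partials (\<lambda>y. sharp (conf u g) (gauge h g u) y $ l)
      (\<lambda>m. gauge_sharp_partials B J m l) x" for l
    unfolding X
    by (rule has_partials_eq, rule has_partials_sum[OF has_partials_mult[OF
            regular_metric_ginv[OF conf_self(1)] has_partials_gauge]])
       (simp add: gauge_sharp_partials_def gauge_gauge_jet conf_self conf_self')
  from has_partials_pd[OF this x]
  have dX: "pdS i (\<lambda>y. sharp (conf u g) (gauge h g u) y $ l) x = gauge_sharp_partials B J i l" for i l .
  have X0: "sharp (conf u g) (gauge h g u) x $ l = gauge_sharp B J l" for l
    by (simp add: sharp_def matrix_vector_mult_def gauge_sharp_def gauge_gauge_jet conf_self')
  show ?thesis
    by (simp add: dstar_def Lie_def dstar_jet_def dX X0 conf_self')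
qed

lemma L_metric_jet: "L_metric h g u \<phi> x $ i $ j = metric_jet B J i j"
  by (simp add: L_metric_def metric_jet_def T_S_def tensor_def Ric_jet Hess_jet Lap_jet scal_jet
      ip_jet d_component dstar_dstar_jet at_metric' at_scalar)

end

locale boundary_point = field_point +
  assumes pos: "ip g x x x > 0"
begin

lemma normal_nrm: "normal g x $ l = nrm x (gi J) l"
  by (simp add: normal_def nrm_def ip_sqn matrix_vector_mult_def at_metric')

lemma has_partials_normal:
  "has_partials (\<lambda>y. normal g y $ l) (\<lambda>m. nrm_partials x (gi J) (g1 J) m l) x"
proof -
  from neg_inverse_sqrt_has_derivative[OF pos]
  have d: "((\<lambda>s. - 1 / sqrt s) has_real_derivative 1 / (2 * ip g x x x * sqrt (ip g x x x)))
      (at (\<Sum>i\<in>UNIV. \<Sum>j\<in>UNIV. ginv g x $ i $ j * x $ i * x $ j))"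
    by (simp add: ip_def)
  have "has_partials (\<lambda>y. (- 1 / sqrt (\<Sum>i\<in>UNIV. \<Sum>j\<in>UNIV. ginv g y $ i $ j * y $ i * y $ j))
      * (\<Sum>b\<in>UNIV. ginv g y $ l $ b * y $ b)) (\<lambda>m. nrm_partials x (gi J) (g1 J) m l) x"
    by (rule has_partials_eq, rule has_partials_mult[OF has_partials_chain[OF has_partials_sum[OF
            has_partials_sum[OF has_partials_mult[OF has_partials_mult[OF regular_metric_ginv[OF regular_metric]
              has_partials_coordinate] has_partials_coordinate]]] d] has_partials_sum[OF
            has_partials_mult[OF regular_metric_ginv[OF regular_metric] has_partials_coordinate]]])
       (simp add: nrm_partials_def ip_sqn at_metric at_metric' sqn_def)
  then show ?thesis
    by (simp add: normal_def ip_def matrix_vector_mult_def)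
qed

lemma mean_curv_mean_curv_jet: "mean_curv g x = mean_curv_jet x J"
  by (simp add: mean_curv_def mean_curv_jet_def Lie_def normal_nrm at_metric'
      has_partials_pd[OF has_partials_normal x])

lemma normal_deriv: "normal g x \<bullet> d \<phi> x = normal_deriv_jet x J"
  by (simp add: inner_vec_def normal_deriv_jet_def normal_nrm d_def at_scalar)

end

section \<open>Principal parts of the linearization\<close>

lemma j_add: "j0 (V + W) c = j0 V c + j0 W c" "j1 (V + W) i c = j1 V i c + j1 W i c"
    "j2 (V + W) i j c = j2 V i j c + j2 W i j c"
  and j_scaleR: "j0 (r *\<^sub>R V) c = r * j0 V c" "j1 (r *\<^sub>R V) i c = r * j1 V i c"
    "j2 (r *\<^sub>R V) i j c = r * j2 V i j c"
  by (simp_all add: j0_def j1_def j2_def)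

lemma bounded_linear_j:
  "bounded_linear (\<lambda>V. j0 V c)" "bounded_linear (\<lambda>V. j1 V i c)" "bounded_linear (\<lambda>V. j2 V i j c)"
  by (intro linear_conv_bounded_linear[THEN iffD1] linearI; simp add: j_add j_scaleR)+

text \<open>The unit jet for the derivative of component c along a list of at most two indices: a
  linear functional evaluated on it gives the corresponding coefficient in
  \<open>diff_expr\<close>.\<close>

definition jet_basis :: "icomp \<Rightarrow> 3 list \<Rightarrow> jet"
  where "jet_basis c is = (case is of [] \<Rightarrow> (axis c 1, 0, 0) | [i] \<Rightarrow> (0, axis i (axis c 1), 0)
    | i # j # _ \<Rightarrow> (0, 0, axis i (axis j (axis c 1))))"

lemma j_jet_basis:
  "j0 (jet_basis c []) c' = of_bool (c' = c)" "j1 (jet_basis c []) i c' = 0" "j2 (jet_basis c []) i j c' = 0"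
  "j0 (jet_basis c [k]) c' = 0" "j1 (jet_basis c [k]) i c' = of_bool (i = k \<and> c' = c)"
  "j2 (jet_basis c [k]) i j c' = 0"
  "j0 (jet_basis c [k, l]) c' = 0" "j1 (jet_basis c [k, l]) i c' = 0"
  "j2 (jet_basis c [k, l]) i j c' = of_bool (i = k \<and> j = l \<and> c' = c)"
  by (auto simp: jet_basis_def j0_def j1_def j2_def axis_def)

lemma jet_expansion:
  "V = (\<Sum>c\<in>UNIV. j0 V c *\<^sub>R jet_basis c []) + (\<Sum>c\<in>UNIV. \<Sum>i\<in>UNIV. j1 V i c *\<^sub>R jet_basis c [i])
    + (\<Sum>c\<in>UNIV. \<Sum>i\<in>UNIV. \<Sum>j\<in>UNIV. j2 V i j c *\<^sub>R jet_basis c [i, j])" (is "_ = ?S")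
proof -
  note lin = bounded_linear_j[THEN bounded_linear.linear, THEN linear_sum]
  have "j0 ?S c = j0 V c" for c
    by (simp add: j_add lin j_scaleR j_jet_basis)
  moreover have "j1 ?S i c = j1 V i c" for i c
    by (simp add: j_add lin j_scaleR j_jet_basis of_bool_conj)
       (simp add: flip: sum_distrib_left sum_distrib_right mult.assoc)
  moreover have "j2 ?S i j c = j2 V i j c" for i j c
    by (simp add: j_add lin j_scaleR j_jet_basis of_bool_conj)
       (simp add: flip: sum_distrib_left sum_distrib_right mult.assoc)
  ultimately show ?thesis
    by (auto simp: j0_def j1_def j2_def prod_eq_iff vec_eq_iff)
qed

section \<open>A calculus of top-order parts\<close>

text \<open>Jets of order above k are included, so the part P determined on this set also shows
  whether derivatives of higher order occur.\<close>

definition top_jets :: "nat \<Rightarrow> jet set"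
  where "top_jets k = {V. (0 < k \<longrightarrow> (\<forall>c. j0 V c = 0)) \<and> (1 < k \<longrightarrow> (\<forall>i c. j1 V i c = 0))}"

text \<open>\<open>P\<close> is the part of order \<open>k\<close> of the linearization of \<open>F\<close> at the jet \<open>B\<close>.\<close>

definition has_top :: "nat \<Rightarrow> jet \<Rightarrow> (jet \<Rightarrow> real) \<Rightarrow> (jet \<Rightarrow> real) \<Rightarrow> bool"
  where "has_top k B F P \<longleftrightarrow> (\<exists>F'. (F has_derivative F') (at B) \<and> (\<forall>V\<in>top_jets k. F' V = P V))"

lemma has_top_cong:
  assumes "has_top k B F P" "\<And>V. V \<in> top_jets k \<Longrightarrow> P V = Q V"
  shows "has_top k B F Q"
  using assms by (auto simp: has_top_def)

lemma has_top_const: "has_top k B (\<lambda>_. c) (\<lambda>_. 0)"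
  by (auto simp: has_top_def intro: exI[of _ "\<lambda>_. 0"])

lemma has_top_add:
  "has_top k B F P \<Longrightarrow> has_top k B G Q \<Longrightarrow> has_top k B (\<lambda>J. F J + G J) (\<lambda>V. P V + Q V)"
  unfolding has_top_def
  by (elim exE conjE, intro exI conjI, erule (1) has_derivative_add) simp_all

lemma has_top_diff:
  "has_top k B F P \<Longrightarrow> has_top k B G Q \<Longrightarrow> has_top k B (\<lambda>J. F J - G J) (\<lambda>V. P V - Q V)"
  unfolding has_top_def
  by (elim exE conjE, intro exI conjI, erule (1) has_derivative_diff) simp_all

lemma has_top_minus: "has_top k B F P \<Longrightarrow> has_top k B (\<lambda>J. - F J) (\<lambda>V. - P V)"
  unfolding has_top_def
  by (elim exE conjE, intro exI conjI, erule has_derivative_minus) simp_all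

lemma has_top_mult:
  "has_top k B F P \<Longrightarrow> has_top k B G Q \<Longrightarrow> has_top k B (\<lambda>J. F J * G J) (\<lambda>V. F B * Q V + P V * G B)"
  unfolding has_top_def
  by (elim exE conjE, intro exI conjI, erule (1) has_derivative_mult) simp_all

lemma has_top_chain:
  assumes "has_top k B F P" "(h has_real_derivative h') (at (F B))"
  shows "has_top k B (\<lambda>J. h (F J)) (\<lambda>V. h' * P V)"
proof -
  obtain F' where F': "(F has_derivative F') (at B)" "\<forall>V\<in>top_jets k. F' V = P V"
    using assms(1) by (auto simp: has_top_def)
  from has_derivative_compose[OF F'(1) assms(2)[unfolded has_field_derivative_def]] F'(2)
  show ?thesis
    unfolding has_top_def by (intro exI[of _ "\<lambda>V. h' * F' V"]) auto
qed

lemma has_top_sum: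
  assumes "\<And>a. a \<in> I \<Longrightarrow> has_top k B (F a) (P a)"
  shows "has_top k B (\<lambda>J. \<Sum>a\<in>I. F a J) (\<lambda>V. \<Sum>a\<in>I. P a V)"
proof -
  obtain F' where F': "\<And>a. a \<in> I \<Longrightarrow> (F a has_derivative F' a) (at B)"
      "\<And>a V. a \<in> I \<Longrightarrow> V \<in> top_jets k \<Longrightarrow> F' a V = P a V"
    using assms unfolding has_top_def by metis
  show ?thesis
    unfolding has_top_def using F'
    by (intro exI[of _ "\<lambda>V. \<Sum>a\<in>I. F' a V"]) (auto intro: has_derivative_sum)
qed

lemma has_top_linear:
  assumes "bounded_linear F"
  shows "has_top k B F F"
  using assms by (auto simp: has_top_def intro: bounded_linear_imp_has_derivative)

lemmas has_top_j = has_top_linear[OF bounded_linear_j(1)] has_top_linear[OF bounded_linear_j(2)]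
  has_top_linear[OF bounded_linear_j(3)]

lemma has_top_low:
  assumes "has_top k B F P" "\<And>V. V \<in> top_jets k \<Longrightarrow> P V = 0"
  shows "has_top k B F (\<lambda>_. 0)"
  using has_top_cong[OF assms(1), of "\<lambda>_. 0"] assms(2) by blast

lemma has_top_j0: "0 < k \<Longrightarrow> has_top k B (\<lambda>J. j0 J c) (\<lambda>_. 0)"
  by (rule has_top_low[OF has_top_j(1)]) (auto simp: top_jets_def)

lemma has_top_j1: "1 < k \<Longrightarrow> has_top k B (\<lambda>J. j1 J i c) (\<lambda>_. 0)"
  by (rule has_top_low[OF has_top_j(2)]) (auto simp: top_jets_def)

lemma has_top_exp: "0 < k \<Longrightarrow> has_top k B (\<lambda>J. exp (r * j0 J c)) (\<lambda>_. 0)"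
  by (rule has_top_low[OF has_top_chain[where h = exp, OF has_top_mult[OF has_top_const has_top_j0]]])
     (auto intro!: derivative_eq_intros)

lemma has_top_g:
  "0 < k \<Longrightarrow> has_top k B (\<lambda>J. g0 J a b) (\<lambda>_. 0)"
  "has_top k B (\<lambda>J. g1 J i a b) (\<lambda>V. g1 V i a b)"
  "has_top k B (\<lambda>J. g2 J m i a b) (\<lambda>V. g2 V m i a b)"
  unfolding g0_def g1_def g2_def by (simp_all add: has_top_j0 has_top_j)

lemma has_top_gi:
  assumes "0 < k" "det ((\<chi> a b. g0 B a b) :: real^3^3) \<noteq> 0"
  shows "has_top k B (\<lambda>J. gi J p q) (\<lambda>_. 0)"
proof -
  let ?m = "\<lambda>J. (\<chi> a b. g0 J a b) :: real^3^3"
  have "bounded_linear ?m"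
    by (intro linear_conv_bounded_linear[THEN iffD1] linearI)
       (simp_all add: vec_eq_iff g0_def j_add j_scaleR)
  then have "(?m has_derivative ?m) (at B)"
    by (rule bounded_linear_imp_has_derivative)
  from has_derivative_compose[OF this matrix_inv_has_derivative[OF assms(2), of p q]]
  show ?thesis
    unfolding has_top_def gi_def
  proof (intro exI conjI ballI)
    fix V assume "V \<in> top_jets k"
    then have "g0 V a b = 0" for a b
      using assms(1) by (simp add: top_jets_def g0_def)
    then show "- (\<Sum>r\<in>UNIV. \<Sum>s\<in>UNIV. matrix_inv (?m B) $ p $ r * ?m V $ r $ s * matrix_inv (?m B) $ s $ q) = 0"
      by simp
  qed
qed

text \<open>Here and in the next lemmas a factor of lower order contributes only its value at B, so
  expressions linear in the highest derivatives keep their form with frozen coefficients.\<close>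

lemma has_top_inv_partials:
  assumes M: "\<And>k' l. has_top k B (\<lambda>J. M J k' l) (\<lambda>_. 0)"
    and D: "\<And>i a b. has_top k B (\<lambda>J. D J i a b) (D' i a b)"
  shows "has_top k B (\<lambda>J. inv_partials (M J) (D J) m p q)
    (\<lambda>V. inv_partials (M B) (\<lambda>i a b. D' i a b V) m p q)"
  unfolding inv_partials_def
  by (rule has_top_cong, (rule has_top_minus has_top_sum has_top_mult M D)+)
     simp

lemma has_top_chr:
  assumes M: "\<And>k' l. has_top k B (\<lambda>J. M J k' l) (\<lambda>_. 0)"
    and D: "\<And>i a b. has_top k B (\<lambda>J. D J i a b) (D' i a b)"
  shows "has_top k B (\<lambda>J. chr (M J) (D J) p i j) (\<lambda>V. chr (M B) (\<lambda>i a b. D' i a b V) p i j)"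
  unfolding chr_def divide_inverse
  by (rule has_top_cong, (rule has_top_add has_top_diff has_top_const has_top_sum has_top_mult M D)+)
     simp

lemma chr_0: "chr M (\<lambda>_ _ _. 0) k i j = 0" and inv_partials_0: "inv_partials M (\<lambda>_ _ _. 0) m k l = 0"
  by (simp_all add: chr_def inv_partials_def)

text \<open>First derivatives now have lower order, so the products with derivatives of the inverse
  metric drop out and a Christoffel expression in the second derivatives remains.\<close>

lemma has_top_chr_partials:
  assumes M: "\<And>k' l. has_top k B (\<lambda>J. M J k' l) (\<lambda>_. 0)"
    and D: "\<And>i a b. has_top k B (\<lambda>J. D J i a b) (\<lambda>_. 0)"
    and D2: "\<And>m i a b. has_top k B (\<lambda>J. D2 J m i a b) (D2' m i a b)"
  shows "has_top k B (\<lambda>J. chr_partials (M J) (D J) (D2 J) m p i j)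
    (\<lambda>V. chr (M B) (\<lambda>i a b. D2' m i a b V) p i j)"
  unfolding chr_partials_def divide_inverse
  by (rule has_top_cong, (rule has_top_add has_top_diff has_top_const has_top_sum has_top_mult M D D2
        has_top_inv_partials)+)
     (simp add: inv_partials_0 chr_def)

lemma has_top_ric:
  assumes M: "\<And>k' l. has_top k B (\<lambda>J. M J k' l) (\<lambda>_. 0)"
    and D: "\<And>i a b. has_top k B (\<lambda>J. D J i a b) (\<lambda>_. 0)"
    and D2: "\<And>m i a b. has_top k B (\<lambda>J. D2 J m i a b) (D2' m i a b)"
  shows "has_top k B (\<lambda>J. ric (M J) (D J) (D2 J) i j)
    (\<lambda>V. \<Sum>p\<in>UNIV. chr (M B) (\<lambda>i a b. D2' p i a b V) p i j - chr (M B) (\<lambda>m a b. D2' i m a b V) p p j)"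
  unfolding ric_def
  by (rule has_top_cong, (rule has_top_add has_top_diff has_top_sum has_top_mult
        has_top_chr_partials has_top_chr M D D2)+)
     (simp add: chr_0)

lemma has_top_dvg:
  assumes M: "\<And>k' l. has_top k B (\<lambda>J. M J k' l) (\<lambda>_. 0)"
    and K: "\<And>a b. has_top k B (\<lambda>J. K J a b) (\<lambda>_. 0)"
    and D: "\<And>i a b. has_top k B (\<lambda>J. D J i a b) (D' i a b)"
    and DK: "\<And>i a b. has_top k B (\<lambda>J. DK J i a b) (DK' i a b)"
  shows "has_top k B (\<lambda>J. dvg (M J) (D J) (K J) (DK J) b)
    (\<lambda>V. dvg (M B) (\<lambda>i a b. D' i a b V) (K B) (\<lambda>i a b. DK' i a b V) b)"
  unfolding dvg_def
  by (rule has_top_cong, (rule has_top_add has_top_diff has_top_minus has_top_sum has_top_mult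
        has_top_chr M D K DK)+)
     simp

lemma has_top_dvg_partials:
  assumes M: "\<And>k' l. has_top k B (\<lambda>J. M J k' l) (\<lambda>_. 0)"
    and K: "\<And>a b. has_top k B (\<lambda>J. K J a b) (\<lambda>_. 0)"
    and D: "\<And>i a b. has_top k B (\<lambda>J. D J i a b) (\<lambda>_. 0)"
    and DK: "\<And>i a b. has_top k B (\<lambda>J. DK J i a b) (\<lambda>_. 0)"
    and D2: "\<And>m i a b. has_top k B (\<lambda>J. D2 J m i a b) (D2' m i a b)"
    and DDK: "\<And>m i a b. has_top k B (\<lambda>J. DDK J m i a b) (DDK' m i a b)"
  shows "has_top k B (\<lambda>J. dvg_partials (M J) (D J) (D2 J) (K J) (DK J) (DDK J) m b)
    (\<lambda>V. dvg (M B) (\<lambda>i a b. D2' m i a b V) (K B) (\<lambda>i a b. DDK' m i a b V) b)"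
  unfolding dvg_partials_def
  by (rule has_top_cong, (rule has_top_add has_top_diff has_top_minus has_top_sum has_top_mult
        has_top_chr_partials has_top_chr has_top_inv_partials M D K DK D2 DDK)+)
     (simp add: dvg_def inv_partials_0 chr_0)

section \<open>The interior operator and the gauge at top order\<close>

locale invertible_jet =
  fixes B :: jet
  assumes det_B: "det ((\<chi> a b. g0 B a b) :: real^3^3) \<noteq> 0"
begin

lemma gi_mult: "(\<Sum>b\<in>UNIV. gi B a b * g0 B b c) = (if a = c then 1 else 0)"
    "(\<Sum>b\<in>UNIV. g0 B a b * gi B b c) = (if a = c then 1 else 0)"
  using matrix_inv_mult[OF det_B]
  by (simp_all add: gi_def matrix_matrix_mult_def vec_eq_iff mat_def)

lemma g0_sym: "g0 J a b = g0 J b a"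
  by (simp add: g0_def sym_index_commute[of a b])

lemma gi_sym: "gi B a b = gi B b a"
proof -
  let ?g = "(\<chi> a b. g0 B a b) :: real^3^3"
  have t: "transpose ?g = ?g"
    by (simp add: transpose_def vec_eq_iff g0_sym)
  have "transpose (matrix_inv ?g) = transpose (matrix_inv ?g) ** (?g ** matrix_inv ?g)"
    by (simp add: matrix_inv_mult(1)[OF det_B])
  also have "\<dots> = transpose (?g ** matrix_inv ?g) ** matrix_inv ?g"
    by (simp add: matrix_mul_assoc matrix_transpose_mul t)
  also have "\<dots> = matrix_inv ?g"
    by (simp add: matrix_inv_mult(1)[OF det_B])
  finally show ?thesis
    by (simp add: gi_def transpose_def vec_eq_iff)
qed

lemma lower_raise: "(\<Sum>c\<in>UNIV. g0 B a c * (\<Sum>d\<in>UNIV. gi B c d * v d)) = v a"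
proof -
  have "(\<Sum>c\<in>UNIV. g0 B a c * (\<Sum>d\<in>UNIV. gi B c d * v d))
      = (\<Sum>c\<in>UNIV. \<Sum>d\<in>UNIV. (g0 B a c * gi B c d) * v d)"
    by (simp add: sum_distrib_left mult.assoc)
  also have "\<dots> = (\<Sum>d\<in>UNIV. (\<Sum>c\<in>UNIV. g0 B a c * gi B c d) * v d)"
    by (subst sum.swap) (simp add: sum_distrib_right)
  finally show ?thesis
    by (simp add: gi_mult if_distrib[where f = "\<lambda>x. x * _"] cong: if_cong)
qed

lemma gi_mult': "(\<Sum>p\<in>UNIV. gi B p l * g0 B p b) = (if l = b then 1 else 0)"
  using gi_mult(1)[of l b] by (simp add: gi_sym[of l])

lemmas low2 = has_top_j0[OF pos2] has_top_j1[of 2, simplified]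
  has_top_exp[OF pos2] has_top_g(1)[OF pos2] has_top_gi[OF pos2 det_B]

lemma low2_g1: "has_top 2 B (\<lambda>J. g1 J i a b) (\<lambda>_. 0)"
  by (rule has_top_low[OF has_top_g(2)]) (simp add: top_jets_def g1_def)

lemma low2_chr: "has_top 2 B (\<lambda>J. chr (gi J) (g1 J) k i j) (\<lambda>_. 0)"
  by (rule has_top_low[OF has_top_chr[OF low2(5) low2_g1]]) (simp add: chr_0)

lemma top2_hess: "has_top 2 B (\<lambda>J. hess_jet c J i j) (\<lambda>V. j2 V i j c)"
  unfolding hess_jet_def
  by (rule has_top_cong, (rule has_top_diff has_top_j(3) has_top_sum has_top_mult low2_chr low2)+) simp

lemma top2_lap:
  "has_top 2 B (\<lambda>J. lap_jet c J) (\<lambda>V. - (\<Sum>i\<in>UNIV. \<Sum>j\<in>UNIV. gi B i j * j2 V i j c))"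
  unfolding lap_jet_def
  by (rule has_top_cong, (rule has_top_minus has_top_sum has_top_mult top2_hess low2)+) simp

lemma low2_ip: "has_top 2 B (\<lambda>J. ip_jet c c' J) (\<lambda>_. 0)"
  unfolding ip_jet_def
  by (rule has_top_low, (rule has_top_sum has_top_mult low2)+) simp

definition ric_top :: "3 \<Rightarrow> 3 \<Rightarrow> jet \<Rightarrow> real"
  where "ric_top i j V = (\<Sum>p\<in>UNIV.
    chr (gi B) (\<lambda>i a b. g2 V p i a b) p i j - chr (gi B) (\<lambda>m a b. g2 V i m a b) p p j)"

lemma top2_ric: "has_top 2 B (\<lambda>J. ric (gi J) (g1 J) (g2 J) i j) (ric_top i j)"
  unfolding ric_top_def [abs_def] by (rule has_top_ric[OF low2(5) low2_g1 has_top_g(3)])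

lemma top2_scal: "has_top 2 B scal_jet (\<lambda>V. \<Sum>i\<in>UNIV. \<Sum>j\<in>UNIV. gi B i j * ric_top i j V)"
  unfolding scal_jet_def [abs_def]
  by (rule has_top_cong, (rule has_top_sum has_top_mult top2_ric low2)+) simp

lemma low2_conf:
  "has_top 2 B (\<lambda>J. conf0 J J a b) (\<lambda>_. 0)" "has_top 2 B (\<lambda>J. conf1 J J i a b) (\<lambda>_. 0)"
  "has_top 2 B (\<lambda>J. conf1 B J i a b) (\<lambda>_. 0)"
  "has_top 2 B (\<lambda>J. confi J J p q) (\<lambda>_. 0)" "has_top 2 B (\<lambda>J. confi B J p q) (\<lambda>_. 0)"
  unfolding conf0_def conf1_def confi_def
  by (rule has_top_low, (rule has_top_add has_top_mult has_top_const low2 low2_g1)+, simp)+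

text \<open>The reference metric is frozen at B, so its conformal change contributes second
  derivatives of u only, while that of g contributes both kinds. This pair is the input of
  \<open>dvg_conformal\<close>.\<close>

lemma top2_conf2:
  "has_top 2 B (\<lambda>J. conf2 J J m i a b)
    (\<lambda>V. exp (2 * j0 B U) * (2 * j2 V m i U * g0 B a b + g2 V m i a b))"
  "has_top 2 B (\<lambda>J. conf2 B J m i a b) (\<lambda>V. exp (2 * j0 B U) * (2 * j2 V m i U * g0 B a b))"
  unfolding conf2_def
  by (rule has_top_cong, (rule has_top_add has_top_mult has_top_const low2 low2_g1 has_top_j(3)
        has_top_g(3))+, simp add: algebra_simps)+

lemma low2_gauge: "has_top 2 B (\<lambda>J. gauge_jet B J b) (\<lambda>_. 0)"
  unfolding gauge_jet_def
  by (rule has_top_low[OF has_top_dvg[OF low2_conf(5) low2_conf(1) low2_conf(3) low2_conf(2)]])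
     (simp add: dvg_def chr_0)

text \<open>
  The terms with second derivatives of the conformal factor cancel: the divergence of a metric with
  respect to itself vanishes.
\<close>

lemma dvg_conformal:
  "dvg (confi B B) (\<lambda>i a b. c * (2 * s i * g0 B a b)) (conf0 B B)
     (\<lambda>i a b. c * (2 * s i * g0 B a b + D i a b)) b
   = - (\<Sum>i\<in>UNIV. \<Sum>a\<in>UNIV. confi B B i a * (c * D i a b))"
proof -
  have e: "exp (- 2 * j0 B U) * exp (2 * j0 B U) = 1"
    by (simp flip: exp_add)
  \<comment> \<open>Lowering the upper index of the Christoffel symbol: the two conformal factors
    cancel and \<open>gi\<close> is contracted with \<open>g0\<close>.\<close>
  have key: "(\<Sum>p\<in>UNIV. chr (confi B B) (\<lambda>i a b. c * (2 * s i * g0 B a b)) p i a * conf0 B B p b)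
      = c * (s i * g0 B a b + s a * g0 B i b - s b * g0 B i a)" for i a b
  proof -
    define T where "T l = c * (s i * g0 B a l + s a * g0 B i l - s l * g0 B i a)" for l
    have "chr (confi B B) (\<lambda>i a b. c * (2 * s i * g0 B a b)) p i a
        = (\<Sum>l\<in>UNIV. exp (- 2 * j0 B U) * (gi B p l * T l))" for p
      unfolding chr_def confi_def T_def sum_divide_distrib
      by (rule sum.cong) (simp_all add: field_simps)
    then have "chr (confi B B) (\<lambda>i a b. c * (2 * s i * g0 B a b)) p i a * conf0 B B p b
        = exp (- 2 * j0 B U) * exp (2 * j0 B U) * (\<Sum>l\<in>UNIV. (gi B p l * g0 B p b) * T l)" for p
      by (simp add: conf0_def sum_distrib_left sum_distrib_right ac_simps)
    then have "(\<Sum>p\<in>UNIV. chr (confi B B) (\<lambda>i a b. c * (2 * s i * g0 B a b)) p i a * conf0 B B p b)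
        = (\<Sum>p\<in>UNIV. \<Sum>l\<in>UNIV. (gi B p l * g0 B p b) * T l)"
      by (simp only: e mult_1)
    also have "\<dots> = (\<Sum>l\<in>UNIV. (\<Sum>p\<in>UNIV. gi B p l * g0 B p b) * T l)"
      by (subst sum.swap) (simp add: sum_distrib_right)
    also have "\<dots> = T b"
      by (simp add: gi_mult' if_distrib[where f = "\<lambda>x. x * _"] cong: if_cong)
    finally show ?thesis
      by (simp add: T_def)
  qed
  \<comment> \<open>The two Christoffel terms of the covariant derivative add up to the derivative
    of the conformal factor times the metric, which is metric compatibility; after subtraction only
    D survives.\<close>
  have "(\<Sum>p\<in>UNIV. chr (confi B B) (\<lambda>i a b. c * (2 * s i * g0 B a b)) p i a * conf0 B B p b
        + chr (confi B B) (\<lambda>i a b. c * (2 * s i * g0 B a b)) p i b * conf0 B B a p)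
      = c * (2 * s i * g0 B a b)" for i a b
    using key[of i a b] key[of i b a]
    by (simp add: sum.distrib conf0_def g0_sym[of B a] algebra_simps)
  then show ?thesis
    by (simp add: dvg_def algebra_simps)
qed

lemma confi_exp: "confi B B i a * (exp (2 * j0 B U) * y) = gi B i a * y"
  by (simp add: confi_def mult.left_commute[of "gi B i a"] flip: exp_add mult.assoc)

lemma top2_gauge_partials:
  "has_top 2 B (\<lambda>J. gauge_jet_partials B J m b)
    (\<lambda>V. - (\<Sum>i\<in>UNIV. \<Sum>a\<in>UNIV. gi B i a * g2 V m i a b))"
  unfolding gauge_jet_partials_def
  by (rule has_top_cong[OF has_top_dvg_partials[OF low2_conf(5,1,3,2) top2_conf2(2,1)]])
     (simp only: dvg_conformal confi_exp)

lemma top2_sharp_partials: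
  "has_top 2 B (\<lambda>J. gauge_sharp_partials B J m l)
    (\<lambda>V. \<Sum>b\<in>UNIV. confi B B l b * - (\<Sum>i\<in>UNIV. \<Sum>a\<in>UNIV. gi B i a * g2 V m i a b))"
  unfolding gauge_sharp_partials_def
  by (rule has_top_cong, (rule has_top_sum has_top_add has_top_mult low2_conf low2_gauge
        top2_gauge_partials has_top_inv_partials)+)
     (simp add: inv_partials_0)

lemma low2_sharp: "has_top 2 B (\<lambda>J. gauge_sharp B J l) (\<lambda>_. 0)"
  unfolding gauge_sharp_def
  by (rule has_top_low, (rule has_top_sum has_top_mult low2_conf low2_gauge)+) simp

text \<open>The index of the gauge form is raised and lowered again with the same conformal metric,
  so the conformal factor disappears from the top order.\<close>

lemma top2_dstar:
  "has_top 2 B (\<lambda>J. dstar_jet B J i j)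
    (\<lambda>V. - (1/2) * (\<Sum>k\<in>UNIV. \<Sum>a\<in>UNIV. gi B k a * (g2 V i k a j + g2 V j k a i)))"
proof -
  have e: "exp (- 2 * j0 B U) * exp (2 * j0 B U) = 1"
    by (simp flip: exp_add)
  have c: "(\<Sum>l\<in>UNIV. conf0 B B l j * (\<Sum>b\<in>UNIV. confi B B l b * f b)) = f j" for j f
  proof -
    have "(\<Sum>l\<in>UNIV. conf0 B B l j * (\<Sum>b\<in>UNIV. confi B B l b * f b))
        = (\<Sum>l\<in>UNIV. \<Sum>b\<in>UNIV. (gi B b l * g0 B l j) * f b)"
      by (simp add: sum_distrib_left conf0_def confi_def ac_simps gi_sym e flip: exp_add)
    also have "\<dots> = (\<Sum>b\<in>UNIV. (\<Sum>l\<in>UNIV. gi B b l * g0 B l j) * f b)"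
      by (subst sum.swap) (simp add: sum_distrib_right)
    finally show ?thesis
      by (simp add: gi_mult if_distrib[where f = "\<lambda>x. x * _"] cong: if_cong)
  qed
  have c': "(\<Sum>l\<in>UNIV. conf0 B B j l * (\<Sum>b\<in>UNIV. confi B B l b * f b)) = f j" for j f
    using c[of j f] by (simp add: conf0_def g0_sym[of B j])
  show ?thesis
    unfolding dstar_jet_def
    by (rule has_top_cong, (rule has_top_sum has_top_add has_top_mult has_top_const low2_conf low2_sharp
          top2_sharp_partials)+)
       (simp add: sum.distrib sum_subtractf c c' distrib_left sum_negf)
qed

definition lap_top :: "icomp \<Rightarrow> jet \<Rightarrow> real"
  where "lap_top c V = (\<Sum>i\<in>UNIV. \<Sum>j\<in>UNIV. gi B i j * j2 V i j c)"

text \<open>The Laplacian of u enters with factor 1 from the equation and with factor -2 through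
  \<open>T_S\<close>; \<open>Lap\<close> being minus the trace of the Hessian, doubling gives
  \<open>+ 2 * lap_top U\<close>. The last sum comes from the gauge.\<close>

definition metric_top :: "3 \<Rightarrow> 3 \<Rightarrow> jet \<Rightarrow> real"
  where "metric_top i j V = 2 * ric_top i j V - 2 * j2 V i j U + 2 * lap_top U V * g0 B i j
    - (\<Sum>k\<in>UNIV. \<Sum>l\<in>UNIV. gi B k l * ric_top k l V) * g0 B i j
    - (\<Sum>k\<in>UNIV. \<Sum>a\<in>UNIV. gi B k a * (g2 V i k a j + g2 V j k a i))"

lemma top2_metric: "has_top 2 B (\<lambda>J. metric_jet B J i j) (metric_top i j)"
  unfolding metric_jet_def
  by (rule has_top_cong, (rule has_top_add has_top_diff has_top_mult has_top_const low2 low2_ip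
        top2_ric top2_scal top2_hess top2_lap top2_dstar)+)
     (simp add: metric_top_def lap_top_def algebra_simps)

lemma top2_u: "has_top 2 B u_jet (\<lambda>V. - 8 * exp (- 2 * j0 B U) * lap_top U V)"
  unfolding u_jet_def [abs_def]
  by (rule has_top_cong, (rule has_top_diff has_top_mult has_top_const low2 low2_ip top2_lap)+)
     (simp add: lap_top_def)

lemma top2_phi: "has_top 2 B phi_jet (\<lambda>V. - 8 * exp (- 6 * j0 B U) * lap_top Phi V)"
  unfolding phi_jet_def [abs_def]
  by (rule has_top_cong, (rule has_top_add has_top_mult has_top_const low2 low2_ip top2_lap)+)
     (simp add: lap_top_def)

lemmas low1 = has_top_j0[OF zero_less_one] has_top_exp[OF zero_less_one]
  has_top_g(1)[OF zero_less_one] has_top_gi[OF zero_less_one det_B]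

lemma low1_conf:
  "has_top 1 B (\<lambda>J. conf0 J J a b) (\<lambda>_. 0)" "has_top 1 B (\<lambda>J. confi B J p q) (\<lambda>_. 0)"
  unfolding conf0_def confi_def
  by (rule has_top_low, (rule has_top_add has_top_mult has_top_const low1)+, simp)+

lemma top1_conf1:
  "has_top 1 B (\<lambda>J. conf1 J J i a b)
    (\<lambda>V. exp (2 * j0 B U) * (2 * j1 V i U * g0 B a b + g1 V i a b))"
  "has_top 1 B (\<lambda>J. conf1 B J i a b) (\<lambda>V. exp (2 * j0 B U) * (2 * j1 V i U * g0 B a b))"
  unfolding conf1_def
  by (rule has_top_cong, (rule has_top_add has_top_mult has_top_const low1
        has_top_j(2) has_top_g(2))+, simp add: algebra_simps)+

lemma top1_gauge:
  "has_top 1 B (\<lambda>J. gauge_jet B J b) (\<lambda>V. - (\<Sum>i\<in>UNIV. \<Sum>a\<in>UNIV. gi B i a * g1 V i a b))"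
  unfolding gauge_jet_def
  by (rule has_top_cong[OF has_top_dvg[OF low1_conf(2,1) top1_conf1(2,1)]])
     (simp only: dvg_conformal confi_exp)

end

section \<open>The boundary operators at top order\<close>

locale boundary_jet = invertible_jet +
  fixes x :: "real^3"
  assumes sqn_pos: "sqn x (gi B) > 0"
begin

abbreviation N :: "3 \<Rightarrow> real"
  where "N \<equiv> nrm x (gi B)"

lemma low1_sqn: "has_top 1 B (\<lambda>J. sqn x (gi J)) (\<lambda>_. 0)"
  unfolding sqn_def
  by (rule has_top_low, (rule has_top_sum has_top_mult has_top_const low1)+) simp

lemma low1_nrm: "has_top 1 B (\<lambda>J. nrm x (gi J) l) (\<lambda>_. 0)"
proof -
  note d = has_top_chain[OF low1_sqn neg_inverse_sqrt_has_derivative[OF sqn_pos]]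
  show ?thesis
    unfolding nrm_def
    by (rule has_top_low, (rule d has_top_sum has_top_mult has_top_const low1)+) simp
qed

lemma gi_x: "(\<Sum>b\<in>UNIV. gi B l b * x $ b) = - (sqrt (sqn x (gi B)) * N l)"
  using sqn_pos by (simp add: nrm_def)

lemma gi_x': "(\<Sum>b\<in>UNIV. gi B b l * x $ b) = - (sqrt (sqn x (gi B)) * N l)"
  using gi_x[of l] by (simp add: gi_sym[of l])

lemma N_lower: "(\<Sum>l\<in>UNIV. g0 B i l * N l) = - (x $ i / sqrt (sqn x (gi B)))"
proof -
  have "(\<Sum>l\<in>UNIV. g0 B i l * - (sqrt (sqn x (gi B)) * N l)) = x $ i"
    using lower_raise[of i "\<lambda>b. x $ b"] by (simp only: gi_x)
  then have "sqrt (sqn x (gi B)) * (\<Sum>l\<in>UNIV. g0 B i l * N l) = - x $ i"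
    by (simp add: sum_distrib_left sum_negf algebra_simps)
  then show ?thesis
    using sqn_pos by (simp add: field_simps)
qed

lemma N_unit: "(\<Sum>i\<in>UNIV. N i * (\<Sum>l\<in>UNIV. g0 B i l * N l)) = 1"
proof -
  have "(\<Sum>i\<in>UNIV. (\<Sum>j\<in>UNIV. gi B i j * x $ j) * x $ i) = sqn x (gi B)"
    by (simp add: sqn_def sum_distrib_left sum_distrib_right algebra_simps)
  then have "(\<Sum>i\<in>UNIV. - (sqrt (sqn x (gi B)) * N i) * x $ i) = sqn x (gi B)"
    by (simp only: gi_x)
  then have "- (sqrt (sqn x (gi B)) * (\<Sum>i\<in>UNIV. N i * x $ i)) = sqn x (gi B)"
    by (simp add: sum_distrib_left sum_negf algebra_simps)
  also have "\<dots> = sqrt (sqn x (gi B)) * sqrt (sqn x (gi B))"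
    using sqn_pos by simp
  finally have "(\<Sum>i\<in>UNIV. N i * x $ i) = - sqrt (sqn x (gi B))"
    using sqn_pos by (simp only: mult_minus_right[symmetric] mult_cancel_left) auto
  then show ?thesis
    using sqn_pos by (simp add: N_lower sum_negf flip: sum_divide_distrib)
qed

text \<open>The derivative of the inverse metric is \<open>- M D M\<close>, and M applied to x is a
  negative multiple of N.\<close>

lemma inv_partials_N:
  "(\<Sum>b\<in>UNIV. inv_partials (gi B) D m l b * x $ b)
    = sqrt (sqn x (gi B)) * (\<Sum>p\<in>UNIV. \<Sum>q\<in>UNIV. gi B l p * D m p q * N q)"
proof -
  have "(\<Sum>b\<in>UNIV. inv_partials (gi B) D m l b * x $ b)
      = - (\<Sum>b\<in>UNIV. \<Sum>p\<in>UNIV. \<Sum>q\<in>UNIV. gi B l p * D m p q * (gi B q b * x $ b))"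
    by (simp add: inv_partials_def sum_distrib_right sum_negf mult.assoc)
  also have "\<dots> = - (\<Sum>p\<in>UNIV. \<Sum>q\<in>UNIV. gi B l p * D m p q * (\<Sum>b\<in>UNIV. gi B q b * x $ b))"
    by (simp only: sum_distrib_left) (subst sum.swap, intro arg_cong[where f = uminus] sum.cong refl sum.swap)
  also have "\<dots> = - (\<Sum>p\<in>UNIV. \<Sum>q\<in>UNIV. gi B l p * D m p q * - (sqrt (sqn x (gi B)) * N q))"
    by (simp only: gi_x)
  finally show ?thesis
    by (simp add: sum_distrib_left sum_negf algebra_simps)
qed

lemma inv_partials_NN:
  "(\<Sum>i\<in>UNIV. \<Sum>j\<in>UNIV. inv_partials (gi B) D m i j * x $ i * x $ j)
    = - (sqn x (gi B) * (\<Sum>p\<in>UNIV. \<Sum>q\<in>UNIV. N p * D m p q * N q))"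
proof -
  have "(\<Sum>i\<in>UNIV. \<Sum>j\<in>UNIV. inv_partials (gi B) D m i j * x $ i * x $ j)
      = (\<Sum>i\<in>UNIV. (\<Sum>b\<in>UNIV. inv_partials (gi B) D m i b * x $ b) * x $ i)"
    by (simp only: sum_distrib_left ac_simps)
  also have "\<dots> = sqrt (sqn x (gi B)) *
      (\<Sum>i\<in>UNIV. \<Sum>p\<in>UNIV. (gi B i p * x $ i) * (\<Sum>q\<in>UNIV. D m p q * N q))"
    unfolding inv_partials_N by (simp add: sum_distrib_left sum_distrib_right algebra_simps)
  also have "\<dots> = sqrt (sqn x (gi B)) *
      (\<Sum>p\<in>UNIV. (\<Sum>i\<in>UNIV. gi B i p * x $ i) * (\<Sum>q\<in>UNIV. D m p q * N q))"
    by (subst sum.swap) (simp add: sum_distrib_right)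
  also have "\<dots> = - (sqrt (sqn x (gi B)) * sqrt (sqn x (gi B)) * (\<Sum>p\<in>UNIV. \<Sum>q\<in>UNIV. N p * D m p q * N q))"
    unfolding gi_x' by (simp add: sum_distrib_left sum_negf ac_simps del: real_sqrt_mult_self)
  finally show ?thesis
    using sqn_pos by simp
qed

text \<open>Top-order variation of the derivative \<open>\<partial>_m n^l\<close> of the unit
  normal: the second term comes from raising the index with the varied metric, the first from
  renormalizing the length.\<close>

definition nrm_top :: "3 \<Rightarrow> 3 \<Rightarrow> jet \<Rightarrow> real"
  where "nrm_top m l V = (1/2) * (\<Sum>p\<in>UNIV. \<Sum>q\<in>UNIV. N p * g1 V m p q * N q) * N l
    - (\<Sum>p\<in>UNIV. \<Sum>q\<in>UNIV. gi B l p * g1 V m p q * N q)"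

lemma top1_nrm_partials:
  "has_top 1 B (\<lambda>J. nrm_partials x (gi J) (g1 J) m l) (nrm_top m l)"
proof -
  \<comment> \<open>Needed for differentiability of the scalar factor in
    \<open>nrm_partials\<close>; its value drops out because \<open>sqn\<close> has lower
    order.\<close>
  have "((\<lambda>s. 1 / (2 * s * sqrt s)) has_real_derivative (- (3 / (4 * s\<^sup>2 * sqrt s)))) (at s)"
    if "s > 0" for s :: real
    using that by (auto intro!: derivative_eq_intros simp: field_simps power2_eq_square)
  note d1 = has_top_chain[OF low1_sqn this[OF sqn_pos]]
  note d2 = has_top_chain[OF low1_sqn neg_inverse_sqrt_has_derivative[OF sqn_pos]]
  show ?thesis
    unfolding nrm_partials_def
    by (rule has_top_cong, (rule d1 d2 has_top_inv_partials has_top_add has_top_sum has_top_mult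
          has_top_const low1 has_top_g(2))+)
       (use sqn_pos in \<open>simp add: inv_partials_NN inv_partials_N gi_x nrm_top_def\<close>)
qed

definition mean_curv_top :: "jet \<Rightarrow> real"
  where "mean_curv_top V = (\<Sum>i\<in>UNIV. \<Sum>j\<in>UNIV. (gi B i j - N i * N j) *
    ((1/2) * (\<Sum>l\<in>UNIV. N l * g1 V l i j) - (\<Sum>q\<in>UNIV. g1 V i j q * N q)))"

text \<open>The inverse metric minus \<open>N N\<close> projects along the normal and so annihilates
  the conormal; this removes the length correction of \<open>nrm_top\<close> from the mean
  curvature.\<close>

lemma projection_N:
  "(\<Sum>j\<in>UNIV. (gi B i j - N i * N j) * (\<Sum>l\<in>UNIV. g0 B j l * N l)) = 0"
proof -
  have "(\<Sum>j\<in>UNIV. gi B i j * (\<Sum>l\<in>UNIV. g0 B j l * N l))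
      = (\<Sum>j\<in>UNIV. \<Sum>l\<in>UNIV. (gi B i j * g0 B j l) * N l)"
    by (simp add: sum_distrib_left mult.assoc)
  also have "\<dots> = (\<Sum>l\<in>UNIV. (\<Sum>j\<in>UNIV. gi B i j * g0 B j l) * N l)"
    by (subst sum.swap) (simp add: sum_distrib_right)
  also have "\<dots> = N i"
    by (simp add: gi_mult if_distrib[where f = "\<lambda>x. x * _"] cong: if_cong)
  finally show ?thesis
    using N_unit by (simp add: left_diff_distrib sum_subtractf mult.assoc flip: sum_distrib_left)
qed

lemma nrm_top_lower:
  "(\<Sum>l\<in>UNIV. g0 B j l * nrm_top i l V)
    = (1/2) * (\<Sum>p\<in>UNIV. \<Sum>q\<in>UNIV. N p * g1 V i p q * N q) * (\<Sum>l\<in>UNIV. g0 B j l * N l)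
      - (\<Sum>q\<in>UNIV. g1 V i j q * N q)"
proof -
  have *: "(\<Sum>l\<in>UNIV. g0 B j l * (\<Sum>p\<in>UNIV. \<Sum>q\<in>UNIV. gi B l p * g1 V i p q * N q))
      = (\<Sum>q\<in>UNIV. g1 V i j q * N q)"
    using lower_raise[of j "\<lambda>p. \<Sum>q\<in>UNIV. g1 V i p q * N q"] by (simp add: sum_distrib_left mult.assoc)
  have "(\<Sum>l\<in>UNIV. g0 B j l * (c * N l)) = c * (\<Sum>l\<in>UNIV. g0 B j l * N l)" for c
    by (simp add: sum_distrib_left mult.left_commute)
  then show ?thesis
    by (simp only: nrm_top_def right_diff_distrib sum_subtractf *)
qed

text \<open>After contraction with the tangential projection the length term of
  \<open>nrm_top\<close> vanishes, being proportional to the conormal, and the two terms with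
  derivatives of the normal agree by symmetry.\<close>

lemma top1_mean_curv: "has_top 1 B (mean_curv_jet x) mean_curv_top"
proof -
  have "has_top 1 B (mean_curv_jet x) (\<lambda>V. \<Sum>i\<in>UNIV. \<Sum>j\<in>UNIV. (gi B i j - N i * N j) *
      ((1/2) * ((\<Sum>l\<in>UNIV. N l * g1 V l i j) + (\<Sum>l\<in>UNIV. g0 B j l * nrm_top i l V)
        + (\<Sum>l\<in>UNIV. g0 B i l * nrm_top j l V))))"
    unfolding mean_curv_jet_def [abs_def]
    by (rule has_top_cong, (rule has_top_add has_top_diff has_top_sum has_top_mult has_top_const low1_nrm
          top1_nrm_partials low1 has_top_g(2))+)
       (simp add: sum.distrib g0_sym)
  then show ?thesis
  proof (rule has_top_cong)
    fix V
    let ?P = "\<lambda>i j. gi B i j - N i * N j"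
    let ?v = "\<lambda>i. \<Sum>p\<in>UNIV. \<Sum>q\<in>UNIV. N p * g1 V i p q * N q"
    let ?n = "\<lambda>j. \<Sum>l\<in>UNIV. g0 B j l * N l"
    have split: "(\<Sum>i\<in>UNIV. \<Sum>j\<in>UNIV. P i j * ((1/2) * (a i j + b i j + c i j)))
      = (\<Sum>i\<in>UNIV. \<Sum>j\<in>UNIV. P i j * ((1/2) * a i j))
        + (1/2) * (\<Sum>i\<in>UNIV. \<Sum>j\<in>UNIV. P i j * b i j)
        + (1/2) * (\<Sum>i\<in>UNIV. \<Sum>j\<in>UNIV. P i j * c i j)" for P a b c :: "3 \<Rightarrow> 3 \<Rightarrow> real"
      by (simp add: sum.distrib sum_distrib_left algebra_simps)
    have split': "(\<Sum>i\<in>UNIV. \<Sum>j\<in>UNIV. P i j * ((1/2) * v i * n j - w i j))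
      = (1/2) * (\<Sum>i\<in>UNIV. \<Sum>j\<in>UNIV. P i j * (v i * n j))
        - (\<Sum>i\<in>UNIV. \<Sum>j\<in>UNIV. P i j * w i j)" for P w :: "3 \<Rightarrow> 3 \<Rightarrow> real" and v n
      by (simp add: sum_subtractf sum_distrib_left algebra_simps)
    have P_sym: "?P i j = ?P j i" for i j
      by (simp add: gi_sym[of i])
    have 1: "(\<Sum>i\<in>UNIV. \<Sum>j\<in>UNIV. ?P i j * (?v i * ?n j)) = 0"
    proof -
      have "(\<Sum>j\<in>UNIV. ?P i j * (?v i * ?n j)) = ?v i * (\<Sum>j\<in>UNIV. ?P i j * ?n j)" for i
        by (simp only: sum_distrib_left mult.left_commute)
      then show ?thesis
        by (simp only: projection_N mult_zero_right sum.neutral_const)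
    qed
    have swap: "(\<Sum>i\<in>UNIV. \<Sum>j\<in>UNIV. ?P i j * f j i) = (\<Sum>i\<in>UNIV. \<Sum>j\<in>UNIV. ?P i j * f i j)" for f
      by (subst sum.swap, intro sum.cong refl) (simp only: P_sym)
    have "(\<Sum>i\<in>UNIV. \<Sum>j\<in>UNIV. ?P i j * ((1/2) * ((\<Sum>l\<in>UNIV. N l * g1 V l i j)
          + (\<Sum>l\<in>UNIV. g0 B j l * nrm_top i l V) + (\<Sum>l\<in>UNIV. g0 B i l * nrm_top j l V))))
      = (\<Sum>i\<in>UNIV. \<Sum>j\<in>UNIV. ?P i j * ((1/2) * (\<Sum>l\<in>UNIV. N l * g1 V l i j)))
        + (1/2) * (\<Sum>i\<in>UNIV. \<Sum>j\<in>UNIV. ?P i j * (\<Sum>l\<in>UNIV. g0 B j l * nrm_top i l V))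
        + (1/2) * (\<Sum>i\<in>UNIV. \<Sum>j\<in>UNIV. ?P i j * (\<Sum>l\<in>UNIV. g0 B i l * nrm_top j l V))"
      by (rule split)
    also have "(\<Sum>i\<in>UNIV. \<Sum>j\<in>UNIV. ?P i j * (\<Sum>l\<in>UNIV. g0 B i l * nrm_top j l V))
        = (\<Sum>i\<in>UNIV. \<Sum>j\<in>UNIV. ?P i j * (\<Sum>l\<in>UNIV. g0 B j l * nrm_top i l V))"
      by (rule swap)
    also have "(\<Sum>i\<in>UNIV. \<Sum>j\<in>UNIV. ?P i j * (\<Sum>l\<in>UNIV. g0 B j l * nrm_top i l V))
        = (1/2) * (\<Sum>i\<in>UNIV. \<Sum>j\<in>UNIV. ?P i j * (?v i * ?n j))
          - (\<Sum>i\<in>UNIV. \<Sum>j\<in>UNIV. ?P i j * (\<Sum>q\<in>UNIV. g1 V i j q * N q))"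
      unfolding nrm_top_lower by (rule split')
    finally show "(\<Sum>i\<in>UNIV. \<Sum>j\<in>UNIV. ?P i j * ((1/2) * ((\<Sum>l\<in>UNIV. N l * g1 V l i j)
          + (\<Sum>l\<in>UNIV. g0 B j l * nrm_top i l V) + (\<Sum>l\<in>UNIV. g0 B i l * nrm_top j l V))))
        = mean_curv_top V"
      by (simp only: 1 mean_curv_top_def right_diff_distrib sum_subtractf)
  qed
qed

lemma top1_normal_deriv:
  "has_top 1 B (normal_deriv_jet x) (\<lambda>V. \<Sum>i\<in>UNIV. N i * j1 V i Phi)"
  unfolding normal_deriv_jet_def [abs_def]
  by (rule has_top_cong, (rule has_top_sum has_top_mult low1_nrm has_top_j(2))+) simp

end

lemma has_top_tangential:
  "has_top 0 B (\<lambda>J. (\<Sum>i\<in>UNIV. \<Sum>j\<in>UNIV. e $ i * g0 J i j * e' $ j) - c)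
    (\<lambda>V. \<Sum>i\<in>UNIV. \<Sum>j\<in>UNIV. e $ i * g0 V i j * e' $ j)"
  unfolding g0_def
  by (rule has_top_cong, (rule has_top_diff has_top_sum has_top_mult has_top_const has_top_j(1))+)
     simp

section \<open>From top-order parts to coefficients\<close>

lemma sum_lists_le_2:
  fixes f :: "3 list \<Rightarrow> real"
  shows "(\<Sum>is | length is \<le> 0. f is) = f []"
    and "(\<Sum>is | length is \<le> 1. f is) = f [] + (\<Sum>i\<in>UNIV. f [i])"
    and "(\<Sum>is | length is \<le> 2. f is) = f [] + (\<Sum>i\<in>UNIV. f [i]) + (\<Sum>i\<in>UNIV. \<Sum>j\<in>UNIV. f [i, j])"
proof -
  have 0: "{is::3 list. length is \<le> 0} = {[]}"
    by auto
  have 1: "{is::3 list. length is \<le> 1} = insert [] (range (\<lambda>i. [i]))"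
    by (auto simp: le_Suc_eq length_Suc_conv)
  have 2: "{is::3 list. length is \<le> 2}
      = insert [] (range (\<lambda>i. [i]) \<union> (\<lambda>(i, j). [i, j]) ` (UNIV \<times> UNIV))"
    by (auto simp: le_Suc_eq length_Suc_conv numeral_2_eq_2)
  show "(\<Sum>is | length is \<le> 0. f is) = f []"
    by (simp only: 0) simp
  show "(\<Sum>is | length is \<le> 1. f is) = f [] + (\<Sum>i\<in>UNIV. f [i])"
    by (simp only: 1) (subst sum.insert, auto simp: sum.reindex inj_on_def)
  have "sum f (range (\<lambda>i. [i]) \<union> (\<lambda>(i, j). [i, j]) ` (UNIV \<times> UNIV))
      = (\<Sum>i\<in>UNIV. f [i]) + (\<Sum>i\<in>UNIV. \<Sum>j\<in>UNIV. f [i, j])"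
    by (subst sum.union_disjoint)
       (auto simp: sum.reindex inj_on_def sum.cartesian_product case_prod_beta)
  then show "(\<Sum>is | length is \<le> 2. f is)
      = f [] + (\<Sum>i\<in>UNIV. f [i]) + (\<Sum>i\<in>UNIV. \<Sum>j\<in>UNIV. f [i, j])"
    by (simp only: 2) (subst sum.insert, auto simp: add.assoc)
qed

lemma sum_lists_length_2:
  fixes f :: "3 list \<Rightarrow> 'a::comm_monoid_add"
  shows "(\<Sum>is | length is = 0. f is) = f []"
    and "(\<Sum>is | length is = 1. f is) = (\<Sum>i\<in>UNIV. f [i])"
    and "(\<Sum>is | length is = 2. f is) = (\<Sum>i\<in>UNIV. \<Sum>j\<in>UNIV. f [i, j])"
proof -
  have 0: "{is::3 list. length is = 0} = {[]}"
    by auto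
  have 1: "{is::3 list. length is = 1} = range (\<lambda>i. [i])"
    by (auto simp: length_Suc_conv)
  have 2: "{is::3 list. length is = 2} = (\<lambda>(i, j). [i, j]) ` (UNIV \<times> UNIV)"
    by (auto simp: length_Suc_conv numeral_2_eq_2)
  show "(\<Sum>is | length is = 0. f is) = f []"
    by (simp only: 0) simp
  show "(\<Sum>is | length is = 1. f is) = (\<Sum>i\<in>UNIV. f [i])"
    by (simp only: 1) (simp add: sum.reindex inj_on_def)
  show "(\<Sum>is | length is = 2. f is) = (\<Sum>i\<in>UNIV. \<Sum>j\<in>UNIV. f [i, j])"
    by (simp only: 2)
       (subst sum.reindex, auto simp: inj_on_def sum.cartesian_product case_prod_beta)
qed

lemma pds_jet:
  "pds ext [] (icoord c X) x = j0 (jet_of X x) c" "pds ext [i] (icoord c X) x = j1 (jet_of X x) i c"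
  "pds ext [i, j] (icoord c X) x = j2 (jet_of X x) i j c"
  by (simp_all add: jet_of_def j0_def j1_def j2_def)

text \<open>The coefficients are the values of the derivative on unit jets. On those of order at
  least k the derivative equals P, and the vanishing of P above k truncates the expansion to an
  operator of order k.\<close>

lemma has_top_diff_expr:
  assumes top: "has_top k B F P" and k: "k \<le> 2"
    and P: "\<And>c is. k < length is \<Longrightarrow> length is \<le> 2 \<Longrightarrow> P (jet_basis c is) = 0"
  obtains F' a where "(F has_derivative F') (at B)"
    "\<And>X x. F' (jet_of X x) = diff_expr k a X x"
    "\<And>c is. length is = k \<Longrightarrow> a c is = P (jet_basis c is)" "\<And>V. V \<in> top_jets k \<Longrightarrow> F' V = P V"
proof -
  obtain F' where F': "(F has_derivative F') (at B)" "\<forall>V\<in>top_jets k. F' V = P V"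
    using top by (auto simp: has_top_def)
  interpret linear F'
    using F'(1) by (rule has_derivative_linear)
  define a where "a c is = F' (jet_basis c is)" for c "is"
  have top_basis: "jet_basis c is \<in> top_jets k" if "k \<le> length is" "length is \<le> 2" for c "is"
  proof -
    from that(2) consider "is = []" | i where "is = [i]" | i j where "is = [i, j]"
      by (auto simp: le_Suc_eq length_Suc_conv numeral_2_eq_2)
    then show ?thesis
      using that(1) by cases (auto simp: top_jets_def j_jet_basis)
  qed
  have low: "a c is = 0" if "k < length is" "length is \<le> 2" for c "is"
    using that F'(2) P top_basis by (simp add: a_def)
  have "F' V = (\<Sum>c\<in>UNIV. j0 V c * a c []) + (\<Sum>c\<in>UNIV. \<Sum>i\<in>UNIV. j1 V i c * a c [i])
      + (\<Sum>c\<in>UNIV. \<Sum>i\<in>UNIV. \<Sum>j\<in>UNIV. j2 V i j c * a c [i, j])" for V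
    by (subst jet_expansion[of V]) (simp add: add sum scale a_def)
  then have F'_jet: "F' (jet_of X x) = (\<Sum>c\<in>UNIV. a c [] * pds ext [] (icoord c X) x
      + (\<Sum>i\<in>UNIV. a c [i] * pds ext [i] (icoord c X) x)
      + (\<Sum>i\<in>UNIV. \<Sum>j\<in>UNIV. a c [i, j] * pds ext [i, j] (icoord c X) x))" for X x
    by (simp only: pds_jet sum.distrib mult.commute)
  have "F' (jet_of X x) = diff_expr k a X x" for X x
  proof -
    consider "k = 0" | "k = 1" | "k = 2"
      using k by linarith
    then show ?thesis
    proof cases
      case 1
      then show ?thesis
        by (simp add: F'_jet diff_expr_def low sum_lists_le_2(1)[simplified] del: pds.simps)
    next
      case 2
      then show ?thesis
        by (simp only: F'_jet diff_expr_def sum_lists_le_2) (simp add: low del: pds.simps)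
    next
      case 3
      then show ?thesis
        by (simp only: F'_jet diff_expr_def sum_lists_le_2)
    qed
  qed
  moreover have "a c is = P (jet_basis c is)" if "length is = k" for c "is"
    using F'(2) top_basis k that by (simp add: a_def)
  ultimately show ?thesis
    using that F' by blast
qed

section \<open>Principal symbols\<close>

text \<open>Instantiated by the identity of the reals for condition (A) and by the constant
  polynomials \<open>cpoly\<close> for condition (B).\<close>

locale ring_embedding =
  fixes \<iota> :: "real \<Rightarrow> 'a::comm_ring_1"
  assumes \<iota>_1: "\<iota> 1 = 1" and \<iota>_add: "\<iota> (a + b) = \<iota> a + \<iota> b" and \<iota>_mult: "\<iota> (a * b) = \<iota> a * \<iota> b"
begin

lemma \<iota>_0: "\<iota> 0 = 0"
  using \<iota>_add[of 0 0] by simp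

lemma \<iota>_minus: "\<iota> (- a) = - \<iota> a"
  using \<iota>_add[of a "- a"] by (simp add: eq_neg_iff_add_eq_0 add.commute \<iota>_0)

lemma \<iota>_diff: "\<iota> (a - b) = \<iota> a - \<iota> b"
  using \<iota>_add[of a "- b"] by (simp add: \<iota>_minus)

lemma \<iota>_sum: "\<iota> (sum f A) = (\<Sum>a\<in>A. \<iota> (f a))"
  by (induction A rule: infinite_finite_induct) (simp_all add: \<iota>_add \<iota>_0)

lemma \<iota>_of_nat: "\<iota> (of_nat n) = of_nat n"
  by (induction n) (simp_all add: \<iota>_add \<iota>_0 \<iota>_1)

lemma \<iota>_numeral: "\<iota> (numeral n) = numeral n"
  using \<iota>_of_nat[of "numeral n"] by simp

text \<open>A general ring has no division by 2, so the halves from the Christoffel symbols are kept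
  as \<open>\<iota> (1/2)\<close> until this removes them.\<close>

lemma \<iota>_half: "2 * \<iota> (1/2) = 1"
  using \<iota>_mult[of 2 "1/2"] by (simp add: \<iota>_numeral \<iota>_1)

text \<open>The symbol of a functional on jets, applied to w. Working with functionals lets the
  top-order expressions be inserted directly instead of through coefficient matrices.\<close>

definition symb :: "nat \<Rightarrow> 'a^3 \<Rightarrow> 'a^icomp \<Rightarrow> (jet \<Rightarrow> real) \<Rightarrow> 'a"
  where "symb k \<xi> w P = (\<Sum>c\<in>UNIV. \<Sum>is | length is = k.
    \<iota> (P (jet_basis c is)) * prod_list (map (\<lambda>i. \<xi> $ i) is) * w $ c)"

lemma symbol_symb:
  assumes "\<And>c is. length is = ord r \<Longrightarrow> A r c is = P (jet_basis c is)"
  shows "(symbol \<iota> ord A \<xi> *v w) $ r = symb (ord r) \<xi> w P"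
  by (simp add: matrix_vector_mult_def symbol_def symb_def assms sum_distrib_right)

lemma symb_add: "symb k \<xi> w (\<lambda>V. P V + Q V) = symb k \<xi> w P + symb k \<xi> w Q"
  by (simp add: symb_def \<iota>_add distrib_right sum.distrib)

lemma symb_minus: "symb k \<xi> w (\<lambda>V. - P V) = - symb k \<xi> w P"
  by (simp add: symb_def \<iota>_minus sum_negf)

lemma symb_diff: "symb k \<xi> w (\<lambda>V. P V - Q V) = symb k \<xi> w P - symb k \<xi> w Q"
  by (simp add: symb_def \<iota>_diff left_diff_distrib sum_subtractf)

lemma symb_scale: "symb k \<xi> w (\<lambda>V. c * P V) = \<iota> c * symb k \<xi> w P"
  by (simp add: symb_def \<iota>_mult sum_distrib_left mult.assoc)

lemma symb_scale': "symb k \<xi> w (\<lambda>V. P V * c) = \<iota> c * symb k \<xi> w P"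
  using symb_scale by (simp add: mult.commute)

lemma symb_divide: "symb k \<xi> w (\<lambda>V. P V / 2) = \<iota> (1/2) * symb k \<xi> w P"
  using symb_scale[of k \<xi> w "1/2"] by simp

lemma symb_0: "symb k \<xi> w (\<lambda>V. 0) = 0"
  by (simp add: symb_def \<iota>_0)

lemma symb_sum: "symb k \<xi> w (\<lambda>V. \<Sum>a\<in>I. P a V) = (\<Sum>a\<in>I. symb k \<xi> w (P a))"
  by (induction I rule: infinite_finite_induct) (simp_all add: symb_0 symb_add)

lemma \<iota>_of_bool: "\<iota> (of_bool b) = of_bool b"
  by (cases b) (simp_all add: \<iota>_0 \<iota>_1)

lemma symb_j: "symb 0 \<xi> w (\<lambda>V. j0 V c) = w $ c" "symb 1 \<xi> w (\<lambda>V. j1 V i c) = \<xi> $ i * w $ c"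
    "symb 2 \<xi> w (\<lambda>V. j2 V i j c) = \<xi> $ i * \<xi> $ j * w $ c"
proof -
  have delta: "(\<Sum>a\<in>UNIV. of_bool (b = a) * f a) = f b" for b and f :: "'b::finite \<Rightarrow> 'a"
    by (simp add: of_bool_def if_distrib[where f = "\<lambda>x. x * _"] cong: if_cong)
  show "symb 0 \<xi> w (\<lambda>V. j0 V c) = w $ c"
    by (simp add: symb_def sum_lists_length_2(1)[simplified] j_jet_basis \<iota>_of_bool delta)
  have "symb 1 \<xi> w (\<lambda>V. j1 V i c)
      = (\<Sum>c'\<in>UNIV. of_bool (c = c') * (\<Sum>i'\<in>UNIV. of_bool (i = i') * (\<xi> $ i' * w $ c')))"
    by (simp only: symb_def sum_lists_length_2 j_jet_basis \<iota>_of_bool)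
       (simp add: of_bool_conj sum_distrib_left ac_simps)
  then show "symb 1 \<xi> w (\<lambda>V. j1 V i c) = \<xi> $ i * w $ c"
    by (simp only: delta)
  have "symb 2 \<xi> w (\<lambda>V. j2 V i j c)
      = (\<Sum>c'\<in>UNIV. of_bool (c = c') * (\<Sum>i'\<in>UNIV. of_bool (i = i') *
          (\<Sum>j'\<in>UNIV. of_bool (j = j') * (\<xi> $ i' * \<xi> $ j' * w $ c'))))"
    by (simp only: symb_def sum_lists_length_2 j_jet_basis \<iota>_of_bool)
       (simp add: of_bool_conj sum_distrib_left ac_simps)
  then show "symb 2 \<xi> w (\<lambda>V. j2 V i j c) = \<xi> $ i * \<xi> $ j * w $ c"
    by (simp only: delta)
qed

lemmas symb_simps = symb_add symb_minus symb_diff symb_scale symb_scale' symb_divide symb_sum symb_j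

end

locale jet_symbol = invertible_jet B + ring_embedding \<iota> for B and \<iota> :: "real \<Rightarrow> 'a::comm_ring_1" +
  fixes \<xi> :: "'a^3" and w :: "'a^icomp"
begin

abbreviation M :: "3 \<Rightarrow> 3 \<Rightarrow> 'a" where "M a b \<equiv> \<iota> (gi B a b)"
abbreviation G :: "3 \<Rightarrow> 3 \<Rightarrow> 'a" where "G a b \<equiv> \<iota> (g0 B a b)"
abbreviation H :: "3 \<Rightarrow> 3 \<Rightarrow> 'a" where "H a b \<equiv> w $ sym_index a b"

text \<open>\<open>up\<close> is \<xi> with its index raised, p = |\<xi>|^2, t is the trace of h,
  and \<open>hx\<close>, \<open>hxx\<close> are h(\<xi>, .) and h(\<xi>, \<xi>).\<close>

definition up :: "3 \<Rightarrow> 'a" where "up a = (\<Sum>b\<in>UNIV. M a b * \<xi> $ b)"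
definition p :: 'a where "p = (\<Sum>a\<in>UNIV. \<xi> $ a * up a)"
definition t :: 'a where "t = (\<Sum>a\<in>UNIV. \<Sum>b\<in>UNIV. M a b * H a b)"
definition hx :: "3 \<Rightarrow> 'a" where "hx a = (\<Sum>b\<in>UNIV. H a b * up b)"
definition hxx :: 'a where "hxx = (\<Sum>a\<in>UNIV. up a * hx a)"

lemma M_sym: "M a b = M b a"
  by (simp add: gi_sym[of a b])

lemma H_sym: "H a b = H b a"
  by (simp add: sym_index_commute[of a b])

lemma symb_g: "symb 0 \<xi> w (\<lambda>V. g0 V a b) = H a b" "symb 1 \<xi> w (\<lambda>V. g1 V i a b) = \<xi> $ i * H a b"
    "symb 2 \<xi> w (\<lambda>V. g2 V m i a b) = \<xi> $ m * \<xi> $ i * H a b"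
  by (simp_all add: g0_def g1_def g2_def symb_j[unfolded One_nat_def])

lemma up': "(\<Sum>a\<in>UNIV. M a b * \<xi> $ a) = up b"
  by (simp add: up_def M_sym[of b])

text \<open>Each of the six second-derivative terms reduces to one of these contractions; of the
  three coming from the traced Christoffel symbol two cancel, leaving the trace term.\<close>

lemma symb_ric_top:
  "symb 2 \<xi> w (ric_top i j) = \<iota> (1/2) * (\<xi> $ i * hx j + \<xi> $ j * hx i - p * H i j - \<xi> $ i * \<xi> $ j * t)"
proof -
  have e1: "(\<Sum>a\<in>UNIV. \<Sum>b\<in>UNIV. M a b * (\<xi> $ a * c * H d b)) = c * hx d" for c d
  proof -
    have "(\<Sum>a\<in>UNIV. \<Sum>b\<in>UNIV. M a b * (\<xi> $ a * c * H d b))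
        = (\<Sum>b\<in>UNIV. \<Sum>a\<in>UNIV. c * (H d b * (M a b * \<xi> $ a)))"
      by (subst sum.swap) (simp add: ac_simps)
    then show ?thesis
      by (simp only: sum_distrib_left[symmetric] up' hx_def)
  qed
  have e2: "(\<Sum>a\<in>UNIV. \<Sum>b\<in>UNIV. M a b * (\<xi> $ a * \<xi> $ b * c)) = c * p" for c
    by (simp add: p_def up_def sum_distrib_left ac_simps)
  have e3: "(\<Sum>a\<in>UNIV. \<Sum>b\<in>UNIV. M a b * (c * \<xi> $ b * H a d)) = c * hx d" for c d
    unfolding hx_def up_def by (simp add: H_sym[of d] sum_distrib_left ac_simps)
  have e4: "(\<Sum>a\<in>UNIV. \<Sum>b\<in>UNIV. M a b * (c * H a b)) = c * t" for c
    by (simp add: t_def sum_distrib_left ac_simps)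
  have e5: "(\<Sum>a\<in>UNIV. \<Sum>b\<in>UNIV. M a b * (c * \<xi> $ a * H d b)) = c * hx d" for c d
    using e1 by (simp add: mult.commute)
  have "symb 2 \<xi> w (ric_top i j) = (\<Sum>a\<in>UNIV. \<iota> (1/2) * (\<Sum>b\<in>UNIV.
      M a b * (\<xi> $ a * \<xi> $ i * H j b) + M a b * (\<xi> $ a * \<xi> $ j * H i b) - M a b * (\<xi> $ a * \<xi> $ b * H i j)
      - (M a b * (\<xi> $ i * \<xi> $ a * H j b) + M a b * (\<xi> $ i * \<xi> $ j * H a b) - M a b * (\<xi> $ i * \<xi> $ b * H a j))))"
    unfolding ric_top_def [abs_def] chr_def
    by (simp add: symb_simps symb_g sum.distrib sum_subtractf algebra_simps)
  also have "\<dots> = \<iota> (1/2) * (\<xi> $ i * hx j + \<xi> $ j * hx i - H i j * p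
      - (\<xi> $ i * hx j + \<xi> $ i * \<xi> $ j * t - \<xi> $ i * hx j))"
    by (simp only: sum_distrib_left[symmetric] sum.distrib sum_subtractf e1 e2 e3 e4 e5)
  finally show ?thesis
    by (simp add: algebra_simps)
qed

lemma symb_scal_top: "symb 2 \<xi> w (\<lambda>V. \<Sum>k\<in>UNIV. \<Sum>l\<in>UNIV. gi B k l * ric_top k l V) = hxx - p * t"
proof -
  have e1: "(\<Sum>k\<in>UNIV. \<Sum>l\<in>UNIV. M k l * (\<xi> $ k * hx l)) = hxx"
    unfolding hxx_def by (subst sum.swap) (simp add: up'[symmetric] sum_distrib_right mult.assoc)
  have e2: "(\<Sum>k\<in>UNIV. \<Sum>l\<in>UNIV. M k l * (\<xi> $ l * hx k)) = hxx"
    by (simp add: hxx_def up_def sum_distrib_right mult.assoc)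
  have e3: "(\<Sum>k\<in>UNIV. \<Sum>l\<in>UNIV. M k l * (c * H k l)) = c * t" for c
    by (simp add: t_def sum_distrib_left ac_simps)
  have e4: "(\<Sum>k\<in>UNIV. \<Sum>l\<in>UNIV. M k l * (\<xi> $ k * \<xi> $ l * c)) = p * c" for c
    by (simp add: p_def up_def sum_distrib_left sum_distrib_right ac_simps)
  have "symb 2 \<xi> w (\<lambda>V. \<Sum>k\<in>UNIV. \<Sum>l\<in>UNIV. gi B k l * ric_top k l V)
      = \<iota> (1/2) * (\<Sum>k\<in>UNIV. \<Sum>l\<in>UNIV. M k l * (\<xi> $ k * hx l) + M k l * (\<xi> $ l * hx k)
          - M k l * (p * H k l) - M k l * (\<xi> $ k * \<xi> $ l * t))"
    by (simp add: symb_simps symb_ric_top sum_distrib_left algebra_simps)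
  also have "\<dots> = \<iota> (1/2) * (hxx + hxx - p * t - p * t)"
    by (simp only: sum.distrib sum_subtractf e1 e2 e3 e4)
  also have "\<dots> = 2 * \<iota> (1/2) * (hxx - p * t)"
    by (simp add: algebra_simps)
  finally show ?thesis
    by (simp add: \<iota>_half)
qed

lemma symb_lap_top: "symb 2 \<xi> w (lap_top c) = p * w $ c"
  unfolding lap_top_def [abs_def]
  by (simp add: symb_simps p_def up_def sum_distrib_left sum_distrib_right ac_simps)

text \<open>The gauge term cancels \<open>\<xi> $ i * hx j + \<xi> $ j * hx i\<close> in twice the
  Ricci symbol, the terms that make it degenerate along diffeomorphisms.\<close>

lemma symb_metric_top:
  "symb 2 \<xi> w (metric_top i j) = - p * H i j - \<xi> $ i * \<xi> $ j * t - (hxx - p * t) * G i j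
    + 2 * (p * G i j - \<xi> $ i * \<xi> $ j) * w $ U"
proof -
  have e: "(\<Sum>k\<in>UNIV. \<Sum>a\<in>UNIV. M k a * (\<xi> $ i * \<xi> $ k * H a j)) = \<xi> $ i * hx j" for i j
  proof -
    have "(\<Sum>k\<in>UNIV. \<Sum>a\<in>UNIV. M k a * (\<xi> $ i * \<xi> $ k * H a j))
        = (\<Sum>a\<in>UNIV. \<Sum>k\<in>UNIV. \<xi> $ i * (H j a * (M k a * \<xi> $ k)))"
      by (subst sum.swap) (simp add: H_sym[of j] ac_simps)
    then show ?thesis
      by (simp only: sum_distrib_left[symmetric] up' hx_def)
  qed
  have s: "(\<Sum>k\<in>UNIV. \<Sum>l\<in>UNIV. M k l * symb 2 \<xi> w (ric_top k l)) = hxx - p * t"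
    using symb_scal_top by (simp only: symb_sum symb_scale)
  have "symb 2 \<xi> w (metric_top i j) = 2 * symb 2 \<xi> w (ric_top i j) - 2 * (\<xi> $ i * \<xi> $ j * w $ U)
      + G i j * (2 * (p * w $ U)) - G i j * (hxx - p * t) - (\<xi> $ i * hx j + \<xi> $ j * hx i)"
    unfolding metric_top_def [abs_def]
    by (simp only: symb_diff symb_add symb_scale symb_scale' \<iota>_numeral symb_j symb_lap_top s
        symb_sum symb_g distrib_left sum.distrib e)
  also have "2 * symb 2 \<xi> w (ric_top i j)
      = 2 * \<iota> (1/2) * (\<xi> $ i * hx j + \<xi> $ j * hx i - p * H i j - \<xi> $ i * \<xi> $ j * t)"
    by (simp add: symb_ric_top mult.assoc)
  finally show ?thesis
    by (simp only: \<iota>_half) (simp add: algebra_simps)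
qed

lemma symb_gauge: "symb 1 \<xi> w (\<lambda>V. - (\<Sum>i\<in>UNIV. \<Sum>a\<in>UNIV. gi B i a * g1 V i a b)) = - hx b"
proof -
  have "(\<Sum>k\<in>UNIV. \<Sum>a\<in>UNIV. M k a * (\<xi> $ k * H a b)) = (\<Sum>a\<in>UNIV. \<Sum>k\<in>UNIV. H b a * (M k a * \<xi> $ k))"
    by (subst sum.swap) (simp add: H_sym[of b] ac_simps)
  then show ?thesis
    by (simp only: symb_minus symb_sum symb_scale symb_g sum_distrib_left[symmetric] up' hx_def)
qed

end

locale boundary_symbol = boundary_jet B x + jet_symbol B \<iota> \<xi> w
  for B x and \<iota> :: "real \<Rightarrow> 'a::comm_ring_1" and \<xi> w
begin

definition n\<xi> :: 'a where "n\<xi> = (\<Sum>i\<in>UNIV. \<iota> (N i) * \<xi> $ i)"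
definition hn :: "3 \<Rightarrow> 'a" where "hn a = (\<Sum>b\<in>UNIV. H a b * \<iota> (N b))"
definition hnn :: 'a where "hnn = (\<Sum>a\<in>UNIV. \<iota> (N a) * hn a)"

lemma symb_mean_curv_top:
  "symb 1 \<xi> w mean_curv_top
    = \<iota> (1/2) * n\<xi> * (t - hnn) - (\<Sum>a\<in>UNIV. (up a - n\<xi> * \<iota> (N a)) * hn a)"
proof -
  have "symb 1 \<xi> w mean_curv_top = (\<Sum>i\<in>UNIV. \<Sum>j\<in>UNIV. (M i j - \<iota> (N i) * \<iota> (N j)) *
      (\<iota> (1/2) * (\<Sum>l\<in>UNIV. \<iota> (N l) * (\<xi> $ l * H i j)) - (\<Sum>q\<in>UNIV. \<iota> (N q) * (\<xi> $ i * H j q))))"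
    unfolding mean_curv_top_def [abs_def]
    by (simp only: symb_diff symb_add symb_scale symb_scale' symb_sum symb_g \<iota>_diff \<iota>_mult)
  also have "\<dots> = (\<Sum>i\<in>UNIV. \<Sum>j\<in>UNIV. (M i j - \<iota> (N i) * \<iota> (N j)) *
      (\<iota> (1/2) * (n\<xi> * H i j) - \<xi> $ i * hn j))"
    by (simp add: n\<xi>_def hn_def sum_distrib_left sum_distrib_right ac_simps)
  also have "\<dots> = \<iota> (1/2) * n\<xi> * (\<Sum>i\<in>UNIV. \<Sum>j\<in>UNIV. M i j * H i j)
      - \<iota> (1/2) * n\<xi> * (\<Sum>i\<in>UNIV. \<iota> (N i) * (\<Sum>j\<in>UNIV. H i j * \<iota> (N j)))
      - ((\<Sum>i\<in>UNIV. \<Sum>j\<in>UNIV. M i j * \<xi> $ i * hn j)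
        - (\<Sum>i\<in>UNIV. \<Sum>j\<in>UNIV. \<iota> (N i) * \<xi> $ i * (\<iota> (N j) * hn j)))"
    by (simp add: sum_distrib_left left_diff_distrib right_diff_distrib sum_subtractf sum.distrib ac_simps)
  also have "(\<Sum>i\<in>UNIV. \<Sum>j\<in>UNIV. M i j * \<xi> $ i * hn j) = (\<Sum>j\<in>UNIV. up j * hn j)"
    by (subst sum.swap) (simp only: up'[symmetric] sum_distrib_right)
  also have "(\<Sum>i\<in>UNIV. \<Sum>j\<in>UNIV. \<iota> (N i) * \<xi> $ i * (\<iota> (N j) * hn j)) = n\<xi> * hnn"
    by (simp only: n\<xi>_def hnn_def sum_product)
  finally show ?thesis
    by (simp only: t_def[symmetric] hn_def[symmetric])
       (simp add: hnn_def left_diff_distrib right_diff_distrib sum_subtractf sum_distrib_left ac_simps)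
qed

lemma symb_normal_deriv: "symb 1 \<xi> w (\<lambda>V. \<Sum>i\<in>UNIV. N i * j1 V i Phi) = n\<xi> * w $ Phi"
  by (simp only: symb_sum symb_scale symb_j n\<xi>_def sum_distrib_right mult.assoc)

lemma symb_tangential:
  "symb 0 \<xi> w (\<lambda>V. \<Sum>i\<in>UNIV. \<Sum>j\<in>UNIV. e $ i * g0 V i j * e' $ j)
    = (\<Sum>i\<in>UNIV. \<Sum>j\<in>UNIV. \<iota> (e $ i) * H i j * \<iota> (e' $ j))"
  by (simp only: symb_sum symb_scale symb_scale' symb_g mult.commute)

end

section \<open>The complementing condition in an orthonormal coframe\<close>

text \<open>\<open>lplus D\<close> contains the full power of the linear factor at z in D, so every
  product on the right carries that power and n further factors; cancelling D leaves these n in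
  \<beta>. Allowing n larger than 1 is what makes the higher-order test fields usable.\<close>

lemma lplus_cancel:
  fixes D \<beta> :: "complex poly" and a y :: "'n::finite \<Rightarrow> complex poly"
  assumes D: "D \<noteq> 0" and z: "Im z > 0" and a: "\<And>j. lplus D dvd a j"
    and y: "\<And>j. [:- z, 1:] ^ n dvd y j" and eq: "D * \<beta> = (\<Sum>j\<in>UNIV. a j * y j)"
  shows "[:- z, 1:] ^ n dvd \<beta>"
proof (cases "\<beta> = 0")
  case False
  have "[:- z, 1:] ^ order z D dvd lplus D"
  proof (cases "poly D z = 0")
    case True
    have "finite {z. poly D z = 0 \<and> Im z > 0}"
      using poly_roots_finite[OF D] by (rule rev_finite_subset) auto
    then show ?thesis
      unfolding lplus_def using True z by (intro dvd_prodI[where f = "\<lambda>z. [:- z, 1:] ^ order z D"]) auto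
  qed (simp add: order_0I)
  then have "[:- z, 1:] ^ (order z D + n) dvd a j * y j" for j
    using a y by (simp add: power_add) (meson dvd_trans mult_dvd_mono)
  then have "[:- z, 1:] ^ (order z D + n) dvd D * \<beta>"
    by (simp add: eq dvd_sum)
  then show ?thesis
    using D False by (simp add: order_divides order_mult)
qed simp

text \<open>
  The symbols in an orthonormal coframe \<open>\<epsilon>\<close> in which \<open>\<xi> = (\<rho>, 0, z)\<close> and \<open>h\<close> has the
  components \<open>h11, \<dots>, h33\<close> (up to the sign of the interior symbol).  The test fields below annihilate the interior symbol modulo powers
  of \<open>z - i \<rho>\<close>; they correspond to the decaying solutions of the constant coefficient problem
  on a half space.
\<close>

definition frame_interior ::
    "complex poly \<Rightarrow> complex poly \<Rightarrow> (complex poly \<times> complex poly \<times> complex poly \<times>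
     complex poly \<times> complex poly \<times> complex poly) \<Rightarrow> complex poly \<Rightarrow> complex poly set"
  where "frame_interior R Z h V = (case h of (h11, h12, h13, h22, h23, h33) \<Rightarrow>
    let p = R * R + Z * Z; t = h11 + h22 + h33;
        D = R * R * h11 + 2 * (R * Z * h13) + Z * Z * h33 - p * t - 2 * p * V
    in {p * h11 + R * R * (t + 2 * V) + D, p * h12, p * h13 + R * Z * (t + 2 * V),
        p * h22 + D, p * h23, p * h33 + Z * Z * (t + 2 * V) + D})"

text \<open>The Y are coefficients of the gauge rows, the T of the tangential metric, \<Lambda> and
  K of mean curvature and normal derivative. Constant test fields give six equations, which tie
  \<open>T11\<close>, \<open>T22\<close> and \<open>Y1 * \<rho> + Y3 * z0\<close> to \<Lambda>; the
  fields of order 2 and 3 then yield \<Lambda> = 0 and \<open>Y3 = 0\<close>.\<close>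

lemma boundary_functional_zero:
  fixes \<rho> :: real and Y1 Y2 Y3 T11 T12 T22 \<Lambda> K :: complex
  defines "R \<equiv> [:of_real \<rho>:]" and "Z \<equiv> [:0, 1:]" and "z0 \<equiv> \<i> * of_real \<rho>"
  assumes \<rho>: "\<rho> > 0"
    and main: "\<And>j h11 h12 h13 h22 h23 h33 V \<psi>.
      (\<And>l. l \<in> frame_interior R Z (h11, h12, h13, h22, h23, h33) V \<Longrightarrow> [:- z0, 1:] ^ j dvd l) \<Longrightarrow>
      [:- z0, 1:] ^ j dvd (R * R + Z * Z) * V \<Longrightarrow> [:- z0, 1:] ^ j dvd (R * R + Z * Z) * \<psi> \<Longrightarrow>
      [:- z0, 1:] ^ j dvd - [:Y1:] * (R * h11 + Z * h13) - [:Y2:] * (R * h12 + Z * h23)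
        - [:Y3:] * (R * h13 + Z * h33) + [:T11:] * h11 + [:T12:] * h12 + [:T22:] * h22
        + [:\<Lambda>:] * ([:1/2:] * Z * (h11 + h22) - R * h13) + [:K:] * Z * \<psi>"
  shows "Y1 = 0 \<and> Y2 = 0 \<and> Y3 = 0 \<and> T11 = 0 \<and> T12 = 0 \<and> T22 = 0 \<and> \<Lambda> = 0 \<and> K = 0"
proof -
  define q where "q = [:- z0, 1:]"
  note main = main[folded q_def]
  let ?r = "complex_of_real \<rho>"
  have z0: "z0 \<noteq> 0" and r: "?r \<noteq> 0" and zz: "z0 * z0 = - (?r * ?r)"
    using \<rho> by (auto simp: z0_def algebra_simps)
  have dvd1: "q ^ 1 dvd f \<longleftrightarrow> poly f z0 = 0" for f
    by (simp add: poly_eq_0_iff_dvd q_def)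
  have ev: "poly R z0 = ?r" "poly Z z0 = z0"
    by (simp_all add: R_def Z_def)
  have pz: "?r * ?r + z0 * z0 = 0"
    by (simp add: zz)
  have p: "R * R + Z * Z = q * (Z + [:z0:])"
    by (simp add: R_def Z_def zz q_def)
  have q0: "q \<noteq> 0"
    by (simp add: q_def)
  have q: "q = Z - [:z0:]"
    by (simp add: Z_def q_def)
  \<comment> \<open>At \<open>z0\<close> the norm p vanishes, so a constant field solves the
    interior equations to order 1 as soon as \<open>h(\<xi>, \<xi>) = 0\<close> and
    \<open>tr h + 2 V = 0\<close> there.\<close>
  have const: "- Y1 * (?r * ka + z0 * kc) - Y2 * (?r * kb + z0 * ke) - Y3 * (?r * kc + z0 * kf)
      + T11 * ka + T12 * kb + T22 * kd + \<Lambda> * (z0 / 2 * (ka + kd) - ?r * kc) + K * z0 * b = 0"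
    if "?r * ?r * ka + 2 * (?r * z0 * kc) + z0 * z0 * kf = 0" "ka + kd + kf + 2 * v = 0"
    for ka kb kc kd ke kf v b
  proof -
    have "poly (- [:Y1:] * (R * [:ka:] + Z * [:kc:]) - [:Y2:] * (R * [:kb:] + Z * [:ke:])
        - [:Y3:] * (R * [:kc:] + Z * [:kf:]) + [:T11:] * [:ka:] + [:T12:] * [:kb:] + [:T22:] * [:kd:]
        + [:\<Lambda>:] * ([:1/2:] * Z * ([:ka:] + [:kd:]) - R * [:kc:]) + [:K:] * Z * [:b:]) z0 = 0"
    proof (rule main[where j = 1 and V = "[:v:]", unfolded dvd1])
      fix l assume "l \<in> frame_interior R Z ([:ka:], [:kb:], [:kc:], [:kd:], [:ke:], [:kf:]) [:v:]"
      then show "poly l z0 = 0"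
        unfolding frame_interior_def Let_def case_prod_conv
        by (elim insertE emptyE; simp only: poly_add poly_diff poly_mult poly_numeral ev pz poly_pCons poly_0
            mult_zero_right add_0_right that; simp)
    qed (simp_all add: ev pz)
    then show ?thesis
      by (simp add: ev algebra_simps)
  qed
  have K: "K = 0"
    using const[where ka = 0 and kb = 0 and kc = 0 and kd = 0 and ke = 0 and kf = 0 and v = 0 and b = 1] z0
    by simp
  have Y2: "Y2 = 0"
    using const[where ka = 0 and kb = 0 and kc = 0 and kd = 0 and ke = 1 and kf = 0 and v = 0 and b = 0] z0
    by simp
  have T12: "T12 = 0"
    using const[where kb = 1 and ka = 0 and kc = 0 and kd = 0 and ke = 0 and kf = 0 and v = 0 and b = 0] Y2
    by simp
  \<comment> \<open>\<open>h22 = 1\<close> has trace 1, which \<open>V = -1/2\<close>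
    offsets.\<close>
  have T22: "T22 + \<Lambda> * z0 / 2 = 0"
    using const[where kb = 0 and ka = 0 and kc = 0 and kd = 1 and ke = 0 and kf = 0 and v = "-1/2" and b = 0]
    by simp
  \<comment> \<open>Here \<open>h(\<xi>, \<xi>) = \<rho>^2 + z0^2 = 0\<close>, and the trace 2
    forces \<open>V = -1\<close>.\<close>
  have 4: "- Y1 * ?r - Y3 * z0 + T11 + \<Lambda> * z0 / 2 = 0"
    using const[where kb = 0 and ka = 1 and kc = 0 and kd = 0 and ke = 0 and kf = 1 and v = "-1" and b = 0] pz
    by simp
  \<comment> \<open>The tensor is the symmetric product of the first covector with (-z0, 0, \<rho>),
    which is orthogonal to \<xi> at \<open>z0\<close>, so \<open>h(\<xi>, \<xi>) = 0\<close>;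
    \<open>V = z0\<close> offsets the trace -2 z0.\<close>
  have 5: "Y1 * ?r + Y3 * z0 = 2 * T11"
  proof -
    have "z0 * (Y1 * ?r - 2 * T11) = Y3 * (?r * ?r) + \<Lambda> * (z0 * z0 + ?r * ?r)"
      using const[where kb = 0 and ka = "-2 * z0" and kc = ?r and kd = 0 and ke = 0 and kf = 0 and v = z0 and b = 0]
      by (simp add: algebra_simps)
    also have "\<dots> = z0 * (- Y3 * z0)"
      by (simp add: zz algebra_simps)
    finally have "z0 * (Y1 * ?r + Y3 * z0 - 2 * T11) = 0"
      by (simp add: algebra_simps)
    then show ?thesis
      using z0 by simp
  qed
  have T11: "T11 = \<Lambda> * z0 / 2"
    using 4 5 by (simp add: algebra_simps)
  \<comment> \<open>the test field \<open>h = \<xi> \<xi>\<close>, \<open>V = - p\<close> of order 2\<close>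
  have \<Lambda>: "\<Lambda> = 0"
  proof -
    let ?p = "R * R + Z * Z"
    have "q ^ 2 dvd - [:Y1:] * (R * (R * R) + Z * (R * Z)) - [:Y2:] * (R * 0 + Z * 0)
        - [:Y3:] * (R * (R * Z) + Z * (Z * Z)) + [:T11:] * (R * R) + [:T12:] * 0 + [:T22:] * 0
        + [:\<Lambda>:] * ([:1/2:] * Z * (R * R + 0) - R * (R * Z)) + [:K:] * Z * 0"
    proof (rule main[where V = "- ?p"])
      have pp: "q ^ 2 dvd ?p * ?p"
        by (simp only: p) (simp add: power2_eq_square mult_dvd_mono)
      \<comment> \<open>\<xi> \<xi> has trace p and value p^2 on \<xi>, so \<open>V = - p\<close>
        cancels the \<xi> \<xi> terms and leaves 2 p^2 on the diagonal.\<close>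
      fix l assume "l \<in> frame_interior R Z (R * R, 0, R * Z, 0, 0, Z * Z) (- ?p)"
      then have "l = 0 \<or> l = 2 * (?p * ?p)"
        by (auto simp: frame_interior_def Let_def algebra_simps)
      then show "q ^ 2 dvd l"
        using pp by auto
    next
      have "q ^ 2 dvd ?p * ?p"
        by (simp only: p) (simp add: power2_eq_square mult_dvd_mono)
      then show "q ^ 2 dvd ?p * - ?p"
        by (simp only: mult_minus_right dvd_minus_iff)
    qed simp
    also have "- [:Y1:] * (R * (R * R) + Z * (R * Z)) - [:Y2:] * (R * 0 + Z * 0)
        - [:Y3:] * (R * (R * Z) + Z * (Z * Z)) + [:T11:] * (R * R) + [:T12:] * 0 + [:T22:] * 0
        + [:\<Lambda>:] * ([:1/2:] * Z * (R * R + 0) - R * (R * Z)) + [:K:] * Z * 0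
      = - ?p * ([:Y1:] * R + [:Y3:] * Z) - [:\<Lambda> / 2:] * (R * R) * q"
    proof -
      have "[:T11:] = [:\<Lambda> / 2:] * [:z0:]" "[:\<Lambda>:] * [:1/2:] = [:\<Lambda> / 2:]"
          "[:\<Lambda>:] = [:\<Lambda> / 2:] + [:\<Lambda> / 2:]"
        by (simp_all add: T11)
      then show ?thesis
        using q by algebra
    qed
    also have "\<dots> = q * (- (Z + [:z0:]) * ([:Y1:] * R + [:Y3:] * Z) - [:\<Lambda> / 2:] * (R * R))"
      using p by algebra
    \<comment> \<open>One factor q cancels; the value at \<open>z0\<close> of what is left becomes a
      multiple of \<Lambda> by the equations from the constant fields.\<close>
    finally have "q ^ 1 dvd - (Z + [:z0:]) * ([:Y1:] * R + [:Y3:] * Z) - [:\<Lambda> / 2:] * (R * R)"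
      using q0 by (simp add: power2_eq_square del: mult_pCons_left mult_pCons_right)
    then have "- (2 * z0) * (Y1 * ?r + Y3 * z0) - \<Lambda> / 2 * (?r * ?r) = 0"
      unfolding dvd1 by (simp add: ev)
    also have "- (2 * z0) * (Y1 * ?r + Y3 * z0) - \<Lambda> / 2 * (?r * ?r) = 3 / 2 * \<Lambda> * (?r * ?r)"
      unfolding 5 T11 using zz by algebra
    finally show ?thesis
      using r by simp
  qed
  \<comment> \<open>With \<Lambda> = 0 the combination of Y1 and Y3 in the order 2 test equals Y3
    times q, so that test gives nothing more and a field of order 3 is required.\<close>
  have Y1: "[:Y1:] * R = - [:Y3:] * [:z0:]"
    using 5 T11 by (simp add: \<Lambda> R_def eq_neg_iff_add_eq_0 mult.commute)
  \<comment> \<open>\<open>h = 3 \<rho>\<^sup>2 \<xi> \<xi> - 2 \<rho>\<^sup>2 p g - 2 p\<^sup>2 (\<epsilon>\<^sub>1 \<epsilon>\<^sub>1 - \<epsilon>\<^sub>2 \<epsilon>\<^sub>2)\<close>, \<open>V = 0\<close>: the first term has order 1 and the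
    others correct it to order 3\<close>
  have Y3: "Y3 = 0"
  proof -
    let ?p = "R * R + Z * Z"
    let ?h11 = "3 * (R * R * R * R) - 2 * (R * R * ?p) - 2 * (?p * ?p)"
    let ?h13 = "3 * (R * R * R * Z)"
    let ?h22 = "- 2 * (R * R * ?p) + 2 * (?p * ?p)"
    let ?h33 = "3 * (R * R * Z * Z) - 2 * (R * R * ?p)"
    have "q ^ 3 dvd - [:Y1:] * (R * ?h11 + Z * ?h13) - [:Y2:] * (R * 0 + Z * 0)
        - [:Y3:] * (R * ?h13 + Z * ?h33) + [:T11:] * ?h11 + [:T12:] * 0 + [:T22:] * ?h22
        + [:\<Lambda>:] * ([:1/2:] * Z * (?h11 + ?h22) - R * ?h13) + [:K:] * Z * 0"
    proof (rule main[where V = 0])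
      have pp: "q ^ 3 dvd ?p * ?p * ?p"
        by (simp only: p) (simp add: power3_eq_cube mult_dvd_mono)
      \<comment> \<open>The trace is -3 \<rho>^2 p and the value on \<xi> is -\<rho>^2 p^2, so
        everything cancels except -2 p^3 in the 11 component and 2 p^3 in the 22 component.\<close>
      fix l assume "l \<in> frame_interior R Z (?h11, 0, ?h13, ?h22, 0, ?h33) 0"
      then have "l = 0 \<or> l = 2 * (?p * ?p * ?p) \<or> l = - 2 * (?p * ?p * ?p)"
        by (auto simp: frame_interior_def Let_def algebra_simps)
      then show "q ^ 3 dvd l"
        using pp by auto
    qed simp_all
    also have "- [:Y1:] * (R * ?h11 + Z * ?h13) - [:Y2:] * (R * 0 + Z * 0)
        - [:Y3:] * (R * ?h13 + Z * ?h33) + [:T11:] * ?h11 + [:T12:] * 0 + [:T22:] * ?h22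
        + [:\<Lambda>:] * ([:1/2:] * Z * (?h11 + ?h22) - R * ?h13) + [:K:] * Z * 0
      = - (R * R) * ?p * ([:Y1:] * R + [:Y3:] * Z) + 2 * ([:Y1:] * R) * (?p * ?p)"
    proof -
      have "[:T11:] = 0" "[:T22:] = 0" "[:\<Lambda>:] = 0"
        using T11 T22 \<Lambda> by simp_all
      then show ?thesis
        by algebra
    qed
    \<comment> \<open>Both terms contain q^2 once \<open>Y1\<close> is expressed through
      \<open>Y3\<close>; the quotient at \<open>z0\<close> is a nonzero multiple of
      \<open>Y3\<close>.\<close>
    also have "\<dots> = q ^ 2 * ([:Y3:] * (- (R * R) * (Z + [:z0:]) - 2 * [:z0:] * ((Z + [:z0:]) * (Z + [:z0:]))))"
      using p q Y1 by algebra
    finally have "q ^ 1 dvd [:Y3:] * (- (R * R) * (Z + [:z0:]) - 2 * [:z0:] * ((Z + [:z0:]) * (Z + [:z0:])))"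
      using q0 by (simp add: power3_eq_cube power2_eq_square mult.assoc del: mult_pCons_left mult_pCons_right)
    then have "Y3 * (- (?r * ?r) * (2 * z0) - 2 * z0 * (2 * z0 * (2 * z0))) = 0"
      unfolding dvd1 by (simp add: ev)
    also have "- (?r * ?r) * (2 * z0) - 2 * z0 * (2 * z0 * (2 * z0)) = 6 * z0 * (?r * ?r)"
      using zz by algebra
    finally show ?thesis
      using z0 r by simp
  qed
  show ?thesis
    using K Y2 T12 T22 T11 \<Lambda> Y3 Y1 r by (simp add: R_def)
qed

section \<open>Interior symbols in an orthonormal coframe\<close>

locale coframe = invertible_jet +
  fixes \<epsilon> :: "3 \<Rightarrow> real^3"
  assumes orthonormal: "(\<Sum>a\<in>UNIV. \<Sum>b\<in>UNIV. gi B a b * \<epsilon> r $ a * \<epsilon> s $ b) = (if r = s then 1 else 0)"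
begin

definition E :: "3 \<Rightarrow> real^3"
  where "E r = (\<chi> a. \<Sum>b\<in>UNIV. gi B a b * \<epsilon> r $ b)"

lemma dual: "(\<Sum>a\<in>UNIV. \<epsilon> s $ a * E r $ a) = (if r = s then 1 else 0)"
  using orthonormal[of s r] by (simp add: E_def sum_distrib_left ac_simps eq_commute)

text \<open>Orthonormality makes \<epsilon> and E dual; one-sided inverses of square matrices being
  two-sided, the pair also resolves the identity.\<close>

lemma dual': "(\<Sum>r\<in>UNIV. E r $ a * \<epsilon> r $ b) = (if a = b then 1 else 0)"
proof -
  define P Q :: "real^3^3" where "P = (\<chi> r a. \<epsilon> r $ a)" and "Q = (\<chi> a r. E r $ a)"
  have "P ** Q = mat 1"
    by (simp add: P_def Q_def matrix_matrix_mult_def vec_eq_iff mat_def dual)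
  then have "Q ** P = mat 1"
    by (simp add: matrix_left_right_inverse)
  then show ?thesis
    by (simp add: P_def Q_def matrix_matrix_mult_def vec_eq_iff mat_def)
qed

lemma complete: "(\<Sum>r\<in>UNIV. \<epsilon> r $ a * \<epsilon> r $ b) = g0 B a b"
proof -
  have lower: "(\<Sum>c\<in>UNIV. g0 B a c * E r $ c) = \<epsilon> r $ a" for r a
    by (simp add: E_def lower_raise)
  have "(\<Sum>r\<in>UNIV. \<epsilon> r $ a * \<epsilon> r $ b) = (\<Sum>r\<in>UNIV. \<Sum>c\<in>UNIV. g0 B a c * (E r $ c * \<epsilon> r $ b))"
    by (simp add: lower[symmetric, of _ a] sum_distrib_right mult.assoc)
  also have "\<dots> = (\<Sum>c\<in>UNIV. g0 B a c * (\<Sum>r\<in>UNIV. E r $ c * \<epsilon> r $ b))"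
    by (subst sum.swap) (simp add: sum_distrib_left)
  finally show ?thesis
    by (simp add: dual' if_distrib[where f = "\<lambda>x. _ * x"] cong: if_cong)
qed

text \<open>General scalars, because it serves real vectors in \<open>coframe_zero_real\<close> and
  the complex coefficients of the gauge rows.\<close>

lemma coframe_zero:
  fixes v :: "3 \<Rightarrow> 'b::{real_algebra_1, comm_ring_1}"
  assumes "\<And>r. (\<Sum>a\<in>UNIV. v a * of_real (\<epsilon> r $ a)) = 0"
  shows "v b = 0"
proof -
  have "0 = (\<Sum>r\<in>UNIV. of_real (E r $ b) * (\<Sum>a\<in>UNIV. v a * of_real (\<epsilon> r $ a)))"
    by (simp add: assms)
  also have "\<dots> = (\<Sum>a\<in>UNIV. v a * of_real (\<Sum>r\<in>UNIV. E r $ b * \<epsilon> r $ a))"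
    unfolding of_real_sum sum_distrib_left by (subst sum.swap) (simp add: ac_simps)
  finally show ?thesis
    by (simp add: dual' if_distrib[where f = "\<lambda>x. _ * x"] if_distrib[where f = of_real] cong: if_cong)
qed

end

locale frame_symbol = jet_symbol B \<iota> \<xi> w + coframe B \<epsilon>
  for B and \<iota> :: "real \<Rightarrow> 'a::comm_ring_1" and \<xi> w \<epsilon> +
  fixes X :: "3 \<Rightarrow> 'a" and h :: "3 \<Rightarrow> 3 \<Rightarrow> 'a"
  assumes \<xi>: "\<xi> $ a = (\<Sum>r\<in>UNIV. X r * \<iota> (\<epsilon> r $ a))"
    and h: "w $ sym_index a b = (\<Sum>r\<in>UNIV. \<Sum>s\<in>UNIV. h r s * (\<iota> (\<epsilon> r $ a) * \<iota> (\<epsilon> s $ b)))"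
begin

lemma contract: "(\<Sum>a\<in>UNIV. (\<Sum>r\<in>UNIV. c r * \<iota> (\<epsilon> r $ a)) * \<iota> (E s $ a)) = c s"
proof -
  have "(\<Sum>a\<in>UNIV. (\<Sum>r\<in>UNIV. c r * \<iota> (\<epsilon> r $ a)) * \<iota> (E s $ a))
      = (\<Sum>r\<in>UNIV. c r * \<iota> (\<Sum>a\<in>UNIV. \<epsilon> r $ a * E s $ a))"
    by (simp add: sum_distrib_right sum_distrib_left \<iota>_sum \<iota>_mult mult.assoc) (rule sum.swap)
  then show ?thesis
    by (simp add: dual if_distrib[where f = "\<lambda>x. _ * x"] if_distrib[where f = \<iota>] \<iota>_0 \<iota>_1 cong: if_cong)
qed

lemma raise: "(\<Sum>b\<in>UNIV. M a b * (\<Sum>r\<in>UNIV. c r * \<iota> (\<epsilon> r $ b))) = (\<Sum>r\<in>UNIV. c r * \<iota> (E r $ a))"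
proof -
  have "(\<Sum>b\<in>UNIV. M a b * (\<Sum>r\<in>UNIV. c r * \<iota> (\<epsilon> r $ b)))
      = (\<Sum>b\<in>UNIV. \<Sum>r\<in>UNIV. c r * (M a b * \<iota> (\<epsilon> r $ b)))"
    by (simp add: sum_distrib_left ac_simps)
  also have "\<dots> = (\<Sum>r\<in>UNIV. c r * (\<Sum>b\<in>UNIV. M a b * \<iota> (\<epsilon> r $ b)))"
    by (subst sum.swap) (simp add: sum_distrib_left)
  finally show ?thesis
    by (simp add: E_def \<iota>_sum \<iota>_mult)
qed

lemma up_frame: "up a = (\<Sum>r\<in>UNIV. X r * \<iota> (E r $ a))"
  unfolding up_def \<xi> by (rule raise)

lemma contract_up: "(\<Sum>a\<in>UNIV. (\<Sum>r\<in>UNIV. c r * \<iota> (\<epsilon> r $ a)) * up a) = (\<Sum>r\<in>UNIV. c r * X r)"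
proof -
  have "(\<Sum>a\<in>UNIV. (\<Sum>r\<in>UNIV. c r * \<iota> (\<epsilon> r $ a)) * up a)
      = (\<Sum>s\<in>UNIV. X s * (\<Sum>a\<in>UNIV. (\<Sum>r\<in>UNIV. c r * \<iota> (\<epsilon> r $ a)) * \<iota> (E s $ a)))"
    unfolding up_frame sum_distrib_left
    by (subst sum.swap) (intro sum.cong refl, simp only: ac_simps)
  then show ?thesis
    by (simp only: contract) (simp only: mult.commute)
qed

lemma p_frame: "p = (\<Sum>r\<in>UNIV. X r * X r)"
  unfolding p_def \<xi> by (rule contract_up)

lemma H_rows: "H a b = (\<Sum>s\<in>UNIV. (\<Sum>r\<in>UNIV. h r s * \<iota> (\<epsilon> r $ a)) * \<iota> (\<epsilon> s $ b))"
  unfolding h by (subst sum.swap) (simp add: sum_distrib_right mult.assoc)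

lemma hx_frame: "hx a = (\<Sum>r\<in>UNIV. (\<Sum>s\<in>UNIV. h r s * X s) * \<iota> (\<epsilon> r $ a))"
proof -
  have "hx a = (\<Sum>s\<in>UNIV. (\<Sum>r\<in>UNIV. h r s * \<iota> (\<epsilon> r $ a)) * X s)"
    unfolding hx_def H_rows by (rule contract_up)
  also have "\<dots> = (\<Sum>r\<in>UNIV. (\<Sum>s\<in>UNIV. h r s * X s) * \<iota> (\<epsilon> r $ a))"
    unfolding sum_distrib_right by (subst sum.swap) (simp only: ac_simps)
  finally show ?thesis .
qed

lemma hxx_frame: "hxx = (\<Sum>r\<in>UNIV. (\<Sum>s\<in>UNIV. h r s * X s) * X r)"
  using contract_up[of "\<lambda>r. \<Sum>s\<in>UNIV. h r s * X s"] by (simp add: hxx_def hx_frame mult.commute)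

lemma t_frame: "t = (\<Sum>r\<in>UNIV. h r r)"
proof -
  have "t = (\<Sum>a\<in>UNIV. \<Sum>s\<in>UNIV. (\<Sum>r\<in>UNIV. h r s * \<iota> (\<epsilon> r $ a)) * \<iota> (E s $ a))"
    unfolding t_def H_rows by (simp only: raise)
  also have "\<dots> = (\<Sum>s\<in>UNIV. \<Sum>a\<in>UNIV. (\<Sum>r\<in>UNIV. h r s * \<iota> (\<epsilon> r $ a)) * \<iota> (E s $ a))"
    by (rule sum.swap)
  finally show ?thesis
    by (simp only: contract)
qed

lemma G_frame: "G a b = (\<Sum>r\<in>UNIV. \<iota> (\<epsilon> r $ a) * \<iota> (\<epsilon> r $ b))"
  by (simp add: complete[symmetric] \<iota>_sum \<iota>_mult)

text \<open>Coframe components of minus the metric symbol; for the adapted coframe they are the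
  polynomials collected in \<open>frame_interior\<close>.\<close>

definition l_frame :: "3 \<Rightarrow> 3 \<Rightarrow> 'a"
  where "l_frame r s = p * h r s + X r * X s * (t + 2 * w $ U)
    + (if r = s then hxx - p * t - 2 * p * w $ U else 0)"

lemma metric_frame:
  "symb 2 \<xi> w (metric_top a b)
    = - (\<Sum>r\<in>UNIV. \<Sum>s\<in>UNIV. l_frame r s * (\<iota> (\<epsilon> r $ a) * \<iota> (\<epsilon> s $ b)))"
proof -
  have diag: "(\<Sum>r\<in>UNIV. \<Sum>s\<in>UNIV. (if r = s then c else 0) * (\<iota> (\<epsilon> r $ a) * \<iota> (\<epsilon> s $ b))) = c * G a b" for c
    by (simp add: G_frame sum_distrib_left if_distrib[where f = "\<lambda>x. x * _"] cong: if_cong)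
  have xx: "(\<Sum>r\<in>UNIV. \<Sum>s\<in>UNIV. X r * X s * c * (\<iota> (\<epsilon> r $ a) * \<iota> (\<epsilon> s $ b))) = \<xi> $ a * \<xi> $ b * c" for c
    unfolding \<xi> sum_product unfolding sum_distrib_right by (simp only: ac_simps)
  have hh: "(\<Sum>r\<in>UNIV. \<Sum>s\<in>UNIV. c * h r s * (\<iota> (\<epsilon> r $ a) * \<iota> (\<epsilon> s $ b))) = c * H a b" for c
    by (simp add: h sum_distrib_left mult.assoc)
  have "(\<Sum>r\<in>UNIV. \<Sum>s\<in>UNIV. l_frame r s * (\<iota> (\<epsilon> r $ a) * \<iota> (\<epsilon> s $ b)))
      = p * H a b + \<xi> $ a * \<xi> $ b * (t + 2 * w $ U) + (hxx - p * t - 2 * p * w $ U) * G a b"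
    unfolding l_frame_def distrib_right[where c = "_ * \<iota> _"] sum.distrib by (simp only: diag xx hh)
  then show ?thesis
    by (simp add: symb_metric_top algebra_simps)
qed

end

definition field_vec :: "(3 \<Rightarrow> 3 \<Rightarrow> 'a) \<Rightarrow> 'a \<Rightarrow> 'a \<Rightarrow> 'a^icomp"
  where "field_vec k v \<psi> = (\<chi> c. case c of M11 \<Rightarrow> k 1 1 | M12 \<Rightarrow> k 1 2 | M13 \<Rightarrow> k 1 3
    | M22 \<Rightarrow> k 2 2 | M23 \<Rightarrow> k 2 3 | M33 \<Rightarrow> k 3 3 | U \<Rightarrow> v | Phi \<Rightarrow> \<psi>)"

lemma field_vec_nth:
  "(\<And>a b. k a b = k b a) \<Longrightarrow> field_vec k v \<psi> $ sym_index a b = k a b"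
  "field_vec k v \<psi> $ U = v" "field_vec k v \<psi> $ Phi = \<psi>"
  using exhaust_3[of a] exhaust_3[of b] by (auto simp: field_vec_def sym_index_def)

context invertible_jet
begin

definition int_top :: "icomp \<Rightarrow> jet \<Rightarrow> real"
  where "int_top r = (case r of M11 \<Rightarrow> metric_top 1 1 | M12 \<Rightarrow> metric_top 1 2 | M13 \<Rightarrow> metric_top 1 3
    | M22 \<Rightarrow> metric_top 2 2 | M23 \<Rightarrow> metric_top 2 3 | M33 \<Rightarrow> metric_top 3 3
    | U \<Rightarrow> (\<lambda>V. - 8 * exp (- 2 * j0 B U) * lap_top U V)
    | Phi \<Rightarrow> (\<lambda>V. - 8 * exp (- 6 * j0 B U) * lap_top Phi V))"

definition gauge_top :: "3 \<Rightarrow> jet \<Rightarrow> real"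
  where "gauge_top b V = - (\<Sum>i\<in>UNIV. \<Sum>a\<in>UNIV. gi B i a * g1 V i a b)"

end

context jet_symbol
begin

lemma symb_int_top:
  "symb 2 \<xi> w (int_top (sym_index a b)) = symb 2 \<xi> w (metric_top a b)"
  "symb 2 \<xi> w (int_top U) = \<iota> (- 8 * exp (- 2 * j0 B U)) * (p * w $ U)"
  "symb 2 \<xi> w (int_top Phi) = \<iota> (- 8 * exp (- 6 * j0 B U)) * (p * w $ Phi)"
proof -
  have *: "symb 2 \<xi> w (metric_top a b) = symb 2 \<xi> w (metric_top b a)" for a b
    unfolding symb_metric_top by (simp add: sym_index_commute[of a b] g0_sym[of B a b] ac_simps)
  show "symb 2 \<xi> w (int_top (sym_index a b)) = symb 2 \<xi> w (metric_top a b)"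
    using exhaust_3[of a] exhaust_3[of b]
    by (elim disjE) (simp_all add: int_top_def sym_index_def *[of 2 1] *[of 3 1] *[of 3 2])
  show "symb 2 \<xi> w (int_top U) = \<iota> (- 8 * exp (- 2 * j0 B U)) * (p * w $ U)"
    "symb 2 \<xi> w (int_top Phi) = \<iota> (- 8 * exp (- 6 * j0 B U)) * (p * w $ Phi)"
    by (simp_all only: int_top_def icomp.case symb_scale symb_lap_top)
qed

end

section \<open>Condition (A)\<close>

locale definite_jet = invertible_jet +
  assumes definite: "v \<noteq> 0 \<Longrightarrow> (\<Sum>a\<in>UNIV. \<Sum>b\<in>UNIV. g0 B a b * v $ a * v $ b) > 0"
begin

definition ipc :: "real^3 \<Rightarrow> real^3 \<Rightarrow> real"
  where "ipc a b = (\<Sum>i\<in>UNIV. \<Sum>j\<in>UNIV. gi B i j * a $ i * b $ j)"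

text \<open>With v the raised covector, a is v lowered again, so \<open>ipc a a\<close> is the
  metric evaluated on v.\<close>

lemma ipc_pos:
  assumes "a \<noteq> 0"
  shows "ipc a a > 0"
proof -
  define v :: "real^3" where "v = (\<chi> i. \<Sum>j\<in>UNIV. gi B i j * a $ j)"
  have lower: "(\<Sum>i\<in>UNIV. g0 B k i * v $ i) = a $ k" for k
    by (simp add: v_def lower_raise)
  have "v \<noteq> 0"
  proof
    assume "v = 0"
    then have "a $ k = 0" for k
      using lower[of k] by simp
    then show False
      using assms by (simp add: vec_eq_iff)
  qed
  moreover have "(\<Sum>k\<in>UNIV. \<Sum>i\<in>UNIV. g0 B k i * v $ k * v $ i) = (\<Sum>k\<in>UNIV. (\<Sum>i\<in>UNIV. g0 B k i * v $ i) * v $ k)"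
    unfolding sum_distrib_right by (simp only: ac_simps)
  moreover have "\<dots> = ipc a a"
    unfolding lower by (simp add: v_def ipc_def sum_distrib_left ac_simps)
  ultimately show ?thesis
    using definite[of v] by simp
qed

lemma interior_injective:
  fixes w :: "real^icomp"
  assumes \<xi>: "\<xi> \<noteq> 0"
    and A: "\<And>r c is. length is = 2 \<Longrightarrow> A r c is = int_top r (jet_basis c is)"
    and w: "symbol (\<lambda>a. a) iord A \<xi> *v w = 0"
  shows "w = 0"
proof -
  interpret jet_symbol B "\<lambda>a. a" \<xi> w
    by unfold_locales auto
  have row: "symb 2 \<xi> w (int_top r) = 0" for r
  proof -
    have "(symbol (\<lambda>a. a) iord A \<xi> *v w) $ r = symb (iord r) \<xi> w (int_top r)"
      by (rule symbol_symb) (rule A, simp add: iord_def)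
    then show ?thesis
      unfolding w iord_def by simp
  qed
  have p: "p > 0"
    using ipc_pos[OF \<xi>] by (simp add: p_def up_def ipc_def sum_distrib_left ac_simps)
  \<comment> \<open>The rows of u and \<phi> are nonzero multiples of p times their own unknown, so
    only h is left.\<close>
  have U: "w $ U = 0" and Phi: "w $ Phi = 0"
    using row[of U] row[of Phi] p by (simp_all add: symb_int_top)
  have eq: "p * H i j + \<xi> $ i * \<xi> $ j * t + (hxx - p * t) * g0 B i j = 0" for i j
    using row[of "sym_index i j"] by (simp add: symb_int_top symb_metric_top U)
  \<comment> \<open>The trace of the equation; the factor 3 is the trace of the metric, hence the
    dimension.\<close>
  have "(\<Sum>i\<in>UNIV. \<Sum>j\<in>UNIV. M i j * (p * H i j + \<xi> $ i * \<xi> $ j * t + (hxx - p * t) * g0 B i j))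
      = p * t + p * t + (hxx - p * t) * 3"
  proof -
    have "(\<Sum>i\<in>UNIV. \<Sum>j\<in>UNIV. M i j * (p * H i j)) = p * t"
      by (simp add: t_def sum_distrib_left ac_simps)
    moreover have "(\<Sum>i\<in>UNIV. \<Sum>j\<in>UNIV. M i j * (\<xi> $ i * \<xi> $ j * t)) = p * t"
      by (simp add: p_def up_def sum_distrib_left sum_distrib_right ac_simps)
    moreover have "(\<Sum>i\<in>UNIV. \<Sum>j\<in>UNIV. M i j * (c * g0 B i j)) = c * 3" for c
    proof -
      have "(\<Sum>i\<in>UNIV. \<Sum>j\<in>UNIV. M i j * (c * g0 B i j)) = c * (\<Sum>i\<in>UNIV. \<Sum>j\<in>UNIV. M i j * g0 B j i)"
        by (simp add: sum_distrib_left ac_simps g0_sym)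
      then show ?thesis
        by (simp add: gi_mult)
    qed
    ultimately show ?thesis
      by (simp only: distrib_left sum.distrib)
  qed
  then have 1: "p * t = 3 * hxx"
    by (simp add: eq)
  \<comment> \<open>The equation evaluated twice on \<xi>: the terms with t cancel and leave
    \<open>2 * p * hxx = 0\<close>, after which the trace equation gives t = 0.\<close>
  have "(\<Sum>i\<in>UNIV. \<Sum>j\<in>UNIV. up i * up j * (p * H i j + \<xi> $ i * \<xi> $ j * t + (hxx - p * t) * g0 B i j))
      = p * hxx + p * p * t + (hxx - p * t) * p"
  proof -
    have "(\<Sum>i\<in>UNIV. \<Sum>j\<in>UNIV. up i * up j * (p * H i j)) = p * hxx"
      by (simp add: hxx_def hx_def sum_distrib_left ac_simps)
    moreover have "(\<Sum>i\<in>UNIV. \<Sum>j\<in>UNIV. up i * up j * (\<xi> $ i * \<xi> $ j * t)) = p * p * t"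
      unfolding p_def sum_product unfolding sum_distrib_right by (simp only: ac_simps)
    moreover have "(\<Sum>i\<in>UNIV. \<Sum>j\<in>UNIV. up i * up j * (c * g0 B i j)) = c * p" for c
    proof -
      have "(\<Sum>j\<in>UNIV. g0 B i j * up j) = \<xi> $ i" for i
        by (simp add: up_def lower_raise)
      moreover have "(\<Sum>i\<in>UNIV. \<Sum>j\<in>UNIV. up i * up j * (c * g0 B i j))
          = c * (\<Sum>i\<in>UNIV. up i * (\<Sum>j\<in>UNIV. g0 B i j * up j))"
        by (simp add: sum_distrib_left ac_simps)
      ultimately show ?thesis
        by (simp add: p_def mult.commute)
    qed
    ultimately show ?thesis
      by (simp only: distrib_left sum.distrib)
  qed
  then have "0 = p * hxx + p * p * t + (hxx - p * t) * p"
    by (simp only: eq mult_zero_right sum.neutral_const)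
  then have "2 * p * hxx = 0"
    by (simp add: algebra_simps)
  then have "hxx = 0" "t = 0"
    using p 1 by auto
  then have H: "H i j = 0" for i j
    using eq[of i j] p by simp
  have "w $ M11 = 0" "w $ M12 = 0" "w $ M13 = 0" "w $ M22 = 0" "w $ M23 = 0" "w $ M33 = 0"
    using H[of 1 1] H[of 1 2] H[of 1 3] H[of 2 2] H[of 2 3] H[of 3 3]
    by (simp_all add: sym_index_def)
  then have "w $ c = 0" for c
    using U Phi by (cases c) auto
  then show ?thesis
    by (simp add: vec_eq_iff)
qed

lemma interior_elliptic:
  assumes "\<And>r c is. length is = 2 \<Longrightarrow> A r c is = int_top r (jet_basis c is)"
  shows "ADN_interior A"
  unfolding ADN_interior_def
proof (intro allI impI)
  fix \<xi> :: "real^3" assume "\<xi> \<noteq> 0"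
  then have "\<forall>w. symbol (\<lambda>a. a) iord A \<xi> *v w = 0 \<longrightarrow> w = 0"
    using interior_injective assms by blast
  then show "det (symbol (\<lambda>a. a) iord A \<xi>) \<noteq> 0"
    by (simp flip: matrix_left_invertible_ker add: invertible_left_inverse flip: invertible_det_nz)
qed

end

section \<open>Condition (B) in an adapted coframe\<close>

text \<open>s is the sign between the normal N and the vector dual to the third covector: a unit
  conormal may point to either side.\<close>

locale boundary_frame_symbol = boundary_symbol B x \<iota> \<xi> w + frame_symbol B \<iota> \<xi> w \<epsilon> X h
  for B x and \<iota> :: "real \<Rightarrow> 'a::comm_ring_1" and \<xi> w \<epsilon> X h +
  fixes s :: real
  assumes s: "s * s = 1" and N_frame: "N a = s * E 3 $ a"
begin

lemma contract_N: "(\<Sum>a\<in>UNIV. (\<Sum>r\<in>UNIV. c r * \<iota> (\<epsilon> r $ a)) * \<iota> (N a)) = \<iota> s * c 3"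
proof -
  have "(\<Sum>a\<in>UNIV. (\<Sum>r\<in>UNIV. c r * \<iota> (\<epsilon> r $ a)) * \<iota> (N a))
      = \<iota> s * (\<Sum>a\<in>UNIV. (\<Sum>r\<in>UNIV. c r * \<iota> (\<epsilon> r $ a)) * \<iota> (E 3 $ a))"
    unfolding N_frame \<iota>_mult sum_distrib_left[where r = "\<iota> s"] by (simp only: ac_simps)
  then show ?thesis
    by (simp only: contract)
qed

lemma s': "\<iota> s * \<iota> s = 1"
  using s by (simp flip: \<iota>_mult add: \<iota>_1)

lemma n\<xi>_frame: "n\<xi> = \<iota> s * X 3"
  using contract_N[of X] by (simp only: n\<xi>_def \<xi> mult.commute)

lemma hn_frame: "hn a = (\<Sum>r\<in>UNIV. (\<iota> s * h r 3) * \<iota> (\<epsilon> r $ a))"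
  unfolding hn_def H_rows contract_N by (simp add: sum_distrib_left mult.assoc)

lemma hnn_frame: "hnn = h 3 3"
proof -
  have "hnn = \<iota> s * (\<iota> s * h 3 3)"
    using contract_N[of "\<lambda>r. \<iota> s * h r 3"] by (simp only: hnn_def hn_frame mult.commute)
  then show ?thesis
    by (simp add: s' flip: mult.assoc)
qed

text \<open>The normal-normal component cancels twice, between the trace and \<open>hnn\<close> and
  in the last sum; what remains is the normal derivative of the tangential trace and tangential
  derivatives of the mixed components.\<close>

lemma mean_curv_frame:
  "symb 1 \<xi> w mean_curv_top = \<iota> s * (\<iota> (1/2) * X 3 * (h 1 1 + h 2 2) - (X 1 * h 1 3 + X 2 * h 2 3))"
proof -
  have "(\<Sum>a\<in>UNIV. up a * hn a) = (\<Sum>r\<in>UNIV. \<iota> s * h r 3 * X r)"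
    using contract_up[of "\<lambda>r. \<iota> s * h r 3"] by (simp only: hn_frame mult.commute)
  moreover have "(\<Sum>a\<in>UNIV. n\<xi> * \<iota> (N a) * hn a) = n\<xi> * hnn"
    by (simp add: hnn_def sum_distrib_left mult.assoc)
  ultimately have "(\<Sum>a\<in>UNIV. (up a - n\<xi> * \<iota> (N a)) * hn a)
      = (\<Sum>r\<in>UNIV. \<iota> s * h r 3 * X r) - \<iota> s * X 3 * h 3 3"
    by (simp only: left_diff_distrib sum_subtractf n\<xi>_frame hnn_frame)
  then have "symb 1 \<xi> w mean_curv_top = \<iota> (1/2) * n\<xi> * (t - hnn)
      - ((\<Sum>r\<in>UNIV. \<iota> s * h r 3 * X r) - \<iota> s * X 3 * h 3 3)"
    by (simp only: symb_mean_curv_top)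
  then show ?thesis
    unfolding n\<xi>_frame hnn_frame t_frame sum_3 by (simp add: algebra_simps)
qed

lemma tangential_frame:
  "symb 0 \<xi> w (\<lambda>V. \<Sum>i\<in>UNIV. \<Sum>j\<in>UNIV. e $ i * g0 V i j * e' $ j)
    = (\<Sum>r\<in>UNIV. \<Sum>s\<in>UNIV. h r s * (\<iota> (\<epsilon> r \<bullet> e) * \<iota> (\<epsilon> s \<bullet> e')))"
proof -
  have e: "\<iota> (\<epsilon> r \<bullet> e) = (\<Sum>i\<in>UNIV. \<iota> (\<epsilon> r $ i) * \<iota> (e $ i))" for r e
    by (simp add: inner_vec_def \<iota>_sum \<iota>_mult)
  have "(\<Sum>i\<in>UNIV. \<Sum>j\<in>UNIV. \<iota> (e $ i) * H i j * \<iota> (e' $ j))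
      = (\<Sum>i\<in>UNIV. \<Sum>j\<in>UNIV. \<Sum>r\<in>UNIV. \<Sum>s\<in>UNIV.
          h r s * ((\<iota> (\<epsilon> r $ i) * \<iota> (e $ i)) * (\<iota> (\<epsilon> s $ j) * \<iota> (e' $ j))))"
    unfolding h sum_distrib_left sum_distrib_right by (simp only: ac_simps)
  also have "\<dots> = (\<Sum>i\<in>UNIV. \<Sum>r\<in>UNIV. \<Sum>j\<in>UNIV. \<Sum>s\<in>UNIV.
          h r s * ((\<iota> (\<epsilon> r $ i) * \<iota> (e $ i)) * (\<iota> (\<epsilon> s $ j) * \<iota> (e' $ j))))"
    by (intro sum.cong refl sum.swap)
  also have "\<dots> = (\<Sum>r\<in>UNIV. \<Sum>i\<in>UNIV. \<Sum>s\<in>UNIV. \<Sum>j\<in>UNIV.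
          h r s * ((\<iota> (\<epsilon> r $ i) * \<iota> (e $ i)) * (\<iota> (\<epsilon> s $ j) * \<iota> (e' $ j))))"
    by (subst sum.swap) (intro sum.cong refl sum.swap)
  also have "\<dots> = (\<Sum>r\<in>UNIV. \<Sum>s\<in>UNIV. \<Sum>i\<in>UNIV. \<Sum>j\<in>UNIV.
          h r s * ((\<iota> (\<epsilon> r $ i) * \<iota> (e $ i)) * (\<iota> (\<epsilon> s $ j) * \<iota> (e' $ j))))"
    by (intro sum.cong refl sum.swap)
  also have "\<dots> = (\<Sum>r\<in>UNIV. \<Sum>s\<in>UNIV. h r s * (\<iota> (\<epsilon> r \<bullet> e) * \<iota> (\<epsilon> s \<bullet> e')))"
    unfolding e sum_product unfolding sum_distrib_left ..
  finally show ?thesis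
    by (simp only: symb_tangential)
qed

end

context boundary_jet
begin

definition bdry_top :: "real^3 \<Rightarrow> real^3 \<Rightarrow> bcomp \<Rightarrow> jet \<Rightarrow> real"
  where "bdry_top e1 e2 b = (case b of G1 \<Rightarrow> gauge_top 1 | G2 \<Rightarrow> gauge_top 2 | G3 \<Rightarrow> gauge_top 3
    | T11 \<Rightarrow> (\<lambda>V. \<Sum>i\<in>UNIV. \<Sum>j\<in>UNIV. e1 $ i * g0 V i j * e1 $ j)
    | T12 \<Rightarrow> (\<lambda>V. \<Sum>i\<in>UNIV. \<Sum>j\<in>UNIV. e1 $ i * g0 V i j * e2 $ j)
    | T22 \<Rightarrow> (\<lambda>V. \<Sum>i\<in>UNIV. \<Sum>j\<in>UNIV. e2 $ i * g0 V i j * e2 $ j)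
    | MeanC \<Rightarrow> mean_curv_top | NPhi \<Rightarrow> (\<lambda>V. \<Sum>i\<in>UNIV. N i * j1 V i Phi))"

end

text \<open>The hypotheses say that a binary quadratic form vanishes after a linear substitution
  with determinant D; undoing the substitution recovers each coefficient up to the factor
  D^2.\<close>

lemma quadratic_form_zero:
  fixes t1 t2 t3 a1 a2 b1 b2 :: complex
  assumes "t1 * a1 * a1 + t2 * a1 * b1 + t3 * b1 * b1 = 0"
    and "2 * t1 * a1 * a2 + t2 * (a1 * b2 + a2 * b1) + 2 * t3 * b1 * b2 = 0"
    and "t1 * a2 * a2 + t2 * a2 * b2 + t3 * b2 * b2 = 0" and D: "a1 * b2 - a2 * b1 \<noteq> 0"
  shows "t1 = 0" "t2 = 0" "t3 = 0"
proof -
  let ?D = "a1 * b2 - a2 * b1"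
  have "t1 * (?D * ?D) = 0"
    using assms(1-3) by algebra
  then show "t1 = 0"
    using D by simp
  have "t2 * (?D * ?D) = 0"
    using assms(1-3) by algebra
  then show "t2 = 0"
    using D by simp
  have "t3 * (?D * ?D) = 0"
    using assms(1-3) by algebra
  then show "t3 = 0"
    using D by simp
qed

lemma ring_embedding_cpoly: "ring_embedding cpoly"
  by unfold_locales (simp_all add: cpoly_def one_pCons)

lemma poly_det: "poly (det A) z = det (\<chi> i j. poly (A $ i $ j) z)"
  for A :: "'a::comm_ring_1 poly^'n^'n"
  by (simp add: det_def poly_sum poly_prod flip: of_int_mult)

lemma of_real_det: "complex_of_real (det A) = det (\<chi> i j. of_real (A $ i $ j))"
  for A :: "real^'n^'n"
  by (simp add: det_def)

text \<open>At z = 0 the line passes through \<eta>, so a nonzero determinant of the real symbol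
  shows that the polynomial determinant is not zero.\<close>

lemma poly_symbol_line:
  "poly (symbol cpoly ord A (line \<eta> \<mu>) $ r $ c) 0 = of_real (symbol (\<lambda>a. a) ord A \<eta> $ r $ c)"
proof -
  have "poly (prod_list (map (\<lambda>i. line \<eta> \<mu> $ i) is)) 0 = of_real (prod_list (map (\<lambda>i. \<eta> $ i) is))" for "is"
    by (induction "is") (simp_all add: line_def)
  then show ?thesis
    by (simp add: symbol_def poly_sum cpoly_def)
qed

locale boundary_coframe = boundary_jet B x + coframe B \<epsilon> + definite_jet B for B x \<epsilon> +
  fixes \<rho> s :: real and e1 e2 :: "real^3"
  assumes \<rho>: "\<rho> > 0" and s: "s * s = 1" and N_frame: "N a = s * E 3 $ a"
    and e_tangent: "\<epsilon> 3 \<bullet> e1 = 0" "\<epsilon> 3 \<bullet> e2 = 0" and e_ne: "e1 \<noteq> e2" and e_indep: "independent {e1, e2}"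
begin

lemma coframe_zero_real: "(\<And>r. \<epsilon> r \<bullet> v = 0) \<Longrightarrow> v = 0"
  using coframe_zero[of "\<lambda>a. v $ a"] by (simp add: inner_vec_def vec_eq_iff mult.commute)

text \<open>If the minor vanished, two combinations of \<open>e1\<close> and \<open>e2\<close> would
  be annihilated by all three covectors, hence be zero, and independence would then force
  \<open>e1\<close> itself to vanish.\<close>

lemma tangent_det: "(\<epsilon> 1 \<bullet> e1) * (\<epsilon> 2 \<bullet> e2) - (\<epsilon> 2 \<bullet> e1) * (\<epsilon> 1 \<bullet> e2) \<noteq> 0"
proof
  assume D: "(\<epsilon> 1 \<bullet> e1) * (\<epsilon> 2 \<bullet> e2) - (\<epsilon> 2 \<bullet> e1) * (\<epsilon> 1 \<bullet> e2) = 0"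
  have indep: "a = 0 \<and> b = 0" if "a *\<^sub>R e1 + b *\<^sub>R e2 = 0" for a b
  proof -
    have "\<forall>u. (\<Sum>v\<in>{e1, e2}. u v *\<^sub>R v) = 0 \<longrightarrow> (\<forall>v\<in>{e1, e2}. u v = 0)"
      using e_indep by (simp add: independent_explicit)
    from this[rule_format, of "\<lambda>v. if v = e1 then a else b" e1]
      this[rule_format, of "\<lambda>v. if v = e1 then a else b" e2]
    show ?thesis
      using that e_ne by simp
  qed
  have frame: "\<epsilon> r \<bullet> v = 0" if "\<epsilon> 1 \<bullet> v = 0" "\<epsilon> 2 \<bullet> v = 0" "\<epsilon> 3 \<bullet> v = 0" for v r
    using that exhaust_3[of r] by auto
  have z1: "(\<epsilon> 2 \<bullet> e2) *\<^sub>R e1 + (- (\<epsilon> 2 \<bullet> e1)) *\<^sub>R e2 = 0"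
    by (rule coframe_zero_real, rule frame) (use D e_tangent in \<open>simp_all add: inner_add_right algebra_simps\<close>)
  have z2: "(\<epsilon> 1 \<bullet> e2) *\<^sub>R e1 + (- (\<epsilon> 1 \<bullet> e1)) *\<^sub>R e2 = 0"
    by (rule coframe_zero_real, rule frame) (use D e_tangent in \<open>simp_all add: inner_add_right algebra_simps\<close>)
  have "\<epsilon> 2 \<bullet> e1 = 0" "\<epsilon> 1 \<bullet> e1 = 0"
    using indep[OF z1] indep[OF z2] by simp_all
  then have "e1 = 0"
    using e_tangent by (simp add: coframe_zero_real[OF frame])
  then show False
    using indep[of 1 0] by simp
qed

lemma boundary_elliptic_frame:
  assumes A: "\<And>r c is. length is = 2 \<Longrightarrow> A r c is = int_top r (jet_basis c is)"
    and C: "\<And>b c is. length is = bord b \<Longrightarrow> C b c is = bdry_top e1 e2 b (jet_basis c is)"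
  defines "L \<equiv> symbol cpoly iord A (line (\<rho> *\<^sub>R \<epsilon> 1) (\<epsilon> 3))"
    and "S \<equiv> symbol cpoly bord C (line (\<rho> *\<^sub>R \<epsilon> 1) (\<epsilon> 3))"
  shows "rows_indep_mod (lplus (det L)) (S ** adjugate L)"
  unfolding rows_indep_mod_def
proof (intro allI impI)
  fix c :: "bcomp \<Rightarrow> complex" and b0
  assume dv: "\<forall>j. lplus (det L) dvd (\<Sum>i\<in>UNIV. smult (c i) ((S ** adjugate L) $ i $ j))"
  define \<xi> where "\<xi> = line (\<rho> *\<^sub>R \<epsilon> 1) (\<epsilon> 3)"
  define z0 where "z0 = \<i> * complex_of_real \<rho>"
  define R Z :: "complex poly" where "R = [:of_real \<rho>:]" and "Z = [:0, 1:]"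
  have smult_sum: "smult a (sum f I) = (\<Sum>i\<in>I. smult a (f i))" for a :: complex and f and I :: "icomp set"
    by (induction I rule: infinite_finite_induct) (simp_all add: smult_add_right)
  define \<beta> where "\<beta> w = (\<Sum>i\<in>UNIV. smult (c i) ((S *v w) $ i))" for w
  define X where "X r = (if r = 1 then R else if r = 2 then 0 else Z)" for r :: 3
  have "\<rho> *\<^sub>R \<epsilon> 1 \<noteq> 0"
  proof
    assume "\<rho> *\<^sub>R \<epsilon> 1 = 0"
    then have "\<epsilon> 1 = 0"
      using \<rho> by simp
    then show False
      using orthonormal[of 1 1] by simp
  qed
  then have "det (symbol (\<lambda>a. a) iord A (\<rho> *\<^sub>R \<epsilon> 1)) \<noteq> 0"
    using interior_elliptic[of A] A by (simp add: ADN_interior_def)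
  then have "poly (det L) 0 \<noteq> 0"
    by (simp add: L_def poly_det poly_symbol_line flip: of_real_det)
  then have det_L: "det L \<noteq> 0"
    by auto
  \<comment> \<open>Multiplying the divisible row by \<open>L *v w\<close> turns the adjugate into
    the factor \<open>det L\<close>, which \<open>lplus_cancel\<close> removes.\<close>
  have key: "[:- z0, 1:] ^ n dvd \<beta> w" if "\<And>j. [:- z0, 1:] ^ n dvd (L *v w) $ j" for n w
  proof (rule lplus_cancel[where a = "\<lambda>j. \<Sum>i\<in>UNIV. smult (c i) ((S ** adjugate L) $ i $ j)"
        and y = "\<lambda>j. (L *v w) $ j", OF det_L _ _ that])
    show "Im z0 > 0"
      using \<rho> by (simp add: z0_def)
    show "lplus (det L) dvd (\<Sum>i\<in>UNIV. smult (c i) ((S ** adjugate L) $ i $ j))" for j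
      using dv by blast
    have "(\<Sum>j\<in>UNIV. (\<Sum>i\<in>UNIV. smult (c i) ((S ** adjugate L) $ i $ j)) * (L *v w) $ j)
        = (\<Sum>i\<in>UNIV. smult (c i) (((S ** adjugate L) *v (L *v w)) $ i))"
      unfolding matrix_vector_mult_def[of "S ** adjugate L"] vec_lambda_beta sum_distrib_right smult_sum
      by (subst sum.swap) simp
    also have "(S ** adjugate L) *v (L *v w) = det L *s (S *v w)"
      unfolding matrix_vector_mul_assoc[symmetric] adjugate_mult_left
      by (simp add: matrix_vector_mult_def vec_eq_iff sum_distrib_left ac_simps)
    also have "(\<Sum>i\<in>UNIV. smult (c i) ((det L *s (S *v w)) $ i)) = det L * \<beta> w"
      by (simp add: \<beta>_def sum_distrib_left)
    finally show "det L * \<beta> w = (\<Sum>j\<in>UNIV. (\<Sum>i\<in>UNIV. smult (c i) ((S ** adjugate L) $ i $ j)) * (L *v w) $ j)" ..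
  qed
  \<comment> \<open>The gauge rows are coordinate components and the tangential rows refer to
    \<open>e1\<close>, \<open>e2\<close>; \<open>Y\<close> and \<open>t1\<close>, \<open>t2\<close>,
    \<open>t3\<close> re-express their coefficients in the coframe.\<close>
  define cg where "cg a = (if a = 1 then c G1 else if a = 2 then c G2 else c G3)" for a :: 3
  define Y where "Y r = (\<Sum>a\<in>UNIV. cg a * of_real (\<epsilon> r $ a))" for r
  define a1 a2 b1 b2 where ab: "a1 = complex_of_real (\<epsilon> 1 \<bullet> e1)" "a2 = complex_of_real (\<epsilon> 2 \<bullet> e1)"
    "b1 = complex_of_real (\<epsilon> 1 \<bullet> e2)" "b2 = complex_of_real (\<epsilon> 2 \<bullet> e2)"
  define t1 t2 t3 where t1_t2_t3: "t1 = c T11 * a1 * a1 + c T12 * a1 * b1 + c T22 * b1 * b1"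
    "t2 = 2 * c T11 * a1 * a2 + c T12 * (a1 * b2 + a2 * b1) + 2 * c T22 * b1 * b2"
    "t3 = c T11 * a2 * a2 + c T12 * a2 * b2 + c T22 * b2 * b2"
  have zero: "Y 1 = 0 \<and> Y 2 = 0 \<and> Y 3 = 0 \<and> t1 = 0 \<and> t2 = 0 \<and> t3 = 0
      \<and> c MeanC * of_real s = 0 \<and> c NPhi * of_real s = 0"
  proof (rule boundary_functional_zero[OF \<rho>, folded R_def Z_def z0_def])
    fix n and h11 h12 h13 h22 h23 h33 V \<psi> :: "complex poly"
    assume l: "\<And>l. l \<in> frame_interior R Z (h11, h12, h13, h22, h23, h33) V \<Longrightarrow> [:- z0, 1:] ^ n dvd l"
      and pV: "[:- z0, 1:] ^ n dvd (R * R + Z * Z) * V" and p\<psi>: "[:- z0, 1:] ^ n dvd (R * R + Z * Z) * \<psi>"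
    define hc where "hc i = (case i of M11 \<Rightarrow> h11 | M12 \<Rightarrow> h12 | M13 \<Rightarrow> h13 | M22 \<Rightarrow> h22 | M23 \<Rightarrow> h23
      | M33 \<Rightarrow> h33 | _ \<Rightarrow> 0)" for i
    define h where "h r s = hc (sym_index r s)" for r s
    define k where "k a b = (\<Sum>r\<in>UNIV. \<Sum>s\<in>UNIV. h r s * (cpoly (\<epsilon> r $ a) * cpoly (\<epsilon> s $ b)))" for a b
    define w where "w = field_vec k V \<psi>"
    have k: "k a b = k b a" for a b
      unfolding k_def by (subst sum.swap) (simp add: h_def sym_index_commute ac_simps)
    interpret boundary_frame_symbol B x cpoly \<xi> w \<epsilon> X h s
    proof (intro_locales)
      show "ring_embedding cpoly"
        by (rule ring_embedding_cpoly)
      show "frame_symbol_axioms cpoly \<xi> w \<epsilon> X h"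
        by unfold_locales (simp_all add: \<xi>_def line_def X_def R_def Z_def cpoly_def sum_3 w_def field_vec_nth k k_def)
      show "boundary_frame_symbol_axioms B x \<epsilon> s"
        by unfold_locales (simp_all add: s N_frame)
    qed
    have h_simps: "h 1 1 = h11" "h 1 2 = h12" "h 1 3 = h13" "h 2 1 = h12" "h 2 2 = h22" "h 2 3 = h23"
      "h 3 1 = h13" "h 3 2 = h23" "h 3 3 = h33"
      by (simp_all add: h_def hc_def sym_index_def)
    have X_simps: "X 1 = R" "X 2 = 0" "X 3 = Z"
      by (simp_all add: X_def)
    have w_simps: "w $ U = V" "w $ Phi = \<psi>"
      by (simp_all add: w_def field_vec_nth)
    have p: "p = R * R + Z * Z"
      by (simp add: p_frame sum_3 X_simps)
    have row: "(L *v w) $ r = symb 2 \<xi> w (int_top r)" for r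
    proof -
      have "(symbol cpoly iord A \<xi> *v w) $ r = symb (iord r) \<xi> w (int_top r)"
        by (rule symbol_symb) (rule A, simp add: iord_def)
      then show ?thesis
        by (simp add: L_def \<xi>_def iord_def)
    qed
    \<comment> \<open>Every coframe component is one of the six listed polynomials, so their
      divisibility passes to all coordinate rows.\<close>
    have "l_frame r s \<in> frame_interior R Z (h11, h12, h13, h22, h23, h33) V" for r s
      using exhaust_3[of r] exhaust_3[of s]
      by (auto simp: l_frame_def frame_interior_def Let_def p t_frame hxx_frame sum_3 X_simps h_simps
          w_simps algebra_simps)
    then have metric: "[:- z0, 1:] ^ n dvd symb 2 \<xi> w (metric_top a b)" for a b
      unfolding metric_frame dvd_minus_iff by (intro dvd_sum dvd_mult2 l)
    have "[:- z0, 1:] ^ n dvd (L *v w) $ r" for r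
    proof -
      have "[:- z0, 1:] ^ n dvd symb 2 \<xi> w (int_top (sym_index a b))" for a b
        using metric by (simp only: symb_int_top)
      from this[of 1 1] this[of 1 2] this[of 1 3] this[of 2 2] this[of 2 3] this[of 3 3] pV p\<psi>
      show ?thesis
        unfolding row by (cases r) (simp_all add: sym_index_def symb_int_top p w_simps)
    qed
    then have "[:- z0, 1:] ^ n dvd \<beta> w"
      by (rule key)
    \<comment> \<open>The functional in the coframe; the sign s is absorbed into the coefficients of
      \<open>MeanC\<close> and \<open>NPhi\<close>.\<close>
    moreover have "\<beta> w = - [:Y 1:] * (R * h11 + Z * h13) - [:Y 2:] * (R * h12 + Z * h23)
        - [:Y 3:] * (R * h13 + Z * h33) + [:t1:] * h11 + [:t2:] * h12 + [:t3:] * h22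
        + [:c MeanC * of_real s:] * ([:1/2:] * Z * (h11 + h22) - R * h13) + [:c NPhi * of_real s:] * Z * \<psi>"
    proof -
      have rowS: "(S *v w) $ b = symb (bord b) \<xi> w (bdry_top e1 e2 b)" for b
        unfolding S_def \<xi>_def[symmetric] by (rule symbol_symb) (rule C)
      have G: "symb (Suc 0) \<xi> w (gauge_top a) = - hx a" for a
        using symb_gauge[of a] by (simp add: gauge_top_def [abs_def])
      have hx: "hx a = [:of_real (\<epsilon> 1 $ a):] * (R * h11 + Z * h13)
          + [:of_real (\<epsilon> 2 $ a):] * (R * h12 + Z * h23) + [:of_real (\<epsilon> 3 $ a):] * (R * h13 + Z * h33)" for a
        by (simp add: hx_frame sum_3 X_simps h_simps cpoly_def algebra_simps smult_add_right)
      have tang: "symb 0 \<xi> w (\<lambda>V. \<Sum>i\<in>UNIV. \<Sum>j\<in>UNIV. e $ i * g0 V i j * e' $ j)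
          = h11 * ([:of_real (\<epsilon> 1 \<bullet> e):] * [:of_real (\<epsilon> 1 \<bullet> e'):])
            + h12 * ([:of_real (\<epsilon> 1 \<bullet> e):] * [:of_real (\<epsilon> 2 \<bullet> e'):] + [:of_real (\<epsilon> 2 \<bullet> e):] * [:of_real (\<epsilon> 1 \<bullet> e'):])
            + h22 * ([:of_real (\<epsilon> 2 \<bullet> e):] * [:of_real (\<epsilon> 2 \<bullet> e'):])"
        if "\<epsilon> 3 \<bullet> e = 0" "\<epsilon> 3 \<bullet> e' = 0" for e e'
        unfolding tangential_frame cpoly_def[symmetric] unfolding sum_3 h_simps that
        by (simp add: \<iota>_0 algebra_simps)
      have mc: "symb (Suc 0) \<xi> w mean_curv_top = [:of_real s:] * ([:1/2:] * Z * (h11 + h22) - R * h13)"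
        using mean_curv_frame by (simp add: X_simps h_simps cpoly_def)
      have nd: "symb (Suc 0) \<xi> w (\<lambda>V. \<Sum>i\<in>UNIV. N i * j1 V i Phi) = [:of_real s:] * Z * \<psi>"
        using symb_normal_deriv by (simp add: n\<xi>_frame X_simps w_simps cpoly_def)
      have \<beta>: "\<beta> w = [:c G1:] * - hx 1 + [:c G2:] * - hx 2 + [:c G3:] * - hx 3
          + [:c T11:] * symb 0 \<xi> w (bdry_top e1 e2 T11) + [:c T12:] * symb 0 \<xi> w (bdry_top e1 e2 T12)
          + [:c T22:] * symb 0 \<xi> w (bdry_top e1 e2 T22)
          + [:c MeanC:] * ([:of_real s:] * ([:1/2:] * Z * (h11 + h22) - R * h13))
          + [:c NPhi:] * ([:of_real s:] * Z * \<psi>)"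
        by (simp add: \<beta>_def rowS UNIV_bcomp G mc nd bdry_top_def mult.commute[of "of_real s" "c _"])
      have Y: "[:Y r:] = [:c G1:] * [:of_real (\<epsilon> r $ 1):] + [:c G2:] * [:of_real (\<epsilon> r $ 2):]
          + [:c G3:] * [:of_real (\<epsilon> r $ 3):]" for r
        by (simp add: Y_def sum_3 cg_def)
      have t: "[:t1:] = [:c T11:] * [:a1:] * [:a1:] + [:c T12:] * [:a1:] * [:b1:] + [:c T22:] * [:b1:] * [:b1:]"
        "[:t2:] = 2 * [:c T11:] * [:a1:] * [:a2:] + [:c T12:] * ([:a1:] * [:b2:] + [:a2:] * [:b1:]) + 2 * [:c T22:] * [:b1:] * [:b2:]"
        "[:t3:] = [:c T11:] * [:a2:] * [:a2:] + [:c T12:] * [:a2:] * [:b2:] + [:c T22:] * [:b2:] * [:b2:]"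
        by (simp_all add: t1_t2_t3 numeral_poly algebra_simps)
      have cs: "[:c b * of_real s:] = [:c b:] * [:of_real s:]" for b
        by simp
      have tg: "symb 0 \<xi> w (bdry_top e1 e2 T11) = h11 * ([:a1:] * [:a1:]) + h12 * ([:a1:] * [:a2:] + [:a2:] * [:a1:]) + h22 * ([:a2:] * [:a2:])"
        "symb 0 \<xi> w (bdry_top e1 e2 T12) = h11 * ([:a1:] * [:b1:]) + h12 * ([:a1:] * [:b2:] + [:a2:] * [:b1:]) + h22 * ([:a2:] * [:b2:])"
        "symb 0 \<xi> w (bdry_top e1 e2 T22) = h11 * ([:b1:] * [:b1:]) + h12 * ([:b1:] * [:b2:] + [:b2:] * [:b1:]) + h22 * ([:b2:] * [:b2:])"
        using tang e_tangent by (simp_all only: bdry_top_def bcomp.case ab)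
      show ?thesis
        unfolding \<beta> hx Y t cs tg by algebra
    qed
    ultimately show "[:- z0, 1:] ^ n dvd - [:Y 1:] * (R * h11 + Z * h13) - [:Y 2:] * (R * h12 + Z * h23)
        - [:Y 3:] * (R * h13 + Z * h33) + [:t1:] * h11 + [:t2:] * h12 + [:t3:] * h22
        + [:c MeanC * of_real s:] * ([:1/2:] * Z * (h11 + h22) - R * h13) + [:c NPhi * of_real s:] * Z * \<psi>"
      by simp
  qed
  have "Y r = 0" for r
    using zero exhaust_3[of r] by auto
  then have cg: "cg a = 0" for a
    unfolding Y_def by (rule coframe_zero)
  have "complex_of_real ((\<epsilon> 1 \<bullet> e1) * (\<epsilon> 2 \<bullet> e2) - (\<epsilon> 2 \<bullet> e1) * (\<epsilon> 1 \<bullet> e2)) \<noteq> 0"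
    using tangent_det of_real_eq_0_iff by blast
  then have D: "a1 * b2 - a2 * b1 \<noteq> 0"
    by (simp add: ab)
  \<comment> \<open>Back from the coframe to \<open>e1\<close>, \<open>e2\<close>: the substitution
    is invertible because these are independent.\<close>
  have "c T11 = 0" "c T12 = 0" "c T22 = 0"
    using quadratic_form_zero[OF _ _ _ D, of "c T11" "c T12" "c T22"] zero unfolding t1_t2_t3 by auto
  moreover have "c MeanC = 0" "c NPhi = 0"
    using zero s by auto
  moreover have "c G1 = 0" "c G2 = 0" "c G3 = 0"
    using cg[of 1] cg[of 2] cg[of 3] by (simp_all add: cg_def)
  ultimately show "c b0 = 0"
    by (cases b0) auto
qed

end

section \<open>Construction of the adapted coframe\<close>

locale boundary_definite = boundary_jet B x + definite_jet B for B x
begin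

lemma ipc_sym: "ipc a b = ipc b a"
  unfolding ipc_def by (subst sum.swap) (simp add: gi_sym ac_simps)

lemma ipc_scaleR: "ipc (r *\<^sub>R a) b = r * ipc a b" "ipc a (r *\<^sub>R b) = r * ipc a b"
  by (simp_all add: ipc_def sum_distrib_left ac_simps)

definition raise_vec :: "real^3 \<Rightarrow> real^3"
  where "raise_vec a = (\<chi> i. \<Sum>j\<in>UNIV. gi B i j * a $ j)"

lemma ipc_raise: "ipc a b = a \<bullet> raise_vec b"
  by (simp add: ipc_def raise_vec_def inner_vec_def sum_distrib_left ac_simps)

text \<open>Conormals at a point of the sphere are multiples of x, and raising x gives a multiple of
  N. So \<mu> can be the third covector and the normalized \<eta> the first; their orthogonality is
  the tangentiality of \<eta>.\<close>

lemma boundary_elliptic: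
  assumes A: "\<And>r c is. length is = 2 \<Longrightarrow> A r c is = int_top r (jet_basis c is)"
    and C: "\<And>b c is. length is = bord b \<Longrightarrow> C b c is = bdry_top e1 e2 b (jet_basis c is)"
    and e: "tangent_basis x e1 e2" and x: "x \<noteq> 0" and \<eta>: "\<eta> \<noteq> 0" and \<eta>N: "(\<Sum>a\<in>UNIV. \<eta> $ a * N a) = 0"
    and \<mu>: "\<And>v. v \<in> tangent x \<Longrightarrow> \<mu> \<bullet> v = 0" and \<mu>1: "ipc \<mu> \<mu> = 1"
  shows "rows_indep_mod (lplus (det (symbol cpoly iord A (line \<eta> \<mu>))))
    (symbol cpoly bord C (line \<eta> \<mu>) ** adjugate (symbol cpoly iord A (line \<eta> \<mu>)))"
proof -
  define c where "c = (\<mu> \<bullet> x) / (x \<bullet> x)"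
  define q where "q = sqn x (gi B)"
  \<comment> \<open>The minus sign reflects that N points towards the origin.\<close>
  define s where "s = - (c * sqrt q)"
  have \<mu>_eq: "\<mu> = c *\<^sub>R x"
  proof -
    have 0: "(\<mu> - c *\<^sub>R x) \<bullet> x = 0"
      using x by (simp add: inner_diff_left c_def)
    then have "\<mu> \<bullet> (\<mu> - c *\<^sub>R x) = 0"
      by (intro \<mu>) (simp add: tangent_def)
    then have "(\<mu> - c *\<^sub>R x) \<bullet> (\<mu> - c *\<^sub>R x) = 0"
      using 0 by (simp add: inner_diff_left[of \<mu>] inner_commute)
    then show ?thesis
      by simp
  qed
  have raise_\<mu>: "raise_vec \<mu> $ a = s * N a" for a
  proof -
    have "raise_vec \<mu> $ a = c * (\<Sum>b\<in>UNIV. gi B a b * x $ b)"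
      by (simp add: raise_vec_def \<mu>_eq sum_distrib_left ac_simps)
    then show ?thesis
      by (simp add: gi_x s_def q_def)
  qed
  have "ipc \<mu> \<mu> = c * c * q"
    by (simp add: \<mu>_eq ipc_scaleR) (simp add: ipc_def sqn_def q_def)
  then have ss: "s * s = 1"
    using \<mu>1 sqn_pos by (simp add: s_def q_def ac_simps)
  have \<eta>\<mu>: "ipc \<eta> \<mu> = 0"
  proof -
    have "ipc \<eta> \<mu> = s * (\<Sum>a\<in>UNIV. \<eta> $ a * N a)"
      by (simp add: ipc_raise inner_vec_def raise_\<mu> sum_distrib_left ac_simps)
    then show ?thesis
      by (simp add: \<eta>N)
  qed
  define \<rho> where "\<rho> = sqrt (ipc \<eta> \<eta>)"
  have \<rho>: "\<rho> > 0" "\<rho> * \<rho> = ipc \<eta> \<eta>"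
    using ipc_pos[OF \<eta>] by (auto simp: \<rho>_def)
  \<comment> \<open>Euclidean orthogonality to the raised covectors is orthogonality in the inverse
    metric, and two vectors cannot span a three-dimensional space.\<close>
  obtain v where v: "v \<noteq> 0" "\<And>y. y \<in> span {raise_vec \<eta>, raise_vec \<mu>} \<Longrightarrow> orthogonal v y"
  proof -
    have "dim {raise_vec \<eta>, raise_vec \<mu>} \<le> card {raise_vec \<eta>, raise_vec \<mu>}"
      by (rule dim_le_card[OF span_superset]) simp
    also have "\<dots> < DIM(real^3)"
      using card_insert_le_m1[of 2 "{raise_vec \<mu>}" "raise_vec \<eta>"] by simp
    finally show ?thesis
      using orthogonal_to_subspace_exists that by metis
  qed
  have v\<eta>: "ipc v \<eta> = 0"
    unfolding ipc_raise orthogonal_def[symmetric] by (rule v(2)[OF span_base]) simp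
  have v\<mu>: "ipc v \<mu> = 0"
    unfolding ipc_raise orthogonal_def[symmetric] by (rule v(2)[OF span_base]) simp
  define \<theta> where "\<theta> = (1 / sqrt (ipc v v)) *\<^sub>R v"
  have \<theta>: "ipc \<theta> \<theta> = 1" "ipc \<theta> \<eta> = 0" "ipc \<theta> \<mu> = 0"
    using ipc_pos[OF v(1)] by (simp_all add: \<theta>_def ipc_scaleR v\<eta> v\<mu>)
  define \<epsilon> where "\<epsilon> r = (if r = 1 then (1 / \<rho>) *\<^sub>R \<eta> else if r = 2 then \<theta> else \<mu>)" for r :: 3
  have orth: "ipc (\<epsilon> r) (\<epsilon> s) = (if r = s then 1 else 0)" for r s
    using exhaust_3[of r] exhaust_3[of s] \<rho> \<eta>\<mu> \<theta> \<mu>1 ipc_sym[of \<mu> \<eta>] ipc_sym[of \<eta> \<theta>] ipc_sym[of \<mu> \<theta>]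
    by (auto simp: \<epsilon>_def ipc_scaleR)
  interpret coframe B \<epsilon>
    by unfold_locales (use orth in \<open>simp add: ipc_def\<close>)
  have E3: "E 3 = raise_vec \<mu>"
    by (simp add: E_def raise_vec_def \<epsilon>_def)
  interpret boundary_coframe B x \<epsilon> \<rho> s e1 e2
  proof
    show "N a = s * E 3 $ a" for a
      using ss by (simp add: E3 raise_\<mu> flip: mult.assoc)
  qed (use \<rho> ss e \<mu> in \<open>auto simp: \<epsilon>_def tangent_basis_def\<close>)
  have "\<eta> = \<rho> *\<^sub>R \<epsilon> 1" "\<mu> = \<epsilon> 3"
    using \<rho> by (simp_all add: \<epsilon>_def)
  then show ?thesis
    using boundary_elliptic_frame[OF A C] by simp
qed

end

section \<open>The linearized boundary value problem\<close>

definition int_jet :: "jet \<Rightarrow> icomp \<Rightarrow> jet \<Rightarrow> real"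
  where "int_jet B r J = (case r of M11 \<Rightarrow> metric_jet B J 1 1 | M12 \<Rightarrow> metric_jet B J 1 2
    | M13 \<Rightarrow> metric_jet B J 1 3 | M22 \<Rightarrow> metric_jet B J 2 2 | M23 \<Rightarrow> metric_jet B J 2 3
    | M33 \<Rightarrow> metric_jet B J 3 3 | U \<Rightarrow> u_jet J | Phi \<Rightarrow> phi_jet J)"

definition tangential_jet :: "real^3^3 \<Rightarrow> real^3 \<Rightarrow> real^3 \<Rightarrow> jet \<Rightarrow> real"
  where "tangential_jet k e e' J = (\<Sum>i\<in>UNIV. \<Sum>j\<in>UNIV. e $ i * g0 J i j * e' $ j) - e \<bullet> (k *v e')"

definition bdry_jet :: "jet \<Rightarrow> real^3 \<Rightarrow> real^3 \<Rightarrow> real^3 \<Rightarrow> real^3^3 \<Rightarrow> real \<Rightarrow> real \<Rightarrow> bcomp \<Rightarrow> jet \<Rightarrow> real"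
  where "bdry_jet B x e1 e2 k l m b J = (case b of G1 \<Rightarrow> gauge_jet B J 1 | G2 \<Rightarrow> gauge_jet B J 2
    | G3 \<Rightarrow> gauge_jet B J 3 | T11 \<Rightarrow> tangential_jet k e1 e1 J | T12 \<Rightarrow> tangential_jet k e1 e2 J
    | T22 \<Rightarrow> tangential_jet k e2 e2 J | MeanC \<Rightarrow> mean_curv_jet x J - l
    | NPhi \<Rightarrow> normal_deriv_jet x J - m)"

lemma (in invertible_jet) top2_int: "has_top 2 B (int_jet B r) (int_top r)"
  unfolding int_jet_def [abs_def] int_top_def
  by (cases r) (simp_all only: icomp.case top2_metric top2_u top2_phi)

lemma (in boundary_jet) top_bdry: "has_top (bord b) B (bdry_jet B x e1 e2 k l m b) (bdry_top e1 e2 b)"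
proof -
  have sub: "has_top 1 B (\<lambda>J. F J - r) P" if "has_top 1 B F P" for F P and r :: real
    using has_top_diff[OF that has_top_const[of 1 B r]] by simp
  show ?thesis
    unfolding bdry_jet_def [abs_def] bdry_top_def tangential_jet_def
    by (cases b)
       (simp_all add: has_top_tangential gauge_top_def [abs_def] top1_gauge[unfolded One_nat_def]
         sub[unfolded One_nat_def] top1_mean_curv[unfolded One_nat_def] top1_normal_deriv[unfolded One_nat_def])
qed

lemma (in gauge_point) L_S_jet: "icoord r (L_S h (g, u, \<phi>)) x = int_jet B r J"
  by (cases r) (simp_all add: int_jet_def L_metric_jet L_u_jet L_phi_jet)

lemma (in field_point) tangential: "e \<bullet> ((g x - k) *v e') = tangential_jet k e e' J"
proof -
  have "e \<bullet> (g x *v e') = (\<Sum>i\<in>UNIV. \<Sum>j\<in>UNIV. e $ i * g0 J i j * e' $ j)"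
    by (simp add: inner_vec_def matrix_vector_mult_def at_metric' sum_distrib_left mult.assoc)
  then show ?thesis
    by (simp add: tangential_jet_def matrix_vector_mult_diff_rdistrib inner_diff_right)
qed

lemma bdry_data_jet:
  assumes "gauge_point g u \<phi> x J h v \<psi> B" "boundary_point g u \<phi> x J"
  shows "bcoord e1 e2 b (B_S h \<gamma> lam f (g, u, \<phi>)) x = bdry_jet B x e1 e2 (\<gamma> x) (lam x) (f x) b J"
proof -
  interpret gauge_point g u \<phi> x J h v \<psi> B
    by (rule assms)
  interpret boundary_point g u \<phi> x J
    by (rule assms)
  show ?thesis
    by (cases b) (simp_all add: bdry_jet_def gauge_gauge_jet tangential mean_curv_mean_curv_jet normal_deriv)
qed

section \<open>Perturbed fields and their jets\<close>

lemma icoord_perturb: "icoord c (perturb W t X) x = icoord c W x + t * icoord c X x"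
  by (cases W; cases X; cases c) simp_all

lemma regular_fields_perturb:
  assumes W: "regular_fields W" and X: "regular_fields X"
  shows "regular_fields (perturb W t X)"
    and "x \<in> ext \<Longrightarrow> jet_of (perturb W t X) x = jet_of W x + t *\<^sub>R jet_of X x"
proof -
  have tW: "twice_diff (icoord c W)" and tX: "twice_diff (icoord c X)" for c
    using assms by (simp_all add: regular_fields_def)
  have c: "icoord c (perturb W t X) = (\<lambda>x. icoord c W x + t * icoord c X x)" for c
    by (simp add: fun_eq_iff icoord_perturb)
  have "transpose (fst (perturb W t X) y) = fst (perturb W t X) y" if "y \<in> ext" for y
    using assms that
    by (cases W; cases X) (simp add: regular_fields_def transpose_def vec_eq_iff)
  then show "regular_fields (perturb W t X)"
    using twice_diff_linear(1)[OF tW tX] by (simp add: regular_fields_def c)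
  show "jet_of (perturb W t X) x = jet_of W x + t *\<^sub>R jet_of X x" if "x \<in> ext"
    using twice_diff_linear(2,3)[OF tW tX that] by (simp add: jet_of_def c vec_eq_iff)
qed

text \<open>Agreement is asked only near t = 0, since a perturbed metric may degenerate for larger
  t.\<close>

lemma derivative_along_jet:
  assumes F: "(F has_derivative F') (at B)" and f: "\<forall>\<^sub>F t in nhds 0. f t = F (B + t *\<^sub>R V)"
  shows "(f has_real_derivative F' V) (at 0)"
proof -
  interpret F': bounded_linear F'
    using F by (rule has_derivative_bounded_linear)
  have "((\<lambda>t. B + t *\<^sub>R V) has_derivative (\<lambda>t. t *\<^sub>R V)) (at 0)"
    by (auto intro!: derivative_eq_intros)
  moreover have "(F has_derivative F') (at (B + 0 *\<^sub>R V))"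
    using F by simp
  ultimately have "((\<lambda>t. F (B + t *\<^sub>R V)) has_derivative (\<lambda>t. F' (t *\<^sub>R V))) (at 0)"
    by (rule has_derivative_compose)
  then have "((\<lambda>t. F (B + t *\<^sub>R V)) has_real_derivative F' V) (at 0)"
    by (simp add: has_field_derivative_def F'.scaleR mult_commute_abs)
  then show ?thesis
    using f by (subst DERIV_cong_ev[OF refl f refl])
qed

lemma isCont_tendsto_nhds: "isCont f a \<Longrightarrow> (f \<longlongrightarrow> f a) (nhds a)"
  unfolding isCont_def tendsto_at_iff_tendsto_nhds .

context field_point
begin

lemma invertible_jet: "invertible_jet J"
proof
  have "(\<chi> a b. g0 J a b) = g x"
    by (simp add: vec_eq_iff at_metric')
  then show "det ((\<chi> a b. g0 J a b) :: real^3^3) \<noteq> 0"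
    using det by simp
qed

text \<open>Regularity persists for every t, and nondegeneracy is asked at the single point x, so
  continuity of the determinant in t suffices.\<close>

lemma perturbed_field_point:
  assumes X: "regular_fields (h, v, \<psi>)"
  shows "\<forall>\<^sub>F t in nhds 0. field_point (\<lambda>y. g y + t *\<^sub>R h y) (\<lambda>y. u y + t * v y) (\<lambda>y. \<phi> y + t * \<psi> y)
    x (J + t *\<^sub>R jet_of (h, v, \<psi>) x)"
proof -
  have "(\<lambda>t. det (g x + t *\<^sub>R h x)) differentiable (at 0 within UNIV)"
    by (rule differentiable_det) (auto intro!: derivative_intros)
  then have "isCont (\<lambda>t. det (g x + t *\<^sub>R h x)) 0"
    using differentiable_imp_continuous_within by blast
  then have "\<forall>\<^sub>F t in nhds 0. det (g x + t *\<^sub>R h x) \<noteq> 0"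
    using det by (intro tendsto_imp_eventually_ne[OF isCont_tendsto_nhds]) simp_all
  then show ?thesis
    by (rule eventually_mono)
       (use regular_fields_perturb[OF reg X] x J in \<open>auto simp: field_point_def\<close>)
qed

lemma perturbed_boundary_point:
  assumes X: "regular_fields (h, v, \<psi>)" and pos: "sqn x (gi J) > 0"
  shows "\<forall>\<^sub>F t in nhds 0. boundary_point (\<lambda>y. g y + t *\<^sub>R h y) (\<lambda>y. u y + t * v y) (\<lambda>y. \<phi> y + t * \<psi> y)
    x (J + t *\<^sub>R jet_of (h, v, \<psi>) x)"
proof -
  interpret boundary_jet J x
    by (intro boundary_jet.intro invertible_jet) (simp add: boundary_jet_axioms_def pos)
  have "isCont (\<lambda>J. sqn x (gi J)) J"
    using low1_sqn by (auto simp: has_top_def intro: has_derivative_continuous)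
  then have "\<forall>\<^sub>F K in nhds J. sqn x (gi K) > 0"
    using pos by (intro order_tendstoD(1)[OF isCont_tendsto_nhds])
  moreover have "((\<lambda>t. J + t *\<^sub>R jet_of (h, v, \<psi>) x) \<longlongrightarrow> J) (nhds 0)"
    using isCont_tendsto_nhds[where f = "\<lambda>t. J + t *\<^sub>R jet_of (h, v, \<psi>) x" and a = 0] by simp
  ultimately have "\<forall>\<^sub>F t in nhds 0. sqn x (gi (J + t *\<^sub>R jet_of (h, v, \<psi>) x)) > 0"
    by (rule eventually_compose_filterlim)
  with perturbed_field_point[OF X] show ?thesis
    by eventually_elim (simp add: boundary_point_def boundary_point_axioms_def field_point.ip_sqn)
qed

end

lemma twice_diff_whol:
  assumes "f \<in> whol m \<alpha> \<delta>" "2 \<le> m"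
  shows "twice_diff f"
proof -
  have diff: "pds ext is f differentiable_on ext" if "length is < m" for "is"
    using assms(1) that by (auto simp: whol_def Ck_def)
  have "f differentiable_on ext" "pdS i f differentiable_on ext" for i
    using diff[of "[]"] diff[of "[i]"] assms(2) by simp_all
  then show ?thesis
    by (auto simp: twice_diff_def differentiable_on_def)
qed

lemma regular_fieldsI:
  assumes g: "\<And>a b. twice_diff (\<lambda>y. g y $ a $ b)" "twice_diff u" "twice_diff \<phi>"
    and "\<And>y. y \<in> ext \<Longrightarrow> transpose (g y) = g y"
  shows "regular_fields (g, u, \<phi>)"
proof -
  have eq: "icoord c (g, u, \<phi>) = (case c of M11 \<Rightarrow> \<lambda>y. g y $ 1 $ 1 | M12 \<Rightarrow> \<lambda>y. g y $ 1 $ 2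
      | M13 \<Rightarrow> \<lambda>y. g y $ 1 $ 3 | M22 \<Rightarrow> \<lambda>y. g y $ 2 $ 2 | M23 \<Rightarrow> \<lambda>y. g y $ 2 $ 3
      | M33 \<Rightarrow> \<lambda>y. g y $ 3 $ 3 | U \<Rightarrow> u | Phi \<Rightarrow> \<phi>)" for c
    by (cases c) (simp_all add: fun_eq_iff)
  have "twice_diff (icoord c (g, u, \<phi>))" for c
    unfolding eq by (cases c) (simp_all only: icomp.case g)
  then show ?thesis
    using assms(4) by (simp add: regular_fields_def)
qed

lemma regular_fields_Met:
  assumes "g \<in> Met m \<alpha> \<delta>" "u \<in> whol m \<alpha> \<delta>" "\<phi> \<in> whol m \<alpha> \<delta>" "2 \<le> m"
  shows "regular_fields (g, u, \<phi>)"
proof (rule regular_fieldsI)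
  show "twice_diff (\<lambda>y. g y $ a $ b)" for a b
  proof -
    have "(\<lambda>y. g y $ a $ b - mat 1 $ a $ b) \<in> whol m \<alpha> \<delta>"
      using assms(1) by (simp add: Met_def)
    then show ?thesis
      by (rule twice_diff_add_const[OF twice_diff_whol[OF _ assms(4)]])
  qed
  show "twice_diff u" "twice_diff \<phi>"
    using assms(2-4) by (blast intro: twice_diff_whol)+
  show "transpose (g y) = g y" if "y \<in> ext" for y
    using assms(1) that by (simp add: Met_def)
qed

lemma regular_fields_variations:
  assumes "X \<in> variations m \<alpha> \<delta>" "2 \<le> m"
  shows "regular_fields X"
proof -
  obtain h v \<psi> where X: "X = (h, v, \<psi>)"
    by (cases X)
  have "(\<lambda>y. h y $ a $ b) \<in> whol m \<alpha> \<delta>" "v \<in> whol m \<alpha> \<delta>" "\<psi> \<in> whol m \<alpha> \<delta>"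
      "\<And>y. y \<in> ext \<Longrightarrow> transpose (h y) = h y" for a b
    using assms(1) by (simp_all add: X variations_def)
  then show ?thesis
    unfolding X by (intro regular_fieldsI twice_diff_whol[OF _ assms(2)])
qed

context field_point
begin

text \<open>In \<open>gauge_point\<close> the perturbed fields are the varying ones and the
  unperturbed fields the reference: the gauge metric stays g along the variation.\<close>

lemma interior_derivative:
  assumes X: "regular_fields X" and F: "(int_jet J r has_derivative F') (at J)"
  shows "((\<lambda>t. icoord r (L_S g (perturb (g, u, \<phi>) t X)) x) has_real_derivative F' (jet_of X x)) (at 0)"
proof (rule derivative_along_jet[OF F])
  obtain h v \<psi> where h: "X = (h, v, \<psi>)"
    by (cases X)
  show "\<forall>\<^sub>F t in nhds 0. icoord r (L_S g (perturb (g, u, \<phi>) t X)) x = int_jet J r (J + t *\<^sub>R jet_of X x)"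
    using perturbed_field_point[OF X[unfolded h]]
  proof eventually_elim
    case (elim t)
    then have "gauge_point (\<lambda>y. g y + t *\<^sub>R h y) (\<lambda>y. u y + t * v y) (\<lambda>y. \<phi> y + t * \<psi> y)
        x (J + t *\<^sub>R jet_of X x) g u \<phi> J"
      by (simp add: gauge_point_def gauge_point_axioms_def h field_point_axioms)
    then show ?case
      by (simp add: h gauge_point.L_S_jet del: L_S.simps)
  qed
qed

lemma boundary_derivative:
  assumes X: "regular_fields X" and pos: "sqn x (gi J) > 0"
    and F: "(bdry_jet J x e1 e2 (\<gamma> x) (lam x) (f x) b has_derivative F') (at J)"
  shows "((\<lambda>t. bcoord e1 e2 b (B_S g \<gamma> lam f (perturb (g, u, \<phi>) t X)) x)
    has_real_derivative F' (jet_of X x)) (at 0)"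
proof (rule derivative_along_jet[OF F])
  obtain h v \<psi> where h: "X = (h, v, \<psi>)"
    by (cases X)
  show "\<forall>\<^sub>F t in nhds 0. bcoord e1 e2 b (B_S g \<gamma> lam f (perturb (g, u, \<phi>) t X)) x
      = bdry_jet J x e1 e2 (\<gamma> x) (lam x) (f x) b (J + t *\<^sub>R jet_of X x)"
    using perturbed_field_point[OF X[unfolded h]] perturbed_boundary_point[OF X[unfolded h] pos]
  proof eventually_elim
    case (elim t)
    then have "gauge_point (\<lambda>y. g y + t *\<^sub>R h y) (\<lambda>y. u y + t * v y) (\<lambda>y. \<phi> y + t * \<psi> y)
        x (J + t *\<^sub>R jet_of X x) g u \<phi> J"
      by (simp add: gauge_point_def gauge_point_axioms_def h field_point_axioms)
    from bdry_data_jet[OF this] elim(2) show ?case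
      by (simp add: h del: B_S.simps)
  qed
qed

end

section \<open>The linearization and its ellipticity\<close>

text \<open>Assembled from componentwise derivatives, as \<open>is_linearization\<close> speaks of
  components only; \<open>sym_index\<close> fills in the lower triangle.\<close>

definition lin_L :: "(fields \<Rightarrow> fields) \<Rightarrow> fields \<Rightarrow> fields \<Rightarrow> fields"
  where "lin_L L W X = (let D = (\<lambda>c x. deriv (\<lambda>t. icoord c (L (perturb W t X)) x) 0)
    in (\<lambda>x. \<chi> a b. D (sym_index a b) x, D U, D Phi))"

lemma icoord_lin_L: "icoord c (lin_L L W X) x = deriv (\<lambda>t. icoord c (L (perturb W t X)) x) 0"
  by (cases c) (simp_all add: lin_L_def Let_def sym_index_def)

text \<open>The components outside the tangential metric do not depend on the tangent basis, hence
  the dummy basis 0, 0. The tangential slot has to serve every basis at once, so it is the variation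
  h itself, the derivative of \<open>g + t h - \<gamma>\<close>.\<close>

definition lin_B :: "(fields \<Rightarrow> bdata) \<Rightarrow> fields \<Rightarrow> fields \<Rightarrow> bdata"
  where "lin_B B W X = (let D = (\<lambda>b x. deriv (\<lambda>t. bcoord 0 0 b (B (perturb W t X)) x) 0)
    in (\<lambda>x. \<chi> a. D (if a = 1 then G1 else if a = 2 then G2 else G3) x, fst X, D MeanC, D NPhi))"

lemma bcoord_lin_B:
  assumes X: "regular_fields X" and x: "x \<in> ext"
    and der: "((\<lambda>t. bcoord e1 e2 b (B (perturb W t X)) x) has_real_derivative D) (at 0)"
    and T: "bord b = 0 \<Longrightarrow> D = tangential_jet 0 (if b = T22 then e2 else e1) (if b = T11 then e1 else e2) (jet_of X x)"
  shows "bcoord e1 e2 b (lin_B B W X) x = D"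
proof -
  obtain h v \<psi> where h: "X = (h, v, \<psi>)"
    by (cases X)
  have indep: "bcoord e1 e2 b Y x = bcoord 0 0 b Y x" if "bord b \<noteq> 0" for Y
    using that by (cases Y; cases b) simp_all
  have t: "e \<bullet> (h x *v e') = tangential_jet 0 e e' (jet_of X x)" for e e'
    using jet_of_metric(1)[OF X[unfolded h] x]
    by (simp add: tangential_jet_def h inner_vec_def matrix_vector_mult_def fun_eq_iff
        sum_distrib_left mult.assoc)
  show ?thesis
  proof (cases "bord b = 0")
    case True
    then show ?thesis
      using T by (cases b) (simp_all add: lin_B_def Let_def h t)
  next
    case False
    have "deriv (\<lambda>t. bcoord 0 0 b (B (perturb W t X)) x) 0 = D"
      using der unfolding indep[OF False] by (rule DERIV_imp_deriv)
    then show ?thesis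
      using False by (cases b) (simp_all add: lin_B_def Let_def)
  qed
qed

theorem theorem1p1:
  fixes m :: nat and \<alpha> \<delta> :: real
    and g \<gamma> :: tensor2 and u \<phi> lam f :: "real^3 \<Rightarrow> real"
  assumes "m \<ge> 2" and "0 < \<alpha>" "\<alpha> < 1" and "1/2 < \<delta>" "\<delta> < 1"
    and "\<gamma> \<in> bdry_Met m \<alpha>" and "lam \<in> bdry_holder (m - 1) \<alpha>" and "f \<in> bdry_holder (m - 1) \<alpha>"
    and "g \<in> Met m \<alpha> \<delta>" and "u \<in> whol m \<alpha> \<delta>" and "\<phi> \<in> whol m \<alpha> \<delta>"
    and "int_zero (L_S g (g, u, \<phi>))"
    and "bdry_zero (B_S g \<gamma> lam f (g, u, \<phi>))"
  shows "\<exists>DL DB.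
    is_linearization (L_S g) (B_S g \<gamma> lam f) (g, u, \<phi>) (variations m \<alpha> \<delta>) DL DB \<and>
    ADN_elliptic g (variations m \<alpha> \<delta>) DL DB"
proof -
  let ?V = "variations m \<alpha> \<delta>" and ?W = "(g, u, \<phi>)"
  let ?DL = "lin_L (L_S g) ?W" and ?DB = "lin_B (B_S g \<gamma> lam f) ?W"
  define J where "J x = jet_of ?W x" for x
  have reg: "regular_fields ?W"
    using assms by (intro regular_fields_Met)
  have regX: "regular_fields X" if "X \<in> ?V" for X
    using that assms(1) by (rule regular_fields_variations)
  have g_pos: "v \<bullet> (g x *v v) > 0" if "x \<in> ext" "v \<noteq> 0" for x v
    using \<open>g \<in> Met m \<alpha> \<delta>\<close> that by (auto simp: Met_def)
  have field: "field_point g u \<phi> x (J x)" if x: "x \<in> ext" for x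
  proof
    show "det (g x) \<noteq> 0"
    proof
      assume "det (g x) = 0"
      then have "\<not> invertible (g x)"
        by (simp add: invertible_det_nz)
      then obtain v where "v \<noteq> 0" "g x *v v = 0"
        using matrix_left_invertible_ker[of "g x"] invertible_left_inverse[of "g x"] by blast
      then show False
        using g_pos[OF x] by force
    qed
  qed (use reg x J_def in auto)
  have definite: "definite_jet (J x)" if x: "x \<in> ext" for x
  proof -
    interpret field_point g u \<phi> x "J x"
      by (rule field[OF x])
    have "(\<Sum>a\<in>UNIV. \<Sum>b\<in>UNIV. g0 (J x) a b * v $ a * v $ b) = v \<bullet> (g x *v v)" for v
      by (simp add: inner_vec_def matrix_vector_mult_def at_metric' sum_distrib_left ac_simps)
    then show ?thesis
      using g_pos[OF x] invertible_jet by (simp add: definite_jet_def definite_jet_axioms_def)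
  qed
  have bdry: "x \<in> ext" "x \<noteq> 0" "sqn x (gi (J x)) > 0" if "x \<in> bdry" for x
  proof -
    show x: "x \<in> ext" and x0: "x \<noteq> 0"
      using that by (auto simp: bdry_def ext_def)
    show "sqn x (gi (J x)) > 0"
      using definite_jet.ipc_pos[OF definite[OF x] x0] definite_jet.ipc_def[OF definite[OF x]]
      by (simp add: sqn_def)
  qed
  have interior: "\<exists>F' a. (int_jet (J x) r has_derivative F') (at (J x)) \<and>
      (\<forall>X. F' (jet_of X x) = diff_expr 2 a X x) \<and>
      (\<forall>c is. length is = 2 \<longrightarrow> a c is = invertible_jet.int_top (J x) r (jet_basis c is))"
    if "x \<in> ext" for x r
  proof -
    interpret invertible_jet "J x"
      using definite[OF that] by (simp add: definite_jet_def)
    show ?thesis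
      by (rule has_top_diff_expr[OF top2_int[of r] order_refl]) (linarith, blast)
  qed
  have int_deriv: "\<exists>a. (\<forall>X\<in>?V. ((\<lambda>t. icoord r (L_S g (perturb ?W t X)) x) has_real_derivative
        icoord r (?DL X) x) (at 0) \<and> icoord r (?DL X) x = diff_expr 2 a X x) \<and>
      (\<forall>c is. length is = 2 \<longrightarrow> a c is = invertible_jet.int_top (J x) r (jet_basis c is))"
    if x: "x \<in> ext" for x r
  proof -
    obtain F' a where F': "(int_jet (J x) r has_derivative F') (at (J x))"
        and a: "\<And>X. F' (jet_of X x) = diff_expr 2 a X x"
          "\<And>c is. length is = 2 \<Longrightarrow> a c is = invertible_jet.int_top (J x) r (jet_basis c is)"
      using interior[OF x, of r] by blast
    have "((\<lambda>t. icoord r (L_S g (perturb ?W t X)) x) has_real_derivative diff_expr 2 a X x) (at 0)"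
      if "X \<in> ?V" for X
      using field_point.interior_derivative[OF field[OF x] regX[OF that] F'] by (simp only: a(1))
    then show ?thesis
      using a(2) DERIV_imp_deriv unfolding icoord_lin_L by (intro exI[of _ a]) fastforce
  qed
  have bdry_deriv: "\<exists>a. (\<forall>X\<in>?V. ((\<lambda>t. bcoord e1 e2 b (B_S g \<gamma> lam f (perturb ?W t X)) x)
        has_real_derivative bcoord e1 e2 b (?DB X) x) (at 0) \<and>
        bcoord e1 e2 b (?DB X) x = diff_expr (bord b) a X x) \<and>
      (\<forall>c is. length is = bord b \<longrightarrow> a c is = boundary_jet.bdry_top (J x) x e1 e2 b (jet_basis c is))"
    if x: "x \<in> bdry" for x e1 e2 b
  proof -
    interpret boundary_jet "J x" x
      using definite[OF bdry(1)[OF x]] bdry(3)[OF x]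
      by (simp add: boundary_jet_def boundary_jet_axioms_def definite_jet_def)
    have le: "bord b \<le> 2"
      by (cases b) simp_all
    \<comment> \<open>Each boundary part involves derivatives of exactly its own order, so unit jets
      of higher order give 0.\<close>
    have P: "bdry_top e1 e2 b (jet_basis c is) = 0" if "bord b < length is" "length is \<le> 2" for c "is"
    proof -
      from that(2) consider "is = []" | i where "is = [i]" | i j where "is = [i, j]"
        by (auto simp: le_Suc_eq length_Suc_conv numeral_2_eq_2)
      then show ?thesis
        using that(1)
        by cases (cases b; simp add: bdry_top_def gauge_top_def mean_curv_top_def g0_def g1_def j_jet_basis)+
    qed
    obtain F' a where F': "(bdry_jet (J x) x e1 e2 (\<gamma> x) (lam x) (f x) b has_derivative F') (at (J x))"
        and a: "\<And>X y. F' (jet_of X y) = diff_expr (bord b) a X y"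
          "\<And>c is. length is = bord b \<Longrightarrow> a c is = bdry_top e1 e2 b (jet_basis c is)"
        and F'_top: "\<And>V. V \<in> top_jets (bord b) \<Longrightarrow> F' V = bdry_top e1 e2 b V"
      by (rule has_top_diff_expr[OF top_bdry[where k = "\<gamma> x" and l = "lam x" and m = "f x"] le P]) blast+
    have "((\<lambda>t. bcoord e1 e2 b (B_S g \<gamma> lam f (perturb ?W t X)) x) has_real_derivative
        bcoord e1 e2 b (?DB X) x) (at 0) \<and> bcoord e1 e2 b (?DB X) x = diff_expr (bord b) a X x"
      if X: "X \<in> ?V" for X
    proof -
      have D: "((\<lambda>t. bcoord e1 e2 b (B_S g \<gamma> lam f (perturb ?W t X)) x)
          has_real_derivative F' (jet_of X x)) (at 0)"
        by (rule field_point.boundary_derivative[where \<gamma> = \<gamma> and lam = lam and f = f,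
              OF field[OF bdry(1)[OF x]] regX[OF X] bdry(3)[OF x] F'])
      moreover have "bcoord e1 e2 b (?DB X) x = F' (jet_of X x)"
      proof (rule bcoord_lin_B[OF regX[OF X] bdry(1)[OF x] D])
        \<comment> \<open>At order 0 every jet is a top jet, so F' is completely known on the
          tangential components.\<close>
        assume "bord b = 0"
        then show "F' (jet_of X x) = tangential_jet 0 (if b = T22 then e2 else e1)
            (if b = T11 then e1 else e2) (jet_of X x)"
          using F'_top[of "jet_of X x"]
          by (cases b) (simp_all add: top_jets_def bdry_top_def tangential_jet_def)
      qed
      ultimately show ?thesis
        by (simp add: a(1))
    qed
    then show ?thesis
      using a(2) by blast
  qed
  \<comment> \<open>The interior coefficients must form one family on all of \<open>ext\<close>,
    whereas the boundary coefficients may be chosen separately for each point and tangent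
    basis.\<close>
  have "\<exists>A. \<forall>x\<in>ext. \<forall>r. (\<forall>X\<in>?V. ((\<lambda>t. icoord r (L_S g (perturb ?W t X)) x) has_real_derivative
        icoord r (?DL X) x) (at 0) \<and> icoord r (?DL X) x = diff_expr 2 (A x r) X x) \<and>
      (\<forall>c is. length is = 2 \<longrightarrow> A x r c is = invertible_jet.int_top (J x) r (jet_basis c is))"
    by (intro bchoice ballI choice allI int_deriv)
  then obtain A where A: "\<And>x r X. x \<in> ext \<Longrightarrow> X \<in> ?V \<Longrightarrow>
        ((\<lambda>t. icoord r (L_S g (perturb ?W t X)) x) has_real_derivative icoord r (?DL X) x) (at 0)"
      "\<And>x r X. x \<in> ext \<Longrightarrow> X \<in> ?V \<Longrightarrow> icoord r (?DL X) x = diff_expr 2 (A x r) X x"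
      "\<And>x r c is. x \<in> ext \<Longrightarrow> length is = 2 \<Longrightarrow>
        A x r c is = invertible_jet.int_top (J x) r (jet_basis c is)"
    by blast
  have "is_linearization (L_S g) (B_S g \<gamma> lam f) ?W ?V ?DL ?DB"
    unfolding is_linearization_def using A(1) bdry_deriv by blast
  moreover have "ADN_elliptic g ?V ?DL ?DB"
    unfolding ADN_elliptic_def
  proof (intro exI[of _ A] conjI ballI allI impI)
    fix x assume x: "x \<in> ext"
    show "icoord r (?DL X) x = diff_expr (iord r) (A x r) X x" if "X \<in> ?V" for X r
      using A(2)[OF x that] by (simp add: iord_def)
    show "ADN_interior (A x)"
      by (rule definite_jet.interior_elliptic[OF definite[OF x] A(3)[OF x]])
  next
    fix x e1 e2 assume xb: "x \<in> bdry" and e: "tangent_basis x e1 e2"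
    have "\<exists>C. \<forall>b. (\<forall>X\<in>?V. bcoord e1 e2 b (?DB X) x = diff_expr (bord b) (C b) X x) \<and>
        (\<forall>c is. length is = bord b \<longrightarrow> C b c is = boundary_jet.bdry_top (J x) x e1 e2 b (jet_basis c is))"
      using bdry_deriv[OF xb] by (intro choice) blast
    then obtain C where C: "\<And>X b. X \<in> ?V \<Longrightarrow> bcoord e1 e2 b (?DB X) x = diff_expr (bord b) (C b) X x"
        "\<And>b c is. length is = bord b \<Longrightarrow> C b c is = boundary_jet.bdry_top (J x) x e1 e2 b (jet_basis c is)"
      by blast
    interpret field_point g u \<phi> x "J x"
      by (rule field[OF bdry(1)[OF xb]])
    interpret boundary_point g u \<phi> x "J x"
      by unfold_locales (use bdry(3)[OF xb] ip_sqn in simp)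
    interpret definite_jet "J x"
      by (rule definite[OF bdry(1)[OF xb]])
    interpret boundary_definite "J x" x
      by unfold_locales (use bdry(3)[OF xb] in simp)
    have "ADN_boundary g x (A x) C"
      unfolding ADN_boundary_def Let_def
    proof (intro allI impI boundary_elliptic)
      fix \<eta> \<mu> assume \<eta>\<mu>: "\<eta> \<noteq> 0 \<and> \<eta> \<bullet> normal g x = 0 \<and> unit_conormal g x \<mu>"
      show "(\<Sum>a\<in>UNIV. \<eta> $ a * N a) = 0"
        using \<eta>\<mu> by (simp add: inner_vec_def normal_nrm)
      show "ipc \<mu> \<mu> = 1"
        using \<eta>\<mu> by (simp add: unit_conormal_def ip_def ipc_def at_metric')
    qed (use A(3)[OF bdry(1)[OF xb]] C(2) e bdry(2)[OF xb] in \<open>auto simp: unit_conormal_def\<close>)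
    then show "\<exists>C. (\<forall>X\<in>?V. \<forall>b. bcoord e1 e2 b (?DB X) x = diff_expr (bord b) (C b) X x) \<and>
        ADN_boundary g x (A x) C"
      using C(1) by blast
  qed
  ultimately show ?thesis
    by blast
qed

end
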